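(* Let $\Lambda$ be a $d$-dimensional lattice, let $\bm\alpha\in\mathbb{N}^d$ and let $\nu\in\mathbb{C}$. (1) For $\bm x \notin \Lambda$ and $\bm y \notin \Lambda^*$, the anisotropic Epstein zeta function $Z_{\Lambda,\nu,\bm\alpha}(\bm x,\bm y)$ can be holomorphically extended to $(\nu,\bm x,\bm y)\in\mathbb{C}\times D_{\Lambda}\times D_{\Lambda^*}$. (2) For (fixed) $\bm x\in\Lambda$ and $\bm y \notin \Lambda^*$, it can be holomorphically extended to $(\nu,\bm y)\in \mathbb{C}\times D_{\Lambda^*}$. (3) For (fixed) $\bm y \in \Lambda^*$, $\bm x \notin \Lambda$, and $\chi(\bm\alpha)=0$, it can be holomorphically extended to $(\nu,\bm x)\in \mathbb{C}\times D_{\Lambda}$; and for $\chi(\bm\alpha)=1$ it can be holomorphically extended to $(\nu,\bm x)\in (\mathbb{C}\setminus\{d+|\bm\alpha|\})\times D_{\Lambda}$, with a simple pole at $\nu = d+|\bm\alpha|$. (4) For $\bm x\in\Lambda$, $\bm y\in\Lambda^*$, and $\chi(\bm\alpha)=0$, it is holomorphic in $\nu\in\mathbb{C}$; and for $\chi(\bm\alpha)=1$ it is holomorphic in $\nu\in\mathbb{C}\setminus\{d+|\bm\alpha|\}$ with a simple pole at $\nu=d+|\bm\alpha|$.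
   Context: $\mathbb{N}=\{0,1,2,\dots\}$, $d\ge 1$ is an integer, $0^0=1$. A $d$-dimensional lattice is $\Lambda=A\mathbb{Z}^d$ with $A\in\mathbb{R}^{d\times d}$ regular; its reciprocal lattice is $\Lambda^*=A^{-T}\mathbb{Z}^d$. For $\bm\alpha\in\mathbb{N}^d$, $|\bm\alpha|=\sum_j\alpha^{(j)}$ and $\bm z^{\bm\alpha}=\prod_j (z^{(j)})^{\alpha^{(j)}}$; for vectors $|\cdot|$ is the Euclidean norm. $\chi(\bm\alpha)=1$ if all components of $\bm\alpha$ are even and $\chi(\bm\alpha)=0$ otherwise. For $L\subseteq\mathbb{R}^d$ define $$D_L=\{\bm u\in\mathbb{C}^d:|\mathrm{Re}(\bm u)-\bm z|>|\mathrm{Im}(\bm u)|\ \text{ for all } \bm z\in L\},$$ real and imaginary parts taken componentwise. Anisotropic Epstein zeta function: for $\bm x,\bm y\in\mathbb{R}^d$, $Z_{\Lambda,\nu,\bm\alpha}(\bm x,\bm y)$ is defined for $\mathrm{Re}(\nu)>d+|\bm\alpha|$ by $$\sum_{\bm z\in\Lambda,\ \bm z\ne\bm x} e^{-2\pi i\bm y\cdot\bm z}\,\frac{(\bm z-\bm x)^{\bm\alpha}}{|\bm z-\bm x|^{\nu}}$$ and by meromorphic continuation to $\nu\in\mathbb{C}$. "Can be holomorphically extended to" a set means: there is a jointly holomorphic function on that set which agrees with $Z_{\Lambda,\nu,\bm\alpha}(\bm x,\bm y)$ for the real values of the vector arguments considered in the respective case. *)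

theory Defs
  imports "HOL-Complex_Analysis.Complex_Analysis"
begin

(* Complex scalar multiplication on C, C^d and their finite products, compatible with the real
   one of the library; it is needed to say that a Frechet derivative is complex linear. *)
class complex_normed_vector = real_normed_vector +
  fixes scaleC :: "complex \<Rightarrow> 'a \<Rightarrow> 'a"
  assumes scaleC_add_right: "scaleC c (x + y) = scaleC c x + scaleC c y"
    and scaleC_add_left: "scaleC (b + c) x = scaleC b x + scaleC c x"
    and scaleC_scaleC: "scaleC b (scaleC c x) = scaleC (b * c) x"
    and scaleC_of_real: "scaleC (complex_of_real r) x = r *\<^sub>R x"
    and norm_scaleC: "norm (scaleC c x) = cmod c * norm x"

instantiation complex :: complex_normed_vector
begin
definition scaleC_complex :: "complex \<Rightarrow> complex \<Rightarrow> complex" where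
  "scaleC_complex c z = c * z"
instance
  by standard (simp_all add: scaleC_complex_def algebra_simps norm_mult scaleR_conv_of_real)
end

instantiation prod :: (complex_normed_vector, complex_normed_vector) complex_normed_vector
begin
definition scaleC_prod :: "complex \<Rightarrow> 'a \<times> 'b \<Rightarrow> 'a \<times> 'b" where
  "scaleC_prod c p = (scaleC c (fst p), scaleC c (snd p))"
instance
  by standard
    (auto simp: scaleC_prod_def scaleC_add_right scaleC_add_left scaleC_scaleC scaleC_of_real
      norm_scaleC norm_prod_def power_mult_distrib real_sqrt_mult
      simp flip: distrib_left intro: prod_eqI)
end

instantiation vec :: (complex_normed_vector, finite) complex_normed_vector
begin
definition scaleC_vec :: "complex \<Rightarrow> 'a ^ 'b \<Rightarrow> 'a ^ 'b" where
  "scaleC_vec c v = (\<chi> i. scaleC c (v $ i))"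
instance
  by standard
    (simp_all add: scaleC_vec_def vec_eq_iff scaleC_add_right scaleC_add_left scaleC_scaleC
      scaleC_of_real norm_scaleC norm_vec_def L2_set_right_distrib)
end

definition jointly_holomorphic_on ::
    "('a::complex_normed_vector \<Rightarrow> complex) \<Rightarrow> 'a set \<Rightarrow> bool" where
  "jointly_holomorphic_on F S \<longleftrightarrow> open S \<and>
     (\<forall>p\<in>S. \<exists>F'. (F has_derivative F') (at p) \<and> (\<forall>c v. F' (scaleC c v) = c * F' v))"

definition lattice_of :: "real ^ 'd ^ 'd \<Rightarrow> (real ^ 'd) set" where
  "lattice_of A = {A *v k | k. \<forall>i. k $ i \<in> \<int>}"

definition reciprocal_lattice_of :: "real ^ 'd ^ 'd \<Rightarrow> (real ^ 'd) set" where
  "reciprocal_lattice_of A = lattice_of (transpose (matrix_inv A))"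

definition multi_abs :: "nat ^ 'd \<Rightarrow> nat" where
  "multi_abs \<alpha> = (\<Sum>j\<in>UNIV. \<alpha> $ j)"

definition multi_power :: "real ^ 'd \<Rightarrow> nat ^ 'd \<Rightarrow> real" where
  "multi_power z \<alpha> = (\<Prod>j\<in>UNIV. (z $ j) ^ (\<alpha> $ j))"

definition even_indicator :: "nat ^ 'd \<Rightarrow> nat" where
  "even_indicator \<alpha> = (if \<forall>j. even (\<alpha> $ j) then 1 else 0)"

definition Re_vec :: "complex ^ 'd \<Rightarrow> real ^ 'd" where
  "Re_vec u = (\<chi> j. Re (u $ j))"

definition Im_vec :: "complex ^ 'd \<Rightarrow> real ^ 'd" where
  "Im_vec u = (\<chi> j. Im (u $ j))"

definition complex_vec :: "real ^ 'd \<Rightarrow> complex ^ 'd" where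
  "complex_vec x = (\<chi> j. complex_of_real (x $ j))"

definition D_set :: "(real ^ 'd) set \<Rightarrow> (complex ^ 'd) set" where
  "D_set L = {u. \<forall>z\<in>L. norm (Re_vec u - z) > norm (Im_vec u)}"

definition epstein_series ::
    "(real ^ 'd) set \<Rightarrow> nat ^ 'd \<Rightarrow> real ^ 'd \<Rightarrow> real ^ 'd \<Rightarrow> complex \<Rightarrow> complex" where
  "epstein_series \<Lambda> \<alpha> x y \<nu> =
     (\<Sum>\<^sub>\<infinity>z\<in>\<Lambda> - {x}. exp (- 2 * of_real pi * \<i> * of_real (y \<bullet> z)) *
        of_real (multi_power (z - x) \<alpha>) / of_real (norm (z - x)) powr \<nu>)"

(* Meromorphic continuation from an open set U to the whole plane. Being nicely meromorphic
   fixes the values: removable singularities are filled in and the value at a pole is 0. *)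
definition is_meromorphic_continuation ::
    "(complex \<Rightarrow> complex) \<Rightarrow> complex set \<Rightarrow> (complex \<Rightarrow> complex) \<Rightarrow> bool" where
  "is_meromorphic_continuation f U g \<longleftrightarrow>
     g nicely_meromorphic_on UNIV \<and> (\<forall>s\<in>U. g s = f s)"

definition meromorphic_continuation ::
    "(complex \<Rightarrow> complex) \<Rightarrow> complex set \<Rightarrow> complex \<Rightarrow> complex" where
  "meromorphic_continuation f U = (THE g. is_meromorphic_continuation f U g)"

lemma is_meromorphic_continuation_unique:
  assumes "is_meromorphic_continuation f U g" "is_meromorphic_continuation f U h"
    and U: "open U" "U \<noteq> {}"
  shows "g = h"
proof -
  have g: "g nicely_meromorphic_on UNIV" and h: "h nicely_meromorphic_on UNIV"
    and eq: "\<And>s. s \<in> U \<Longrightarrow> g s = h s"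
    using assms unfolding is_meromorphic_continuation_def by auto
  have mero: "(\<lambda>s. g s - h s) meromorphic_on UNIV"
    using g h unfolding nicely_meromorphic_on_def by (intro meromorphic_intros) auto
  obtain s0 where s0: "s0 \<in> U" using U by auto
  have ev0: "\<forall>\<^sub>F s in at s0. g s - h s = 0"
    using eventually_at_in_open'[OF U(1) s0] by (rule eventually_mono) (use eq in auto)
  have cosp: "\<forall>\<^sub>\<approx>s\<in>UNIV. g s - h s = 0"
  proof (rule ccontr)
    assume "\<not> (\<forall>\<^sub>\<approx>s\<in>UNIV. g s - h s = 0)"
    then have "\<forall>\<^sub>\<approx>s\<in>UNIV. g s - h s \<noteq> 0"
      using meromorphic_imp_constant_or_avoid[OF mero, of 0] by auto
    then have "\<forall>\<^sub>F s in at s0. g s - h s \<noteq> 0"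
      by (simp add: eventually_cosparse_open_eq)
    then have "\<forall>\<^sub>F s in at s0. False" using ev0 by eventually_elim simp
    then show False by simp
  qed
  show ?thesis
  proof
    fix s
    have ev: "\<forall>\<^sub>F w in at s. g w = h w"
      using cosp by (simp add: eventually_cosparse_open_eq)
    have pole: "is_pole g s \<longleftrightarrow> is_pole h s" using ev by (intro is_pole_cong) auto
    show "g s = h s"
    proof (cases "is_pole g s")
      case True
      then have "\<not> g \<midarrow>s\<rightarrow> g s" "\<not> h \<midarrow>s\<rightarrow> h s"
        using pole not_tendsto_and_filterlim_at_infinity[of "at s"] unfolding is_pole_def by auto
      then have "g s = 0" "h s = 0"
        using g h unfolding nicely_meromorphic_on_def by blast+
      then show ?thesis by simp
    next
      case False
      then have "g \<midarrow>s\<rightarrow> g s" "h \<midarrow>s\<rightarrow> h s"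
        using g h pole unfolding nicely_meromorphic_on_def by auto
      moreover have "h \<midarrow>s\<rightarrow> g s" using calculation(1) tendsto_cong[OF ev] by blast
      ultimately show ?thesis using tendsto_unique[of "at s"] by auto
    qed
  qed
qed

lemma meromorphic_continuation_eqI:
  assumes "is_meromorphic_continuation f U g" "open U" "U \<noteq> {}"
  shows "meromorphic_continuation f U = g"
  unfolding meromorphic_continuation_def
  using assms is_meromorphic_continuation_unique by blast

definition epstein_zeta ::
    "(real ^ 'd) set \<Rightarrow> complex \<Rightarrow> nat ^ 'd \<Rightarrow> real ^ 'd \<Rightarrow> real ^ 'd \<Rightarrow> complex" where
  "epstein_zeta \<Lambda> \<nu> \<alpha> x y =
     meromorphic_continuation (epstein_series \<Lambda> \<alpha> x y)
       {s. Re s > real (CARD('d) + multi_abs \<alpha>)} \<nu>"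

definition has_simple_pole :: "(complex \<Rightarrow> complex) \<Rightarrow> complex \<Rightarrow> bool" where
  "has_simple_pole f s \<longleftrightarrow> isolated_singularity_at f s \<and> is_pole f s \<and> zorder f s = - 1"

end

theory Submission
  imports Defs "HOL-Real_Asymp.Real_Asymp"
begin

text \<open>
  Write the terms of the series as Mellin transforms of Gaussians in \<open>t = exp s\<close> and split the integral
  at \<open>s = 0\<close>. The part \<open>s \<ge> 0\<close> is, after summation over \<open>z \<in> \<Lambda>\<close>, dominated locally uniformly in
  \<open>(\<nu>, u, v) \<in> \<complex> \<times> D_\<Lambda> \<times> \<complex>\<^sup>d\<close>, because \<open>u \<in> D_\<Lambda>\<close> says precisely that \<open>Re ((z - u)\<^sup>2) > 0\<close> for all \<open>z\<close>; it is
  therefore jointly holomorphic. Poisson summation turns the part \<open>s \<le> 0\<close> into an integral of the same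
  shape over the reciprocal lattice, with \<open>\<nu>\<close> replaced by \<open>d + |\<alpha>| - \<nu>\<close> and the monomial by a Hermite
  polynomial. The terms \<open>z = x\<close> and \<open>z = y\<close> that the series or its dual lack are elementary integrals;
  the one at \<open>y\<close> produces the pole \<open>1 / (\<nu> - d - |\<alpha>|)\<close>, whose residue is a multiple of the Hermite polynomial
  at 0, and this vanishes iff some component of \<open>\<alpha>\<close> is odd. The factor \<open>1 / \<Gamma>(\<nu>/2)\<close>
  absorbs the term at \<open>x\<close>, which is proportional to \<open>1 / \<nu>\<close>.

  For Poisson summation, the Fourier coefficients of the periodised Gaussian follow by tiling space with
  unit cubes, powers of the coordinates by differentiating termwise in \<open>y\<close>, and general \<open>t\<close> by
  rescaling the lattice.
\<close>

section \<open>Parametric integrals of functions holomorphic in several variables\<close>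

text \<open>In the variable \<open>s\<close> the substitution of \<open>1 / t\<close> for
  \<open>t\<close> is a reflection, so both halves live on \<open>s \<ge> 0\<close>, where
  \<open>exp (- pi * exp s * X)\<close> with \<open>X > 0\<close> beats every power of
  \<open>t\<close> and hence every \<nu>. Both are instances of one integral \<open>eint\<close>
  with a centre and a frequency; in the dual one v is the centre and - u the frequency. A frequency
  may be any complex vector, a centre must lie in \<open>D_set\<close>: the first half restricts u,
  the second v. Deleting a point from a lattice puts that point into the domain, which is how x and
  y on the lattices are treated. One formula with the weights \<omega> and \<tau> of the deleted
  terms serves all four cases. The obstacle is the exchange of sum and integral on
  \<open>s \<le> 0\<close>. It needs a bound for sums of absolute values, which an identity between
  oscillating sums does not give. The bound comes from the Poisson formula without weight and
  character, whose lattice side is positive; there the condition on Re \<nu> enters.\<close>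

definition has_clinear_derivative ::
    "('a::complex_normed_vector \<Rightarrow> complex) \<Rightarrow> ('a \<Rightarrow> complex) \<Rightarrow> 'a \<Rightarrow> bool" where
  "has_clinear_derivative f f' p \<longleftrightarrow>
     (f has_derivative f') (at p) \<and> (\<forall>c v. f' (scaleC c v) = c * f' v)"

lemma has_clinear_derivative_const: "has_clinear_derivative (\<lambda>_. c) (\<lambda>_. 0) p"
  unfolding has_clinear_derivative_def by auto

lemma has_clinear_derivative_add:
  assumes "has_clinear_derivative f f' p" "has_clinear_derivative g g' p"
  shows "has_clinear_derivative (\<lambda>q. f q + g q) (\<lambda>h. f' h + g' h) p"
  using assms unfolding has_clinear_derivative_def
  by (auto intro!: derivative_eq_intros simp: algebra_simps)

lemma has_clinear_derivative_mult:
  assumes "has_clinear_derivative f f' p" "has_clinear_derivative g g' p"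
  shows "has_clinear_derivative (\<lambda>q. f q * g q) (\<lambda>h. f p * g' h + f' h * g p) p"
  using assms unfolding has_clinear_derivative_def
  by (auto intro!: has_derivative_mult simp: algebra_simps)

lemma has_clinear_derivative_comp:
  assumes "has_clinear_derivative f f' p" "(g has_field_derivative g') (at (f p))"
  shows "has_clinear_derivative (\<lambda>q. g (f q)) (\<lambda>h. g' * f' h) p"
  unfolding has_clinear_derivative_def
proof (intro conjI allI)
  have "(f has_derivative f') (at p)" and "(g has_derivative (*) g') (at (f p))"
    using assms unfolding has_clinear_derivative_def has_field_derivative_def by auto
  then show "((\<lambda>q. g (f q)) has_derivative (\<lambda>h. g' * f' h)) (at p)"
    using has_derivative_compose by fastforce
qed (use assms in \<open>auto simp: has_clinear_derivative_def algebra_simps\<close>)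

lemma bounded_linear_scaleC_left:
  "bounded_linear (\<lambda>w. scaleC w (h::'a::complex_normed_vector))"
proof (rule bounded_linear_intro[where K="norm h"])
  fix r :: real and x :: complex
  show "scaleC (r *\<^sub>R x) h = r *\<^sub>R scaleC x h"
    by (metis scaleC_of_real scaleC_scaleC scaleR_conv_of_real)
qed (auto simp: scaleC_add_left norm_scaleC)

lemma scaleC_zero_left [simp]: "scaleC 0 (h::'a::complex_normed_vector) = 0"
  using bounded_linear.linear[OF bounded_linear_scaleC_left[of h]] linear_0 by blast

lemma has_clinear_derivative_comp_affine:
  assumes f: "has_clinear_derivative f f' (T p)"
    and T: "bounded_linear T'" "\<And>q. T q = T' q + a" "\<And>c v. T' (scaleC c v) = scaleC c (T' v)"
  shows "has_clinear_derivative (\<lambda>q. f (T q)) (\<lambda>h. f' (T' h)) p"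
  unfolding has_clinear_derivative_def
proof (intro conjI allI)
  have "(T has_derivative T') (at p)"
    unfolding T(2) by (auto intro!: derivative_eq_intros bounded_linear_imp_has_derivative T(1))
  then show "((\<lambda>q. f (T q)) has_derivative (\<lambda>h. f' (T' h))) (at p)"
    using f has_derivative_compose unfolding has_clinear_derivative_def by blast
qed (use f T(3) in \<open>auto simp: has_clinear_derivative_def\<close>)

text \<open>On a complex line the Frechet derivative becomes multiplication by the number
  \<open>f' h\<close>, because \<open>f'\<close> commutes with \<open>scaleC\<close>. This opens
  one-variable theory, the Cauchy estimate and the identity theorem, to functions on
  \<open>'a\<close>.\<close>

lemma has_field_derivative_line:
  assumes "has_clinear_derivative f f' (p + scaleC w h)"
  shows "((\<lambda>w. f (p + scaleC w h)) has_field_derivative f' h) (at w)"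
proof -
  have "((\<lambda>w. p + scaleC w h) has_derivative (\<lambda>w. scaleC w h)) (at w)"
    by (auto intro!: derivative_eq_intros bounded_linear_imp_has_derivative
        bounded_linear_scaleC_left)
  moreover have "(f has_derivative f') (at (p + scaleC w h))" "\<And>c. f' (scaleC c h) = c * f' h"
    using assms by (auto simp: has_clinear_derivative_def)
  ultimately show ?thesis
    using has_derivative_compose[of "\<lambda>w. p + scaleC w h" "\<lambda>w. scaleC w h" w UNIV f f']
    by (simp add: has_field_derivative_def mult.commute[of _ "f' h"] fun_eq_iff)
qed

text \<open>The Cauchy estimate on the complex line through \<open>p\<close> in direction \<open>h\<close>.\<close>

lemma clinear_derivative_bounds:
  fixes f :: "'a::complex_normed_vector \<Rightarrow> complex"
  assumes r: "r > 0"
    and f: "\<And>q. q \<in> ball p r \<Longrightarrow> has_clinear_derivative f (f' q) q"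
    and B: "\<And>q. q \<in> ball p r \<Longrightarrow> norm (f q) \<le> B"
  shows "norm (f' p h) \<le> 4 * B / r * norm h"
    and "norm h < r / 2 \<Longrightarrow> norm (f (p + h) - f p) \<le> 4 * B / r * norm h"
proof -
  have B0: "B \<ge> 0" using B[of p] r by (auto intro: order_trans[OF norm_ge_zero])
  have *: "norm (f' p h) \<le> 4 * B / r * norm h \<and>
     (norm h < r / 2 \<longrightarrow> norm (f (p + h) - f p) \<le> 4 * B / r * norm h)"
  proof (cases "h = 0")
    case True
    have "linear (f' p)"
      using f[of p] r by (auto simp: has_clinear_derivative_def dest: has_derivative_linear)
    then show ?thesis using True by (simp add: linear_0)
  next
    case False
    define e where "e = (1 / norm h) *\<^sub>R h"
    have ne: "norm e = 1" using False by (simp add: e_def)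
    have he: "h = scaleC (norm h) e" using False by (simp add: e_def scaleC_of_real)
    define g where "g = (\<lambda>w. f (p + scaleC w e))"
    have in_ball: "p + scaleC w e \<in> ball p r" if "norm w < r" for w
      using that by (simp add: dist_norm norm_scaleC ne)
    have gd: "(g has_field_derivative f' (p + scaleC w e) e) (at w)" if "norm w < r" for w
      unfolding g_def by (rule has_field_derivative_line[OF f[OF in_ball[OF that]]])
    \<comment> \<open>A circle of radius \<open>r / 4\<close> about a point of modulus below
      \<open>r / 2\<close> stays inside the ball. This is the origin of the factor 4 and of the
      restriction \<open>norm h < r / 2\<close>.\<close>
    have bd: "norm (f' (p + scaleC w e) e) \<le> 4 * B / r" if w: "norm w < r / 2" for w
    proof -
      have nr: "norm x < r" if "dist w x \<le> r / 4" for x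
        using that w norm_triangle_sub[of x w] r by (simp add: dist_norm norm_minus_commute)
      have "norm ((deriv ^^ 1) g w) \<le> fact 1 * B / (r / 4) ^ 1"
      proof (rule Cauchy_inequality)
        show "g holomorphic_on ball w (r / 4)"
          unfolding holomorphic_on_def field_differentiable_def
        proof (intro ballI exI)
          fix x assume "x \<in> ball w (r / 4)"
          then show "(g has_field_derivative f' (p + scaleC x e) e) (at x within ball w (r / 4))"
            by (intro has_field_derivative_at_within[OF gd] nr) simp
        qed
        show "continuous_on (cball w (r / 4)) g"
          by (rule DERIV_continuous_on[OF has_field_derivative_at_within, OF gd[OF nr]]) simp
        show "norm (g x) \<le> B" if "norm (w - x) = r / 4" for x
          unfolding g_def by (intro B in_ball nr) (simp add: dist_norm that)
      qed (use r in auto)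
      moreover have "deriv g w = f' (p + scaleC w e) e"
        using gd[of w] w r by (intro DERIV_imp_deriv) auto
      ultimately show ?thesis by (simp add: field_simps)
    qed
    have "f' p (scaleC (norm h) e) = norm h * f' p e"
      using f[of p] r by (simp add: has_clinear_derivative_def)
    then have "norm (f' p h) = norm h * norm (f' p e)"
      by (simp add: he[symmetric] norm_mult)
    also have "\<dots> \<le> norm h * (4 * B / r)"
      using bd[of 0] r by (intro mult_left_mono) auto
    finally have 1: "norm (f' p h) \<le> 4 * B / r * norm h" by (simp add: mult.commute)
    have 2: "norm (f (p + h) - f p) \<le> 4 * B / r * norm h" if "norm h < r / 2"
    proof -
      have "norm (g (norm h) - g 0) \<le> 4 * B / r * norm (complex_of_real (norm h) - 0)"
      proof (rule field_differentiable_bound[where S="ball 0 (r/2)"])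
        show "(g has_field_derivative f' (p + scaleC w e) e) (at w within ball 0 (r/2))"
          if "w \<in> ball 0 (r/2)" for w
          using that r by (intro has_field_derivative_at_within[OF gd]) auto
      qed (use that bd r in auto)
      then show ?thesis by (simp add: g_def he[symmetric])
    qed
    show ?thesis using 1 2 by simp
  qed
  show "norm (f' p h) \<le> 4 * B / r * norm h"
    by (rule conjunct1[OF *])
  show "norm (f (p + h) - f p) \<le> 4 * B / r * norm h" if "norm h < r / 2"
    by (rule mp[OF conjunct2[OF *] that])
qed

text \<open>Dominated convergence for the Frechet remainder. The Cauchy estimate turns the bound
  \<open>g\<close> for the values into the bound \<open>4 * g m / r\<close> for derivatives and
  difference quotients, so a dominating function for the values suffices. The derivative is named
  here because it has to be integrated.\<close>

lemma has_clinear_derivative_integral: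
  fixes f :: "'a::complex_normed_vector \<Rightarrow> 'm \<Rightarrow> complex"
  assumes r: "r > 0"
    and f: "\<And>q m. q \<in> ball p r \<Longrightarrow> m \<in> space M \<Longrightarrow>
              has_clinear_derivative (\<lambda>q. f q m) (f' q m) q"
    and meas: "\<And>q. q \<in> ball p r \<Longrightarrow> f q \<in> borel_measurable M"
    and bound: "\<And>q m. q \<in> ball p r \<Longrightarrow> m \<in> space M \<Longrightarrow> norm (f q m) \<le> g m"
    and g: "integrable M g"
  shows "integrable M (\<lambda>m. f' p m h)"
    and "has_clinear_derivative (\<lambda>q. \<integral>m. f q m \<partial>M) (\<lambda>h. \<integral>m. f' p m h \<partial>M) p"
proof -
  have pB: "p \<in> ball p r" using r by simp
  note fp = f[OF pB]
  have int_f: "integrable M (f q)" if "q \<in> ball p r" for q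
    by (rule Bochner_Integration.integrable_bound[OF g meas[OF that]])
      (intro AE_I2 order_trans[OF bound[OF that]], auto)
  have b1: "norm (f' p m h) \<le> 4 * g m / r * norm h" if "m \<in> space M" for m h
    by (rule clinear_derivative_bounds(1)[OF r, where f="\<lambda>q. f q m" and f'="\<lambda>q. f' q m"])
      (use f bound that in auto)
  have b2: "norm (f (p + h) m - f p m) \<le> 4 * g m / r * norm h"
    if "m \<in> space M" "norm h < r / 2" for m h
    by (rule clinear_derivative_bounds(2)[OF r, where f="\<lambda>q. f q m" and f'="\<lambda>q. f' q m"])
      (use f bound that in auto)
  have meas': "(\<lambda>m. f' p m h) \<in> borel_measurable M" for h
  proof (cases "h = 0")
    case True
    have "f' p m h = 0" if "m \<in> space M" for m
      using b1[OF that, of h] True by simp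
    then show ?thesis by (subst measurable_cong[where g="\<lambda>_. 0"]) auto
  next
    case False
    \<comment> \<open>Step sizes along \<open>h\<close>; the shift by 2 keeps all points
      \<open>p + scaleC (e n) h\<close> strictly inside the ball. The derivative is then a pointwise
      limit of measurable difference quotients.\<close>
    define a where "a = (\<lambda>n. r / norm h / (real n + 2))"
    define e where "e = (\<lambda>n. complex_of_real (a n))"
    have a0: "a n > 0" for n
      using r False by (simp add: a_def add_nonneg_pos)
    have e0: "e n \<noteq> 0" for n
      using a0[of n] by (simp add: e_def)
    have lim: "e \<longlonglongrightarrow> 0"
    proof -
      have "a \<longlonglongrightarrow> 0" unfolding a_def by real_asymp
      from tendsto_of_real[OF this, where 'a=complex] show ?thesis
        unfolding e_def by (simp only: of_real_0)
    qed
    have inb: "p + scaleC (e n) h \<in> ball p r" for n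
    proof -
      have "norm (scaleC (e n) h) = a n * norm h"
        using a0[of n] by (simp add: e_def scaleC_of_real)
      also have "\<dots> = r / (real n + 2)" using False by (simp add: a_def)
      also have "\<dots> < r / 1" using r by (intro divide_strict_left_mono) auto
      finally show ?thesis by (simp add: dist_norm)
    qed
    show ?thesis
    proof (rule borel_measurable_LIMSEQ_metric)
      show "(\<lambda>m. (f (p + scaleC (e n) h) m - f p m) / e n) \<in> borel_measurable M" for n
        by (intro borel_measurable_divide borel_measurable_diff borel_measurable_const meas inb pB)
      fix m assume "m \<in> space M"
      then have "((\<lambda>w. f (p + scaleC w h) m) has_field_derivative f' p m h) (at 0)"
        using fp by (intro has_field_derivative_line) auto
      then have "(\<lambda>w. (f (p + scaleC w h) m - f p m) / w) \<midarrow>0\<rightarrow> f' p m h"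
        by (simp add: DERIV_def)
      then have "\<forall>S. (\<forall>n. S n \<noteq> 0) \<and> S \<longlonglongrightarrow> 0 \<longrightarrow>
          (\<lambda>n. (f (p + scaleC (S n) h) m - f p m) / S n) \<longlonglongrightarrow> f' p m h"
        by (subst LIMSEQ_SEQ_conv)
      from this[rule_format, of e] show "(\<lambda>n. (f (p + scaleC (e n) h) m - f p m) / e n) \<longlonglongrightarrow> f' p m h"
        using lim e0 by simp
    qed
  qed
  have gr: "integrable M (\<lambda>m. 4 * g m / r * norm h)" for h :: 'a
    using g by simp
  show int': "integrable M (\<lambda>m. f' p m h)" for h
    by (rule Bochner_Integration.integrable_bound[OF gr[of h] meas'])
      (rule AE_I2, rule order_trans[OF b1], simp, simp only: real_norm_def abs_ge_self)
  have lin: "linear (f' p m)" if "m \<in> space M" for m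
    using fp[OF that] by (auto simp: has_clinear_derivative_def dest: has_derivative_linear)
  show "has_clinear_derivative (\<lambda>q. \<integral>m. f q m \<partial>M) (\<lambda>h. \<integral>m. f' p m h \<partial>M) p"
    unfolding has_clinear_derivative_def
  proof (intro conjI allI)
    fix c v
    have "(\<integral>m. f' p m (scaleC c v) \<partial>M) = (\<integral>m. c * f' p m v \<partial>M)"
      by (rule Bochner_Integration.integral_cong)
        (use fp in \<open>auto simp: has_clinear_derivative_def\<close>)
    then show "(\<integral>m. f' p m (scaleC c v) \<partial>M) = c * (\<integral>m. f' p m v \<partial>M)" by simp
  next
    have bl: "bounded_linear (\<lambda>h. \<integral>m. f' p m h \<partial>M)"
    proof (rule bounded_linear_intro[where K="\<integral>m. 4 * g m / r \<partial>M"])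
      fix x y
      have "(\<integral>m. f' p m (x + y) \<partial>M) = (\<integral>m. f' p m x + f' p m y \<partial>M)"
        by (rule Bochner_Integration.integral_cong) (simp_all add: linear_add[OF lin])
      then show "(\<integral>m. f' p m (x + y) \<partial>M) = (\<integral>m. f' p m x \<partial>M) + (\<integral>m. f' p m y \<partial>M)"
        using int'[of x] int'[of y] by simp
    next
      fix c x
      have "(\<integral>m. f' p m (c *\<^sub>R x) \<partial>M) = (\<integral>m. c *\<^sub>R f' p m x \<partial>M)"
        by (rule Bochner_Integration.integral_cong) (simp_all add: linear_scale[OF lin])
      then show "(\<integral>m. f' p m (c *\<^sub>R x) \<partial>M) = c *\<^sub>R (\<integral>m. f' p m x \<partial>M)" by simp
    next
      fix x
      have "norm (\<integral>m. f' p m x \<partial>M) \<le> (\<integral>m. 4 * g m / r * norm x \<partial>M)"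
        by (rule order_trans[OF Bochner_Integration.integral_norm_bound])
          (intro Bochner_Integration.integral_mono integrable_norm int' gr b1)
      then show "norm (\<integral>m. f' p m x \<partial>M) \<le> norm x * (\<integral>m. 4 * g m / r \<partial>M)"
        by (simp add: mult.commute)
    qed
    show "((\<lambda>q. \<integral>m. f q m \<partial>M) has_derivative (\<lambda>h. \<integral>m. f' p m h \<partial>M)) (at p)"
      unfolding has_derivative_at
    proof (intro conjI bl)
      \<comment> \<open>The quotient whose limit 0 defines the derivative. The Cauchy bounds for the
        increment and for the linear part add up to \<open>8 * g m / r\<close>.\<close>
      define R where "R = (\<lambda>h m. norm (f (p + h) m - f p m - f' p m h) / norm h)"
      have "(\<lambda>h. norm ((\<integral>m. f (p + h) m \<partial>M) - (\<integral>m. f p m \<partial>M) - (\<integral>m. f' p m h \<partial>M)) / norm h) \<midarrow>0\<rightarrow> 0"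
        (is "?N \<midarrow>0\<rightarrow> 0")
      proof (subst LIMSEQ_SEQ_conv[symmetric], intro allI impI, elim conjE)
        fix H :: "nat \<Rightarrow> 'a"
        assume H0: "\<forall>n. H n \<noteq> 0" and H: "H \<longlonglongrightarrow> 0"
        have "\<forall>\<^sub>F n in sequentially. dist (H n) 0 < r / 2"
          by (rule tendstoD[OF H]) (use r in simp)
        then obtain N where N: "\<And>n. n \<ge> N \<Longrightarrow> norm (H n) < r / 2"
          by (auto simp: eventually_sequentially)
        \<comment> \<open>A tail of the sequence, since the bound for the increment holds only for
          \<open>norm h < r / 2\<close>; an offset recovers the limit for \<open>H\<close>
          itself.\<close>
        define K where "K = (\<lambda>n. H (n + N))"
        have K: "norm (K n) < r / 2" "K n \<noteq> 0" for n
          using N H0 by (auto simp: K_def)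
        have K_lim: "K \<longlonglongrightarrow> 0" unfolding K_def using H by (rule LIMSEQ_ignore_initial_segment)
        have KB: "p + K n \<in> ball p r" for n using K(1)[of n] r by (simp add: dist_norm)
        have R_meas: "R (K n) \<in> borel_measurable M" for n
          unfolding R_def
          by (intro borel_measurable_divide borel_measurable_const
              measurable_compose[OF _ borel_measurable_norm] borel_measurable_diff meas meas' KB pB)
        have R_bound: "norm (R (K n) m) \<le> 8 * g m / r" if m: "m \<in> space M" for n m
        proof -
          have "norm (f (p + K n) m - f p m - f' p m (K n)) \<le>
              4 * g m / r * norm (K n) + 4 * g m / r * norm (K n)"
            using norm_triangle_ineq4[of "f (p + K n) m - f p m" "f' p m (K n)"]
              b1[OF m, of "K n"] b2[OF m K(1)[of n]] by linarith
          also have "\<dots> = 8 * g m / r * norm (K n)" by simp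
          finally show ?thesis using K(2)[of n] by (simp add: R_def pos_divide_le_eq)
        qed
        have "(\<lambda>n. \<integral>m. R (K n) m \<partial>M) \<longlonglongrightarrow> (\<integral>m. 0 \<partial>M)"
        proof (rule integral_dominated_convergence[where w="\<lambda>m. 8 * g m / r"])
          show "integrable M (\<lambda>m. 8 * g m / r)" using g by simp
          show "R (K n) \<in> borel_measurable M" for n by (rule R_meas)
          show "AE m in M. norm (R (K n) m) \<le> 8 * g m / r" for n
            by (rule AE_I2) (rule R_bound)
          show "AE m in M. (\<lambda>n. R (K n) m) \<longlonglongrightarrow> 0"
          proof (rule AE_I2)
            fix m assume "m \<in> space M"
            then have "(\<lambda>h. R h m) \<midarrow>0\<rightarrow> 0"
              using fp[of m] by (simp add: has_clinear_derivative_def has_derivative_at R_def)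
            then have "\<forall>S. (\<forall>n. S n \<noteq> 0) \<and> S \<longlonglongrightarrow> 0 \<longrightarrow> (\<lambda>n. R (S n) m) \<longlonglongrightarrow> 0"
              by (subst LIMSEQ_SEQ_conv)
            then show "(\<lambda>n. R (K n) m) \<longlonglongrightarrow> 0"
              using K(2) K_lim by simp
          qed
        qed simp
        then have lim: "(\<lambda>n. \<integral>m. R (K n) m \<partial>M) \<longlonglongrightarrow> 0" by simp
        have "(\<lambda>n. ?N (K n)) \<longlonglongrightarrow> 0"
        proof (rule Lim_null_comparison[OF always_eventually lim], rule allI)
          fix n
          define D where "D = (\<lambda>m. f (p + K n) m - f p m - f' p m (K n))"
          have "(\<integral>m. f (p + K n) m \<partial>M) - (\<integral>m. f p m \<partial>M) - (\<integral>m. f' p m (K n) \<partial>M) = integral\<^sup>L M D"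
            unfolding D_def using int_f[OF KB] int_f[OF pB] int'[of "K n"]
            by (simp only: Bochner_Integration.integral_diff Bochner_Integration.integrable_diff)
          moreover have "norm (integral\<^sup>L M D) \<le> (\<integral>m. norm (D m) \<partial>M)"
            by (rule Bochner_Integration.integral_norm_bound)
          moreover have "(\<integral>m. R (K n) m \<partial>M) = (\<integral>m. norm (D m) \<partial>M) / norm (K n)"
            unfolding R_def D_def by (rule integral_divide_zero)
          ultimately show "norm (?N (K n)) \<le> (\<integral>m. R (K n) m \<partial>M)"
            by (simp add: divide_right_mono)
        qed
        then show "(\<lambda>n. ?N (H n)) \<longlonglongrightarrow> 0"
          unfolding K_def by (rule LIMSEQ_offset[where k=N])
      qed
      then show "(\<lambda>h. norm ((\<integral>m. f (p + h) m \<partial>M) - (\<integral>m. f p m \<partial>M) - (\<integral>m. f' p m h \<partial>M)) / norm h) \<midarrow>0\<rightarrow> 0" .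
    qed
  qed
qed

section \<open>Closure properties of holomorphy at a point\<close>

definition holo_at :: "('a::complex_normed_vector \<Rightarrow> complex) \<Rightarrow> 'a \<Rightarrow> bool" where
  "holo_at f p \<longleftrightarrow> (\<exists>f'. has_clinear_derivative f f' p)"

lemma jointly_holomorphic_on_iff_holo_at:
  "jointly_holomorphic_on f S \<longleftrightarrow> open S \<and> (\<forall>p\<in>S. holo_at f p)"
  unfolding jointly_holomorphic_on_def holo_at_def has_clinear_derivative_def ..

named_theorems holo_intros

lemma holo_at_const [holo_intros]: "holo_at (\<lambda>_. c) p"
  unfolding holo_at_def using has_clinear_derivative_const by blast

lemma holo_at_add [holo_intros]:
  "holo_at f p \<Longrightarrow> holo_at g p \<Longrightarrow> holo_at (\<lambda>q. f q + g q) p"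
  unfolding holo_at_def using has_clinear_derivative_add by blast

lemma holo_at_mult [holo_intros]:
  "holo_at f p \<Longrightarrow> holo_at g p \<Longrightarrow> holo_at (\<lambda>q. f q * g q) p"
  unfolding holo_at_def using has_clinear_derivative_mult by blast

lemma holo_at_uminus [holo_intros]: "holo_at f p \<Longrightarrow> holo_at (\<lambda>q. - f q) p"
  using holo_at_mult[OF holo_at_const[of "-1"], of f p] by simp

lemma holo_at_diff [holo_intros]:
  "holo_at f p \<Longrightarrow> holo_at g p \<Longrightarrow> holo_at (\<lambda>q. f q - g q) p"
  using holo_at_add[OF _ holo_at_uminus, of f p g] by simp

lemma holo_at_power [holo_intros]: "holo_at f p \<Longrightarrow> holo_at (\<lambda>q. f q ^ n) p"
  by (induction n) (auto intro: holo_intros)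

lemma holo_at_sum [holo_intros]:
  "(\<And>i. i \<in> I \<Longrightarrow> holo_at (f i) p) \<Longrightarrow> holo_at (\<lambda>q. \<Sum>i\<in>I. f i q) p"
  by (induction I rule: infinite_finite_induct) (auto intro: holo_intros)

lemma holo_at_prod [holo_intros]:
  "(\<And>i. i \<in> I \<Longrightarrow> holo_at (f i) p) \<Longrightarrow> holo_at (\<lambda>q. \<Prod>i\<in>I. f i q) p"
  by (induction I rule: infinite_finite_induct) (auto intro: holo_intros)

lemma holo_at_comp:
  assumes "holo_at f p" "(g has_field_derivative g') (at (f p))"
  shows "holo_at (\<lambda>q. g (f q)) p"
  using assms has_clinear_derivative_comp unfolding holo_at_def by blast

lemma holo_at_exp [holo_intros]: "holo_at f p \<Longrightarrow> holo_at (\<lambda>q. exp (f q)) p"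
  by (rule holo_at_comp[OF _ DERIV_exp])

lemma holo_at_comp_affine:
  assumes "holo_at f (T p)" "bounded_linear T'" "\<And>q. T q = T' q + a"
    "\<And>c v. T' (scaleC c v) = scaleC c (T' v)"
  shows "holo_at (\<lambda>q. f (T q)) p"
  using assms has_clinear_derivative_comp_affine unfolding holo_at_def by blast

lemma holo_at_id [holo_intros]: "holo_at (\<lambda>z::complex. z) p"
  unfolding holo_at_def has_clinear_derivative_def
  by (rule exI[of _ "\<lambda>h. h"]) (auto simp: scaleC_complex_def)

lemma holo_at_nth [holo_intros]: "holo_at (\<lambda>v::complex ^ 'n. v $ i) p"
  using holo_at_comp_affine[of "\<lambda>z. z" "\<lambda>v. v $ i" p "\<lambda>v. v $ i" 0]
  by (simp add: holo_intros bounded_linear_vec_nth scaleC_vec_def scaleC_complex_def)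

lemma holo_at_fst: "holo_at f (fst p) \<Longrightarrow> holo_at (\<lambda>q. f (fst q)) p"
  by (rule holo_at_comp_affine[of f fst p fst 0])
    (auto simp: bounded_linear_fst scaleC_prod_def)

lemma holo_at_snd: "holo_at f (snd p) \<Longrightarrow> holo_at (\<lambda>q. f (snd q)) p"
  by (rule holo_at_comp_affine[of f snd p snd 0])
    (auto simp: bounded_linear_snd scaleC_prod_def)

lemma holo_at_imp_field_differentiable:
  assumes "holo_at f p"
  shows "f field_differentiable at p"
proof -
  obtain f' where "has_clinear_derivative f f' (p + scaleC 0 1)"
    using assms by (auto simp: holo_at_def)
  from has_field_derivative_line[of f f' p 0 1] obtain
    "((\<lambda>w. f (p + w)) has_field_derivative f' 1) (at 0)"
    using \<open>has_clinear_derivative f f' (p + scaleC 0 1)\<close> by (simp add: scaleC_complex_def)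
  then have "(f has_field_derivative f' 1) (at p)"
    using DERIV_shift[of f "f' 1" 0 p] by (simp add: add.commute)
  then show ?thesis unfolding field_differentiable_def by blast
qed

lemma holo_at_integral:
  fixes f :: "'a::complex_normed_vector \<Rightarrow> 'm \<Rightarrow> complex"
  assumes "r > 0"
    and f: "\<And>q m. q \<in> ball p r \<Longrightarrow> m \<in> space M \<Longrightarrow> holo_at (\<lambda>q. f q m) q"
    and "\<And>q. q \<in> ball p r \<Longrightarrow> f q \<in> borel_measurable M"
    and "\<And>q m. q \<in> ball p r \<Longrightarrow> m \<in> space M \<Longrightarrow> norm (f q m) \<le> g m"
    and "integrable M g"
  shows "holo_at (\<lambda>q. \<integral>m. f q m \<partial>M) p"
proof -
  \<comment> \<open>Choosing a derivative separately for each \<open>m\<close> loses no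
    measurability: \<open>has_clinear_derivative_integral\<close> derives it from the measurability
    of the values.\<close>
  define f' where "f' = (\<lambda>q m. SOME D. has_clinear_derivative (\<lambda>q. f q m) D q)"
  have "has_clinear_derivative (\<lambda>q. f q m) (f' q m) q" if "q \<in> ball p r" "m \<in> space M" for q m
    using f[OF that] unfolding f'_def holo_at_def by (rule someI_ex)
  from has_clinear_derivative_integral(2)[OF assms(1) this assms(3-5)]
  show ?thesis unfolding holo_at_def by blast
qed

section \<open>Gaussian summability and the sets D_set\<close>

text \<open>Bilinear, without conjugation: this is the holomorphic extension of the real inner
  product, so the squared distance and the characters extend to complex vectors.\<close>

definition cdot :: "complex ^ 'd \<Rightarrow> complex ^ 'd \<Rightarrow> complex" where
  "cdot u v = (\<Sum>j\<in>UNIV. u $ j * v $ j)"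

lemma cdot_add_left: "cdot (u + u') v = cdot u v + cdot u' v"
  and cdot_add_right: "cdot u (v + v') = cdot u v + cdot u v'"
  and cdot_diff_left: "cdot (u - u') v = cdot u v - cdot u' v"
  and cdot_diff_right: "cdot u (v - v') = cdot u v - cdot u v'"
  and cdot_minus_left: "cdot (- u) v = - cdot u v"
  and cdot_minus_right: "cdot u (- v) = - cdot u v"
  and cdot_scaleC_left: "cdot (scaleC c u) v = c * cdot u v"
  and cdot_scaleC_right: "cdot u (scaleC c v) = c * cdot u v"
  unfolding cdot_def
  by (simp_all add: algebra_simps sum.distrib sum_subtractf sum_negf sum_distrib_left
      scaleC_vec_def scaleC_complex_def)

lemma cdot_commute: "cdot u v = cdot v u"
  by (simp add: cdot_def mult.commute)

lemma cdot_complex_vec: "cdot (complex_vec x) (complex_vec y) = of_real (x \<bullet> y)"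
  by (simp add: cdot_def complex_vec_def inner_vec_def)

lemma norm_cdot_le: "norm (cdot u v) \<le> norm u * norm v"
proof -
  have "norm (cdot u v) \<le> (\<Sum>j\<in>UNIV. \<bar>norm (u $ j)\<bar> * \<bar>norm (v $ j)\<bar>)"
    unfolding cdot_def by (rule order_trans[OF norm_sum]) (simp add: norm_mult)
  also have "\<dots> \<le> norm u * norm v"
    unfolding norm_vec_def by (rule L2_set_mult_ineq)
  finally show ?thesis .
qed

lemma complex_vec_simps [simp]:
  "Re_vec (complex_vec x) = x" "Im_vec (complex_vec x) = 0" "complex_vec 0 = 0"
  by (simp_all add: Re_vec_def Im_vec_def complex_vec_def vec_eq_iff)

lemma complex_vec_add: "complex_vec (x + y) = complex_vec x + complex_vec y"
  and complex_vec_diff: "complex_vec (x - y) = complex_vec x - complex_vec y"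
  and complex_vec_minus: "complex_vec (- x) = - complex_vec x"
  and complex_vec_scaleR: "complex_vec (r *\<^sub>R x) = scaleC (of_real r) (complex_vec x)"
  by (simp_all add: complex_vec_def vec_eq_iff scaleC_vec_def scaleC_complex_def)

lemma Re_Im_vec_diff:
  "Re_vec (u - v) = Re_vec u - Re_vec v" "Im_vec (u - v) = Im_vec u - Im_vec v"
  by (simp_all add: Re_vec_def Im_vec_def vec_eq_iff)

lemma norm_complex_vec [simp]: "norm (complex_vec x) = norm x"
  by (simp add: norm_vec_def complex_vec_def)

lemma norm_Re_Im_vec: "norm (Re_vec u) \<le> norm u" "norm (Im_vec u) \<le> norm u"
  unfolding norm_vec_def Re_vec_def Im_vec_def
  by (auto intro!: L2_set_mono simp: abs_Re_le_cmod abs_Im_le_cmod)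

lemma Re_cdot_self: "Re (cdot w w) = (norm (Re_vec w))\<^sup>2 - (norm (Im_vec w))\<^sup>2"
  by (simp add: cdot_def power2_norm_eq_inner inner_vec_def Re_vec_def Im_vec_def sum_subtractf)

lemma Re_cdot_shift:
  "Re (cdot (complex_vec z - u) (complex_vec z - u)) = (norm (Re_vec u - z))\<^sup>2 - (norm (Im_vec u))\<^sup>2"
  by (simp add: Re_cdot_self Re_Im_vec_diff norm_minus_commute)

lemma holo_at_cdot [holo_intros]:
  "(\<And>i. holo_at (\<lambda>q. f q $ i) p) \<Longrightarrow> (\<And>i. holo_at (\<lambda>q. g q $ i) p) \<Longrightarrow>
    holo_at (\<lambda>q. cdot (f q) (g q)) p"
  unfolding cdot_def by (auto intro!: holo_intros)

text \<open>The one property of a lattice on which the integrals rely. It passes to subsets, so a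
  lattice with a point deleted has it too, and it implies local finiteness, closedness and
  countability.\<close>

definition gauss_summable :: "(real ^ 'd) set \<Rightarrow> bool" where
  "gauss_summable L \<longleftrightarrow> (\<forall>c>0. (\<lambda>z. exp (- c * (norm z)\<^sup>2)) summable_on L)"

lemma gauss_summable_subset: "gauss_summable L \<Longrightarrow> M \<subseteq> L \<Longrightarrow> gauss_summable M"
  unfolding gauss_summable_def using summable_on_subset_banach by blast

text \<open>Each point in the ball contributes at least \<open>exp (- (R\<^sup>2))\<close> to a
  convergent sum, which bounds the number of such points.\<close>

lemma gauss_summable_finite_cball:
  assumes "gauss_summable L"
  shows "finite (L \<inter> cball 0 R)"
proof -
  let ?f = "\<lambda>z::real^'a. exp (- 1 * (norm z)\<^sup>2)"
  have s: "?f summable_on L" using assms unfolding gauss_summable_def by (metis zero_less_one)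
  have "real (card G) \<le> exp (R\<^sup>2) * infsum ?f L" if G: "G \<subseteq> L \<inter> cball 0 R" "finite G" for G
  proof -
    have "exp (- (R\<^sup>2)) \<le> ?f z" if "z \<in> G" for z
    proof -
      have "norm z \<le> R" using that G by auto
      then have "(norm z)\<^sup>2 \<le> R\<^sup>2" by (simp add: power_mono)
      then show ?thesis by simp
    qed
    then have "real (card G) * exp (- (R\<^sup>2)) \<le> sum ?f G"
      by (rule sum_bounded_below)
    also have "\<dots> \<le> infsum ?f L"
      by (rule finite_sum_le_infsum[OF s]) (use G in auto)
    finally show ?thesis by (simp add: exp_minus field_simps)
  qed
  then have "card G \<le> nat \<lfloor>exp (R\<^sup>2) * infsum ?f L\<rfloor>" if "G \<subseteq> L \<inter> cball 0 R" "finite G" for G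
    by (rule le_nat_floor) (rule that)+
  then show ?thesis by (rule finite_if_finite_subsets_card_bdd[THEN conjunct1])
qed

lemma gauss_summable_imp_closed:
  assumes "gauss_summable L"
  shows "closed L"
proof -
  have "\<not> x islimpt L" for x
  proof
    assume "x islimpt L"
    then have "infinite (L \<inter> cball x 1)" unfolding islimpt_eq_infinite_cball by simp
    moreover have "cball x 1 \<subseteq> cball 0 (norm x + 1)"
      by (simp add: cball_subset_cball_iff)
    then have "L \<inter> cball x 1 \<subseteq> L \<inter> cball 0 (norm x + 1)" by blast
    ultimately show False using gauss_summable_finite_cball[OF assms] finite_subset by blast
  qed
  then show ?thesis by (simp add: closed_limpt)
qed

lemma gauss_summable_imp_countable:
  assumes "gauss_summable L"
  shows "countable L"
proof -
  have "L \<subseteq> (\<Union>n. L \<inter> cball 0 (real n))"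
  proof
    fix z assume "z \<in> L"
    moreover obtain n where "norm z \<le> real n" using real_arch_simple by blast
    ultimately show "z \<in> (\<Union>n. L \<inter> cball 0 (real n))" by auto
  qed
  moreover have "countable (\<Union>n. L \<inter> cball 0 (real n))"
    by (rule countable_UN) (auto intro: countable_finite gauss_summable_finite_cball[OF assms])
  ultimately show ?thesis by (rule countable_subset)
qed

text \<open>Near a point of \<open>D_L\<close> the real part of \<open>(z - u)\<^sup>2\<close> is bounded below uniformly in \<open>z \<in> L\<close>:
  the distance to the closed set \<open>L\<close> is attained and is 1-Lipschitz.\<close>

lemma D_set_uniform:
  assumes "closed L" "u0 \<in> D_set L"
  obtains r \<delta> where "r > 0" "\<delta> > 0"
    "\<And>u z. u \<in> ball u0 r \<Longrightarrow> z \<in> L \<Longrightarrow>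
       norm (Re_vec u - z) > norm (Im_vec u) \<and>
       (norm (Re_vec u - z))\<^sup>2 - (norm (Im_vec u))\<^sup>2 \<ge> \<delta>"
proof (cases "L = {}")
  case True
  then show ?thesis using that[of 1 1] by simp
next
  case False
  obtain z0 where z0: "z0 \<in> L" "\<And>z. z \<in> L \<Longrightarrow> dist (Re_vec u0) z0 \<le> dist (Re_vec u0) z"
    using distance_attains_inf[OF assms(1) False, of "Re_vec u0"] by blast
  \<comment> \<open>The gap at \<open>u0\<close>. Moving by less than \<open>d / 4\<close> costs at
    most that much in the real and in the imaginary part, so a gap of \<open>d / 2\<close> survives
    for all of \<open>L\<close> at once. A difference of squares is the gap times the sum, and both
    factors are at least \<open>d / 2\<close>.\<close>
  define d where "d = dist (Re_vec u0) z0 - norm (Im_vec u0)"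
  have d: "d > 0" using assms(2) z0(1) by (auto simp: D_set_def d_def dist_norm)
  show ?thesis
  proof (rule that[of "d/4" "d\<^sup>2/4"])
    fix u z assume u: "u \<in> ball u0 (d/4)" and z: "z \<in> L"
    have a: "norm (Re_vec u0 - Re_vec u) < d/4" "norm (Im_vec u0 - Im_vec u) < d/4"
      using norm_Re_Im_vec[of "u0 - u"] u by (auto simp: Re_Im_vec_diff dist_norm)
    have b: "dist (Re_vec u0) z \<le> norm (Re_vec u0 - Re_vec u) + norm (Re_vec u - z)"
      using norm_triangle_ineq[of "Re_vec u0 - Re_vec u" "Re_vec u - z"] by (simp add: dist_norm)
    have c: "norm (Im_vec u) \<le> norm (Im_vec u0) + norm (Im_vec u0 - Im_vec u)"
      using norm_triangle_ineq4[of "Im_vec u0" "Im_vec u0 - Im_vec u"] by simp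
    have d': "dist (Re_vec u0) z0 = d + norm (Im_vec u0)" by (simp add: d_def)
    have e: "norm (Re_vec u - z) - norm (Im_vec u) \<ge> d / 2"
      using a(1) a(2) b c z0(2)[OF z] d' by simp
    have "(d / 2) * (d / 2) \<le> (norm (Re_vec u - z) - norm (Im_vec u)) *
        (norm (Re_vec u - z) + norm (Im_vec u))"
    proof (rule mult_mono[OF e])
      show "d / 2 \<le> norm (Re_vec u - z) + norm (Im_vec u)"
        using e norm_ge_zero[of "Im_vec u"] by linarith
    qed (use d e in auto)
    moreover have "(norm (Re_vec u - z) - norm (Im_vec u)) * (norm (Re_vec u - z) + norm (Im_vec u)) =
        (norm (Re_vec u - z))\<^sup>2 - (norm (Im_vec u))\<^sup>2" "(d / 2) * (d / 2) = d\<^sup>2 / 4"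
      by (simp_all add: power2_eq_square algebra_simps)
    ultimately show "norm (Re_vec u - z) > norm (Im_vec u) \<and>
       (norm (Re_vec u - z))\<^sup>2 - (norm (Im_vec u))\<^sup>2 \<ge> d\<^sup>2/4"
      using e d by simp
  qed (use d in auto)
qed

lemma open_D_set:
  assumes "closed L"
  shows "open (D_set L)"
  unfolding open_contains_ball
proof
  fix u0 assume "u0 \<in> D_set L"
  from D_set_uniform[OF assms this] obtain r \<delta> where "r > 0"
    "\<And>u z. u \<in> ball u0 r \<Longrightarrow> z \<in> L \<Longrightarrow>
       norm (Re_vec u - z) > norm (Im_vec u) \<and>
       (norm (Re_vec u - z))\<^sup>2 - (norm (Im_vec u))\<^sup>2 \<ge> \<delta>"
    by metis
  then show "\<exists>e>0. ball u0 e \<subseteq> D_set L"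
    by (auto simp: D_set_def)
qed

lemma complex_vec_in_D_set_iff: "complex_vec x \<in> D_set L \<longleftrightarrow> x \<notin> L"
  by (auto simp: D_set_def)

lemma integrable_count_space_iff:
  "integrable (count_space A) f \<longleftrightarrow> (\<lambda>x. norm (f x)) summable_on A"
  for f :: "'a \<Rightarrow> 'b::{banach,second_countable_topology}"
  using abs_summable_equivalent[of f A] by (simp add: Infinite_Set_Sum.abs_summable_on_def)

lemma integral_count_space_eq_infsum:
  fixes f :: "'a \<Rightarrow> 'b::{banach,second_countable_topology}"
  assumes "(\<lambda>x. norm (f x)) summable_on A"
  shows "integral\<^sup>L (count_space A) f = infsum f A"
  using infsetsum_infsum[of f A] assms abs_summable_equivalent[of f A]
  by (simp add: infsetsum_def)

text \<open>Completing the square: the device by which Gaussian decay absorbs a linear exponent, and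
  the source of the constants of the form \<open>b\<^sup>2 / (4 * a)\<close> below.\<close>

lemma quadratic_le: "a > 0 \<Longrightarrow> b * t - a * t\<^sup>2 \<le> b\<^sup>2 / (4 * a)" for a b t :: real
proof -
  assume a: "a > 0"
  have "0 \<le> (2 * a * t - b)\<^sup>2" by simp
  then have "(b * t - a * t\<^sup>2) * (4 * a) \<le> b\<^sup>2"
    by (simp add: power2_eq_square algebra_simps)
  then show ?thesis using a by (simp add: pos_le_divide_eq)
qed

section \<open>The incomplete Mellin transform\<close>

text \<open>The growth condition is wide enough for a monomial in \<open>w\<close> and for a Hermite
  polynomial at \<open>exp (s / 2)\<close> times \<open>w\<close>, yet a linear exponent in
  \<open>s\<close> and \<open>norm w\<close> is still beaten by quadratic decay. It is imposed on
  \<open>s \<ge> 0\<close>, the range of the integrals.\<close>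

definition kernel_factor :: "((complex ^ 'd) \<Rightarrow> real \<Rightarrow> complex) \<Rightarrow> bool" where
  "kernel_factor q \<longleftrightarrow> (\<forall>w s. holo_at (\<lambda>w. q w s) w) \<and> (\<forall>w. q w \<in> borel_measurable borel) \<and>
     (\<exists>N\<ge>0. \<forall>w s. s \<ge> 0 \<longrightarrow> norm (q w s) \<le> exp (N * (1 + s + norm w)))"

definition gauss_factor :: "complex ^ 'd \<Rightarrow> complex ^ 'd \<Rightarrow> real ^ 'd \<Rightarrow> complex" where
  "gauss_factor u v z = exp (- 2 * of_real pi * \<i> * cdot v (complex_vec z)) *
     exp (- of_real pi * cdot (complex_vec z - u) (complex_vec z - u))"

text \<open>The real part of the squared distance is at least \<open>(norm z)\<^sup>2\<close> minus
  terms linear in \<open>norm z\<close> and a constant. As \<open>pi \<ge> 2\<close>, this leaves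
  two copies of \<open>(norm z)\<^sup>2\<close>: one absorbs all linear exponents, the other is the
  stated decay.\<close>

lemma gauss_factor_bound:
  fixes R N :: real
  assumes "R \<ge> 0" "N \<ge> 0"
  obtains C where "C > 0"
    "\<And>u v (z::real^'d). norm u \<le> R \<Longrightarrow> norm v \<le> R \<Longrightarrow>
       exp (N * norm (complex_vec z - u)) * norm (gauss_factor u v z) \<le> C * exp (- (norm z)\<^sup>2)"
proof -
  \<comment> \<open>The total coefficient of \<open>norm z\<close>: \<open>8 * R\<close> from the
    character, \<open>8 * R\<close> from the shift by \<open>u\<close>, both with
    \<open>pi \<le> 4\<close>, and \<open>N\<close> from the extra exponential factor.\<close>
  define b where "b = 16 * R + N"
  define C where "C = exp (b\<^sup>2 / 4 + 4 * R\<^sup>2 + N * R)"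
  have "exp (N * norm (complex_vec z - u)) * norm (gauss_factor u v z) \<le> C * exp (- (norm z)\<^sup>2)"
    if u: "norm u \<le> R" and v: "norm v \<le> R" for u v :: "complex ^ 'd" and z
  proof -
    define t where "t = norm z"
    have t0: "t \<ge> 0" by (simp add: t_def)
    have pi: "pi \<le> 4" "2 \<le> pi" using pi_less_4 pi_ge_two by auto
    have 1: "N * norm (complex_vec z - u) \<le> N * (t + R)"
      using norm_triangle_ineq4[of "complex_vec z" u] u assms by (intro mult_left_mono) (auto simp: t_def)
    have "Im (cdot v (complex_vec z)) \<le> norm (cdot v (complex_vec z))"
      using abs_Im_le_cmod[of "cdot v (complex_vec z)"] by linarith
    also have "\<dots> \<le> norm v * norm z"
      using norm_cdot_le[of v "complex_vec z"] by simp
    also have "\<dots> \<le> R * t"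
      using v t0 by (auto simp: t_def intro: mult_right_mono)
    finally have "pi * Im (cdot v (complex_vec z)) \<le> pi * (R * t)"
      by (rule mult_left_mono) simp
    also have "\<dots> \<le> 4 * (R * t)"
      using pi(1) t0 assms(1) by (intro mult_right_mono) auto
    finally have 2: "Re (- 2 * of_real pi * \<i> * cdot v (complex_vec z)) \<le> 8 * R * t" by simp
    have "\<bar>t - norm (Re_vec u)\<bar> \<le> norm (Re_vec u - z)"
      using norm_triangle_ineq3[of z "Re_vec u"] by (simp add: t_def norm_minus_commute)
    then have "(t - norm (Re_vec u))\<^sup>2 \<le> (norm (Re_vec u - z))\<^sup>2"
      using abs_le_square_iff[of "t - norm (Re_vec u)" "norm (Re_vec u - z)"] by simp
    moreover have "(t - norm (Re_vec u))\<^sup>2 \<ge> t\<^sup>2 - 2 * (R * t)"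
    proof -
      have "norm (Re_vec u) * t \<le> R * t"
        using norm_Re_Im_vec(1)[of u] u t0 by (intro mult_right_mono) auto
      moreover have "(t - norm (Re_vec u))\<^sup>2 = t\<^sup>2 - 2 * (norm (Re_vec u) * t) + (norm (Re_vec u))\<^sup>2"
        by (simp add: power2_eq_square algebra_simps)
      moreover have "(norm (Re_vec u))\<^sup>2 \<ge> 0" by simp
      ultimately show ?thesis by linarith
    qed
    moreover have "(norm (Im_vec u))\<^sup>2 \<le> R\<^sup>2"
      using norm_Re_Im_vec(2)[of u] u by (intro power_mono) auto
    ultimately have 3: "Re (cdot (complex_vec z - u) (complex_vec z - u)) \<ge> t\<^sup>2 - 2 * (R * t) - R\<^sup>2"
      unfolding Re_cdot_shift by linarith
    have "- pi * Re (cdot (complex_vec z - u) (complex_vec z - u)) \<le> - pi * (t\<^sup>2 - 2 * (R * t) - R\<^sup>2)"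
      using 3 by simp
    also have "\<dots> \<le> - 2 * t\<^sup>2 + 8 * (R * t) + 4 * R\<^sup>2"
    proof -
      have "2 * t\<^sup>2 \<le> pi * t\<^sup>2" "pi * R\<^sup>2 \<le> 4 * R\<^sup>2" "pi * (R * t) \<le> 4 * (R * t)"
        using pi t0 assms by (auto intro!: mult_right_mono)
      then show ?thesis by (simp add: algebra_simps)
    qed
    finally have 4: "Re (- of_real pi * cdot (complex_vec z - u) (complex_vec z - u)) \<le> - 2 * t\<^sup>2 + 8 * (R * t) + 4 * R\<^sup>2"
      by simp
    have 5: "b * t - 1 * t\<^sup>2 \<le> b\<^sup>2 / (4 * 1)" by (rule quadratic_le) simp
    have "N * norm (complex_vec z - u) + Re (- 2 * of_real pi * \<i> * cdot v (complex_vec z)) +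
        Re (- of_real pi * cdot (complex_vec z - u) (complex_vec z - u)) \<le>
        b\<^sup>2 / 4 + 4 * R\<^sup>2 + N * R - t\<^sup>2"
      using 1 2 4 5 unfolding b_def by (simp only: distrib_left distrib_right mult_1 mult_1_right)
    then have "exp (N * norm (complex_vec z - u) + Re (- 2 * of_real pi * \<i> * cdot v (complex_vec z)) +
        Re (- of_real pi * cdot (complex_vec z - u) (complex_vec z - u))) \<le>
        exp (b\<^sup>2 / 4 + 4 * R\<^sup>2 + N * R - t\<^sup>2)" by (simp only: exp_le_cancel_iff)
    then show ?thesis
      by (simp only: gauss_factor_def norm_mult norm_exp_eq_Re exp_add exp_diff C_def t_def exp_minus
          mult.assoc divide_inverse)
  qed
  then show ?thesis using that[of C] by (simp add: C_def)
qed

text \<open>The Mellin integrand in \<open>t = exp s\<close>: the first factor is \<open>t\<close>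
  to the power \<open>\<nu> / 2\<close>, and \<open>ds\<close> stands for \<open>dt / t\<close>. The
  triple \<open>p\<close> is (\<nu>, centre, frequency).\<close>

definition ekernel :: "((complex ^ 'd) \<Rightarrow> real \<Rightarrow> complex) \<Rightarrow>
    complex \<times> (complex ^ 'd) \<times> (complex ^ 'd) \<Rightarrow> real ^ 'd \<Rightarrow> real \<Rightarrow> complex" where
  "ekernel q p z s = exp (of_real (s / 2) * fst p) * q (complex_vec z - fst (snd p)) s *
     exp (- 2 * of_real pi * \<i> * cdot (snd (snd p)) (complex_vec z)) *
     exp (- of_real (pi * exp s) * cdot (complex_vec z - fst (snd p)) (complex_vec z - fst (snd p)))"

text \<open>With \<open>X \<ge> \<delta>\<close> and \<open>exp s - 1 \<ge> s\<^sup>2 / 2\<close>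
  one gets \<open>exp s * X \<ge> X + s\<^sup>2 / 2 * \<delta>\<close>. The summand \<open>X\<close>
  gives the Gaussian decay in \<open>z\<close>, the second one beats all exponential growth in
  \<open>s\<close>; the variables are separated.\<close>

lemma ekernel_bound:
  assumes q: "kernel_factor (q :: (complex ^ 'd) \<Rightarrow> real \<Rightarrow> complex)" and "R \<ge> 0" "\<delta> > 0"
  obtains K where "K > 0"
    "\<And>p z s. norm p \<le> R \<Longrightarrow>
       Re (cdot (complex_vec z - fst (snd p)) (complex_vec z - fst (snd p))) \<ge> \<delta> \<Longrightarrow> s \<ge> 0 \<Longrightarrow>
       norm (ekernel q p z s) \<le> K * exp (- (norm z)\<^sup>2) * exp (- s)"
proof -
  obtain N where N: "N \<ge> 0" "\<And>w s. s \<ge> 0 \<Longrightarrow> norm (q w s) \<le> exp (N * (1 + s + norm w))"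
    using q unfolding kernel_factor_def by blast
  obtain C where C: "C > 0" "\<And>u v (z::real^'d). norm u \<le> R \<Longrightarrow> norm v \<le> R \<Longrightarrow>
       exp (N * norm (complex_vec z - u)) * norm (gauss_factor u v z) \<le> C * exp (- (norm z)\<^sup>2)"
    using gauss_factor_bound[OF \<open>R \<ge> 0\<close> N(1)] by metis
  \<comment> \<open>The coefficient of \<open>s\<close> to be absorbed: \<open>R / 2\<close> from
    the power of \<open>t\<close>, \<open>N\<close> from \<open>q\<close>, and 1 to pay for the
    factor \<open>exp (- s)\<close> in the bound.\<close>
  define b where "b = R / 2 + N + 1"
  define K where "K = C * exp (N + b\<^sup>2 / (2 * pi * \<delta>))"
  have "norm (ekernel q p z s) \<le> K * exp (- (norm z)\<^sup>2) * exp (- s)"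
    if p: "norm p \<le> R" and s: "s \<ge> 0" and
      D: "Re (cdot (complex_vec z - fst (snd p)) (complex_vec z - fst (snd p))) \<ge> \<delta>" for p z s
  proof -
    obtain \<nu> u v where p_eq: "p = (\<nu>, u, v)" by (cases p) auto
    define X where "X = Re (cdot (complex_vec z - u) (complex_vec z - u))"
    have n: "norm \<nu> \<le> R" "norm u \<le> R" "norm v \<le> R"
      using p norm_fst_le[of \<nu> "(u, v)"] norm_snd_le[of "(u, v)" \<nu>] norm_fst_le[of u v] norm_snd_le[of v u]
      unfolding p_eq by linarith+
    have X: "X \<ge> \<delta>" using D by (simp add: X_def p_eq)
    have "(exp s - 1) * X \<ge> (exp s - 1) * \<delta>" using X s by (intro mult_left_mono) auto
    moreover have "(exp s - 1) * \<delta> \<ge> s\<^sup>2 / 2 * \<delta>"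
      using exp_lower_Taylor_quadratic[OF s] s \<open>\<delta> > 0\<close> by (intro mult_right_mono) auto
    ultimately have "exp s * X \<ge> X + s\<^sup>2 / 2 * \<delta>" by (simp add: algebra_simps)
    then have "- pi * (exp s * X) \<le> - pi * (X + s\<^sup>2 / 2 * \<delta>)" by simp
    then have 1: "- (pi * exp s) * X \<le> - pi * X - (pi * \<delta> / 2) * s\<^sup>2" by (simp add: algebra_simps)
    have 2: "b * s - (pi * \<delta> / 2) * s\<^sup>2 \<le> b\<^sup>2 / (4 * (pi * \<delta> / 2))"
      by (rule quadratic_le) (use \<open>\<delta> > 0\<close> in simp)
    have 3: "s / 2 * Re \<nu> \<le> s / 2 * R"
      using n(1) abs_Re_le_cmod[of \<nu>] s by (intro mult_left_mono) auto
    have e1: "norm (exp (of_real (s / 2) * \<nu>)) \<le> exp (s / 2 * R)"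
      using 3 by (simp add: norm_exp_eq_Re)
    have e2: "norm (exp (- of_real (pi * exp s) * cdot (complex_vec z - u) (complex_vec z - u))) \<le>
        norm (exp (- of_real pi * cdot (complex_vec z - u) (complex_vec z - u))) * exp (- (pi * \<delta> / 2) * s\<^sup>2)"
      using 1 by (simp add: norm_exp_eq_Re X_def flip: exp_add)
    have "norm (ekernel q p z s) \<le> exp (s / 2 * R) * exp (N * (1 + s + norm (complex_vec z - u))) *
        norm (exp (- 2 * of_real pi * \<i> * cdot v (complex_vec z))) *
        (norm (exp (- of_real pi * cdot (complex_vec z - u) (complex_vec z - u))) * exp (- (pi * \<delta> / 2) * s\<^sup>2))"
      unfolding ekernel_def p_eq norm_mult fst_conv snd_conv
      by (intro mult_mono e1 e2 N(2) s order_refl mult_nonneg_nonneg norm_ge_zero exp_ge_zero)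
    also have "\<dots> = exp (N + (R / 2 + N) * s - (pi * \<delta> / 2) * s\<^sup>2) *
        (exp (N * norm (complex_vec z - u)) * norm (gauss_factor u v z))"
    proof -
      have exps: "exp (s / 2 * R) * exp (N * (1 + s + n)) * exp (- (pi * \<delta> / 2) * s\<^sup>2) =
          exp (N + (R / 2 + N) * s - (pi * \<delta> / 2) * s\<^sup>2) * exp (N * n)" for n
        by (simp only: exp_add[symmetric] exp_inj_iff) (simp add: algebra_simps)
      have "a * b * E * (G * c) = X * (n * (E * G))" if "a * b * c = X * n" for a b c E G X n :: real
      proof -
        have "a * b * E * (G * c) = (a * b * c) * (E * G)" by (simp only: mult_ac)
        also have "\<dots> = X * n * (E * G)" by (simp only: that)
        finally show ?thesis by (simp only: mult.assoc)
      qed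
      from this[OF exps] show ?thesis unfolding gauss_factor_def norm_mult .
    qed
    also have "\<dots> \<le> exp (N + b\<^sup>2 / (2 * pi * \<delta>) - s) * (C * exp (- (norm z)\<^sup>2))"
    proof (rule mult_mono[OF _ C(2)[OF n(2) n(3)]])
      show "exp (N + (R / 2 + N) * s - (pi * \<delta> / 2) * s\<^sup>2) \<le> exp (N + b\<^sup>2 / (2 * pi * \<delta>) - s)"
        using 2 by (simp add: b_def algebra_simps)
    qed auto
    also have "\<dots> = K * exp (- (norm z)\<^sup>2) * exp (- s)"
      using exp_add[of "N + b\<^sup>2 / (2 * pi * \<delta>)" "- s"] by (simp only: K_def mult_ac minus_real_def)
    finally show ?thesis .
  qed
  then show ?thesis using that[of K] C(1) by (simp add: K_def)
qed

lemma integrable_exp_tail: "integrable lborel (\<lambda>s. indicator {0..} s * exp (- s) :: real)"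
proof (rule integrableI_nonneg)
  have "(\<integral>\<^sup>+s. ennreal (exp (- s)) * indicator {0..} s \<partial>lborel) = ennreal (0 - (- exp (- 0)))"
  proof (rule nn_integral_FTC_atLeast)
    show "((\<lambda>s::real. - exp (- s)) \<longlongrightarrow> 0) at_top" by real_asymp
  qed (auto intro!: derivative_eq_intros)
  then show "(\<integral>\<^sup>+s. ennreal (indicator {0..} s * exp (- s)) \<partial>lborel) < \<infinity>"
    by (simp add: mult.commute ennreal_mult' ennreal_indicator cong: nn_integral_cong)
qed auto

lemma integrable_count_space_mult:
  fixes a :: "'i \<Rightarrow> real" and b :: "'b \<Rightarrow> real"
  assumes "countable L" "sigma_finite_measure M"
    and a: "(\<lambda>z. norm (a z)) summable_on L" and b: "integrable M b"
  shows "integrable (count_space L \<Otimes>\<^sub>M M) (\<lambda>m. a (fst m) * b (snd m))"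
proof -
  interpret L: sigma_finite_measure "count_space L"
    by (rule sigma_finite_measure_count_space_countable[OF assms(1)])
  interpret M: sigma_finite_measure M by fact
  interpret pair_sigma_finite "count_space L" M ..
  have [measurable]: "b \<in> borel_measurable M" using b by auto
  have "integrable (count_space L) a" using a by (simp add: integrable_count_space_iff)
  then show ?thesis
    by (intro Fubini_integrable) (auto simp: abs_mult intro: b)
qed

text \<open>Fubini for counting measure times \<open>M\<close>, with a dominating function that is a
  product of one factor in \<open>z\<close> and one in \<open>x\<close>.\<close>

lemma integral_infsum_dominated:
  fixes f :: "'i \<Rightarrow> 'b \<Rightarrow> complex"
  assumes "countable L" "sigma_finite_measure M"
    and f: "\<And>z. z \<in> L \<Longrightarrow> f z \<in> borel_measurable M"
    and bound: "\<And>z x. z \<in> L \<Longrightarrow> x \<in> space M \<Longrightarrow> norm (f z x) \<le> a z * b x"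
    and a: "(\<lambda>z. norm (a z)) summable_on L" and b: "integrable M b"
  shows "(\<integral>x. (\<Sum>\<^sub>\<infinity>z\<in>L. f z x) \<partial>M) = (\<Sum>\<^sub>\<infinity>z\<in>L. \<integral>x. f z x \<partial>M)"
proof -
  interpret L: sigma_finite_measure "count_space L"
    by (rule sigma_finite_measure_count_space_countable[OF assms(1)])
  interpret M: sigma_finite_measure M by fact
  interpret pair_sigma_finite "count_space L" M ..
  have int: "integrable (count_space L \<Otimes>\<^sub>M M) (case_prod f)"
  proof (rule Bochner_Integration.integrable_bound[OF integrable_count_space_mult[OF assms(1,2) a b]])
    show "case_prod f \<in> borel_measurable (count_space L \<Otimes>\<^sub>M M)"
      by (rule measurable_pair_measure_countable1[OF assms(1)]) (simp add: f)
    show "AE m in count_space L \<Otimes>\<^sub>M M. norm (case_prod f m) \<le> norm (a (fst m) * b (snd m))"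
      by (rule AE_I2) (auto simp: space_pair_measure intro: order_trans[OF bound abs_ge_self])
  qed
  have 1: "(\<integral>z. f z x \<partial>count_space L) = (\<Sum>\<^sub>\<infinity>z\<in>L. f z x)" if x: "x \<in> space M" for x
  proof (rule integral_count_space_eq_infsum, rule summable_on_comparison_test)
    show "(\<lambda>z. norm (a z) * \<bar>b x\<bar>) summable_on L"
      using a by (rule summable_on_cmult_left)
  qed (use bound[OF _ x] in \<open>auto simp flip: abs_mult intro: order_trans[OF _ abs_ge_self]\<close>)
  have 2: "(\<integral>z. (\<integral>x. f z x \<partial>M) \<partial>count_space L) = (\<Sum>\<^sub>\<infinity>z\<in>L. \<integral>x. f z x \<partial>M)"
    using integrable_fst[OF int] by (intro integral_count_space_eq_infsum) (simp add: integrable_count_space_iff)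
  have "(\<integral>x. (\<Sum>\<^sub>\<infinity>z\<in>L. f z x) \<partial>M) = (\<integral>x. (\<integral>z. f z x \<partial>count_space L) \<partial>M)"
    by (rule Bochner_Integration.integral_cong) (use 1 in auto)
  also have "\<dots> = (\<integral>z. (\<integral>x. f z x \<partial>M) \<partial>count_space L)"
    using integral_snd[OF int] integral_fst[OF int] by simp
  finally show ?thesis using 2 by simp
qed

definition eint_measure :: "(real ^ 'd) set \<Rightarrow> ((real ^ 'd) \<times> real) measure" where
  "eint_measure L = count_space L \<Otimes>\<^sub>M lborel"

text \<open>A single integral over counting measure times Lebesgue measure:
  \<open>holo_at_integral\<close> then treats the lattice sum and the Mellin integral at one stroke,
  and Fubini gives either iterated form.\<close>

definition eint :: "((complex ^ 'd) \<Rightarrow> real \<Rightarrow> complex) \<Rightarrow> (real ^ 'd) set \<Rightarrow>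
    complex \<times> (complex ^ 'd) \<times> (complex ^ 'd) \<Rightarrow> complex" where
  "eint q L p = (\<integral>m. indicator {0..} (snd m) *\<^sub>R ekernel q p (fst m) (snd m) \<partial>eint_measure L)"

text \<open>\<open>D_set_uniform\<close> supplies one \<delta> for all lattice points and all nearby
  centres, and \<open>ekernel_bound\<close> converts it into a bound free of \<open>p'\<close>. The
  radius is capped at 1 so that \<open>norm p' \<le> norm p + 1\<close>.\<close>

lemma eint_locally_dominated:
  assumes L: "gauss_summable L" and q: "kernel_factor q" and u: "fst (snd p) \<in> D_set L"
  obtains r K where "r > 0" "K > 0"
    "\<And>p' z s. p' \<in> ball p r \<Longrightarrow> z \<in> L \<Longrightarrow> s \<ge> 0 \<Longrightarrow>
      norm (ekernel q p' z s) \<le> K * exp (- (norm z)\<^sup>2) * exp (- s)"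
proof -
  obtain r \<delta> where r: "r > 0" "\<delta> > 0" "\<And>u' z. u' \<in> ball (fst (snd p)) r \<Longrightarrow> z \<in> L \<Longrightarrow>
       norm (Re_vec u' - z) > norm (Im_vec u') \<and>
       (norm (Re_vec u' - z))\<^sup>2 - (norm (Im_vec u'))\<^sup>2 \<ge> \<delta>"
    using D_set_uniform[OF gauss_summable_imp_closed[OF L] u] by metis
  obtain K where K: "K > 0" "\<And>p' z s. norm p' \<le> norm p + 1 \<Longrightarrow>
       Re (cdot (complex_vec z - fst (snd p')) (complex_vec z - fst (snd p'))) \<ge> \<delta> \<Longrightarrow> s \<ge> 0 \<Longrightarrow>
       norm (ekernel q p' z s) \<le> K * exp (- (norm z)\<^sup>2) * exp (- s)"
    using ekernel_bound[OF q _ r(2), of "norm p + 1"] by (metis add_nonneg_nonneg norm_ge_zero zero_le_one)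
  show ?thesis
  proof (rule that[of "min r 1" K])
    fix p' z s assume p': "p' \<in> ball p (min r 1)" and z: "z \<in> L" and s: "s \<ge> (0::real)"
    have "dist (fst (snd p)) (fst (snd p')) \<le> dist p p'"
      by (rule order_trans[OF dist_fst_le dist_snd_le])
    then have "fst (snd p') \<in> ball (fst (snd p)) r" using p' by auto
    moreover have "norm p' \<le> norm p + 1"
      using p' norm_triangle_ineq2[of p' p] by (auto simp: dist_norm norm_minus_commute)
    ultimately show "norm (ekernel q p' z s) \<le> K * exp (- (norm z)\<^sup>2) * exp (- s)"
      using r(3) z s by (intro K) (auto simp: Re_cdot_shift)
  qed (use r K in auto)
qed

lemma ekernel_measurable:
  assumes "kernel_factor q"
  shows "ekernel q p z \<in> borel_measurable borel"
proof -
  have [measurable]: "q w \<in> borel_measurable borel" for w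
    using assms by (auto simp: kernel_factor_def)
  show ?thesis unfolding ekernel_def by measurable
qed

lemma eint_integrand_measurable:
  assumes "countable L" "kernel_factor q"
  shows "(\<lambda>m. indicator {0..} (snd m) *\<^sub>R ekernel q p (fst m) (snd m)) \<in> borel_measurable (eint_measure L)"
  unfolding eint_measure_def
proof (rule measurable_pair_measure_countable1[OF assms(1)])
  fix z
  have [measurable]: "ekernel q p z \<in> borel_measurable borel" by (rule ekernel_measurable[OF assms(2)])
  show "(\<lambda>s. indicator {0..} (snd (z, s)) *\<^sub>R ekernel q p (fst (z, s)) (snd (z, s))) \<in> borel_measurable lborel"
    by simp
qed

lemma holo_at_ekernel:
  assumes "kernel_factor q"
  shows "holo_at (\<lambda>p. ekernel q p z s) p"
proof -
  have "holo_at (\<lambda>w. q w s) w" for w using assms by (auto simp: kernel_factor_def)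
  then have "holo_at (\<lambda>p. q (complex_vec z - fst (snd p)) s) p"
    by (rule holo_at_comp_affine[where T'="\<lambda>p. - fst (snd p)" and a="complex_vec z"])
      (auto simp: scaleC_prod_def scaleC_vec_def scaleC_complex_def vec_eq_iff
        intro!: bounded_linear_minus bounded_linear_fst_comp bounded_linear_snd)
  note q' = this
  have 1: "holo_at (\<lambda>p::complex \<times> (complex ^ 'a) \<times> (complex ^ 'a). fst p) p"
    by (intro holo_at_fst holo_intros)
  have 2: "holo_at (\<lambda>p::complex \<times> (complex ^ 'a) \<times> (complex ^ 'a). fst (snd p) $ i) p" for i
    by (rule holo_at_snd[of "\<lambda>x. fst x $ i"]) (intro holo_at_fst[of "\<lambda>x. x $ i"] holo_intros)
  have 3: "holo_at (\<lambda>p::complex \<times> (complex ^ 'a) \<times> (complex ^ 'a). snd (snd p) $ i) p" for i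
    by (rule holo_at_snd[of "\<lambda>x. snd x $ i"]) (intro holo_at_snd[of "\<lambda>x. x $ i"] holo_intros)
  have 4: "holo_at (\<lambda>p::complex \<times> (complex ^ 'a) \<times> (complex ^ 'a). (complex_vec z - fst (snd p)) $ i) p" for i
    unfolding vector_minus_component by (intro holo_intros 2)
  show ?thesis
    unfolding ekernel_def by (intro holo_intros q' 1 3 4)
qed

lemma eint_properties:
  assumes L: "gauss_summable L" and q: "kernel_factor q" and u: "fst (snd p) \<in> D_set L"
  shows "holo_at (eint q L) p"
    and "integrable (eint_measure L) (\<lambda>m. indicator {0..} (snd m) *\<^sub>R ekernel q p (fst m) (snd m))"
    and "s \<ge> 0 \<Longrightarrow> (\<lambda>z. norm (ekernel q p z s)) summable_on L"
proof -
  obtain r K where r: "r > 0" "K > 0" and bd: "\<And>p' z s. p' \<in> ball p r \<Longrightarrow> z \<in> L \<Longrightarrow> s \<ge> 0 \<Longrightarrow>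
      norm (ekernel q p' z s) \<le> K * exp (- (norm z)\<^sup>2) * exp (- s)"
    by (rule eint_locally_dominated[OF assms]) blast
  note count = gauss_summable_imp_countable[OF L]
  have gs: "(\<lambda>z. exp (- (norm z)\<^sup>2)) summable_on L"
    using L[unfolded gauss_summable_def, rule_format, of 1] by simp
  have sm: "(\<lambda>z. K * exp (- (norm z)\<^sup>2)) summable_on L"
    using gs by (rule summable_on_cmult_right)
  define g where "g = (\<lambda>m::(real^'a) \<times> real. K * exp (- (norm (fst m))\<^sup>2) * (indicator {0..} (snd m) * exp (- snd m)))"
  have g: "integrable (eint_measure L) g"
    unfolding g_def eint_measure_def
    by (rule integrable_count_space_mult[OF count sigma_finite_lborel _ integrable_exp_tail, where a="\<lambda>z. K * exp (- (norm z)\<^sup>2)"])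
      (use sm r in \<open>simp add: abs_mult\<close>)
  have bound: "norm (indicator {0..} (snd m) *\<^sub>R ekernel q p' (fst m) (snd m)) \<le> g m"
    if "p' \<in> ball p r" "m \<in> space (eint_measure L)" for p' m
    using bd[OF that(1), of "fst m" "snd m"] that(2)
    by (auto simp: g_def eint_measure_def space_pair_measure indicator_def)
  note meas = eint_integrand_measurable[OF count q]
  show "integrable (eint_measure L) (\<lambda>m. indicator {0..} (snd m) *\<^sub>R ekernel q p (fst m) (snd m))"
    by (rule Bochner_Integration.integrable_bound[OF g meas])
      (rule AE_I2, rule order_trans[OF bound], use r in simp, simp, simp only: real_norm_def abs_ge_self)
  have "holo_at (\<lambda>p. \<integral>m. indicator {0..} (snd m) *\<^sub>R ekernel q p (fst m) (snd m) \<partial>eint_measure L) p"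
  proof (rule holo_at_integral[OF r(1) _ meas bound g])
    fix p' and m :: "(real^'a) \<times> real"
    show "holo_at (\<lambda>p. indicator {0..} (snd m) *\<^sub>R ekernel q p (fst m) (snd m)) p'"
      unfolding scaleR_conv_of_real by (intro holo_intros holo_at_ekernel[OF q])
  qed
  then show "holo_at (eint q L) p" by (simp add: eint_def[abs_def])
  show "(\<lambda>z. norm (ekernel q p z s)) summable_on L" if s: "s \<ge> 0"
  proof (rule summable_on_comparison_test)
    show "(\<lambda>z. K * exp (- (norm z)\<^sup>2) * exp (- s)) summable_on L"
      using sm by (rule summable_on_cmult_left)
  qed (use bd[of p] r s in auto)
qed

text \<open>The order with the sum inside is the one that meets Poisson summation, which is an
  identity for each fixed \<open>s\<close>.\<close>

lemma eint_eq_iterated: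
  assumes L: "gauss_summable L" and q: "kernel_factor q" and u: "fst (snd p) \<in> D_set L"
  shows "eint q L p = (\<integral>s. indicator {0..} s *\<^sub>R (\<Sum>\<^sub>\<infinity>z\<in>L. ekernel q p z s) \<partial>lborel)"
    and "integrable lborel (\<lambda>s. indicator {0..} s *\<^sub>R (\<Sum>\<^sub>\<infinity>z\<in>L. ekernel q p z s))"
proof -
  interpret L: sigma_finite_measure "count_space L"
    by (rule sigma_finite_measure_count_space_countable[OF gauss_summable_imp_countable[OF L]])
  interpret pair_sigma_finite "count_space L" "lborel :: real measure" ..
  let ?f = "\<lambda>m. indicator {0..} (snd m) *\<^sub>R ekernel q p (fst m) (snd m)"
  have int: "integrable (count_space L \<Otimes>\<^sub>M lborel) (case_prod (\<lambda>z s. indicator {0..} s *\<^sub>R ekernel q p z s))"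
    using eint_properties(2)[OF assms] by (simp add: eint_measure_def case_prod_beta')
  have eq: "(\<integral>z. indicator {0..} s *\<^sub>R ekernel q p z s \<partial>count_space L) =
      indicator {0..} s *\<^sub>R (\<Sum>\<^sub>\<infinity>z\<in>L. ekernel q p z s)" for s
  proof (cases "s \<ge> 0")
    case True
    then show ?thesis
      using integral_count_space_eq_infsum[OF eint_properties(3)[OF assms True]] by simp
  qed simp
  show "eint q L p = (\<integral>s. indicator {0..} s *\<^sub>R (\<Sum>\<^sub>\<infinity>z\<in>L. ekernel q p z s) \<partial>lborel)"
    using integral_snd[OF int] by (simp only: eq eint_def eint_measure_def case_prod_beta')
  show "integrable lborel (\<lambda>s. indicator {0..} s *\<^sub>R (\<Sum>\<^sub>\<infinity>z\<in>L. ekernel q p z s))"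
    using integrable_snd[OF int] by (simp only: eq)
qed

section \<open>Fourier series on unit cubes\<close>

definition int_vecs :: "(real ^ 'd) set" where
  "int_vecs = {m. \<forall>i. m $ i \<in> \<int>}"

text \<open>Half-open, so that the integer translates partition the space exactly. The centre is
  free: the uniqueness argument works at the centre, and orthogonality compares two cubes.\<close>

definition cube :: "real ^ 'd \<Rightarrow> (real ^ 'd) set" where
  "cube c = {s. \<forall>j. c $ j - 1 / 2 \<le> s $ j \<and> s $ j < c $ j + 1 / 2}"

lemma int_vecs_arith:
  "0 \<in> int_vecs" "m \<in> int_vecs \<Longrightarrow> n \<in> int_vecs \<Longrightarrow> m + n \<in> int_vecs"
  "m \<in> int_vecs \<Longrightarrow> n \<in> int_vecs \<Longrightarrow> m - n \<in> int_vecs" "m \<in> int_vecs \<Longrightarrow> - m \<in> int_vecs"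
  "axis j 1 \<in> int_vecs"
  by (auto simp: int_vecs_def axis_def)

lemma countable_int_vecs: "countable (int_vecs :: (real ^ 'd) set)"
proof -
  have "(int_vecs :: (real ^ 'd) set) \<subseteq> vec_lambda ` (PiE UNIV (\<lambda>_::'d. \<int>))"
  proof
    fix m :: "real ^ 'd" assume "m \<in> int_vecs"
    then have "vec_nth m \<in> PiE UNIV (\<lambda>_. \<int>)" "m = vec_lambda (vec_nth m)"
      by (auto simp: int_vecs_def)
    then show "m \<in> vec_lambda ` (PiE UNIV (\<lambda>_. \<int>))" by blast
  qed
  moreover have "countable (PiE (UNIV :: 'd set) (\<lambda>_. \<int> :: real set))"
    by (intro countable_PiE) (auto simp: Ints_def)
  ultimately show ?thesis by (meson countable_image countable_subset)
qed

lemma cube_translate_unique: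
  fixes s c :: "real ^ 'd"
  obtains m where "m \<in> int_vecs" "\<And>n. n \<in> int_vecs \<Longrightarrow> s + n \<in> cube c \<longleftrightarrow> n = m"
proof
  \<comment> \<open>Coordinatewise the only integer shift that moves \<open>s $ j\<close> into the
    half-open unit interval about \<open>c $ j\<close>.\<close>
  define m :: "real ^ 'd" where "m = (\<chi> j. - of_int \<lfloor>s $ j - c $ j + 1 / 2\<rfloor>)"
  show "m \<in> int_vecs" by (auto simp: int_vecs_def m_def)
  fix n :: "real ^ 'd" assume n: "n \<in> int_vecs"
  have "(c $ j - 1 / 2 \<le> s $ j + n $ j \<and> s $ j + n $ j < c $ j + 1 / 2) \<longleftrightarrow> n $ j = m $ j" for j
  proof -
    obtain k where k: "n $ j = of_int k" using n by (auto simp: int_vecs_def elim: Ints_cases)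
    have "n $ j = m $ j \<longleftrightarrow> \<lfloor>s $ j - c $ j + 1 / 2\<rfloor> = - k"
      unfolding k m_def by simp linarith
    also have "\<dots> \<longleftrightarrow> (c $ j - 1 / 2 \<le> s $ j + n $ j \<and> s $ j + n $ j < c $ j + 1 / 2)"
      unfolding floor_eq_iff k by auto
    finally show ?thesis ..
  qed
  then show "s + n \<in> cube c \<longleftrightarrow> n = m"
    by (simp add: cube_def vec_eq_iff)
qed

lemma cube_sets [measurable]: "cube c \<in> sets borel"
proof -
  have "cube c = (\<Inter>j\<in>UNIV. {s. c $ j - 1 / 2 \<le> s $ j} \<inter> {s. s $ j < c $ j + 1 / 2})"
    by (auto simp: cube_def)
  also have "\<dots> \<in> sets borel"
    by (intro sets.finite_INT sets.Int)
      (auto intro!: borel_closed borel_open closed_Collect_le open_Collect_less continuous_intros)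
  finally show ?thesis .
qed

lemma cube_norm_le: "s \<in> cube c \<Longrightarrow> norm s \<le> norm c + real CARD('d)" for s c :: "real ^ 'd"
proof -
  assume s: "s \<in> cube c"
  have "norm (s - c) \<le> (\<Sum>j\<in>UNIV. \<bar>(s - c) $ j\<bar>)" by (rule norm_le_l1_cart)
  also have "\<dots> \<le> (\<Sum>j\<in>(UNIV::'d set). 1)"
  proof (rule sum_mono)
    fix j show "\<bar>(s - c) $ j\<bar> \<le> 1"
      using s[unfolded cube_def, THEN CollectD, rule_format, of j] by (auto simp: abs_le_iff)
  qed
  finally have "norm (s - c) \<le> real CARD('d)" by simp
  then show ?thesis using norm_triangle_sub[of s c] by linarith
qed

lemma cube_finite_measure: "emeasure lborel (cube c) < \<infinity>"
proof -
  have "bounded (cube c)" by (rule boundedI[OF cube_norm_le])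
  then show ?thesis by (rule emeasure_bounded_finite)
qed

lemma lborel_integral_translate:
  fixes F :: "'a::euclidean_space \<Rightarrow> 'b::{banach,second_countable_topology}"
  assumes [measurable]: "F \<in> borel_measurable borel"
  shows "(\<integral>s. F (a + s) \<partial>lborel) = (\<integral>s. F s \<partial>lborel)"
    and "integrable lborel (\<lambda>s. F (a + s)) \<longleftrightarrow> integrable lborel F"
proof -
  have "(\<integral>s. F s \<partial>lborel) = (\<integral>s. F s \<partial>distr lborel borel ((+) a))" by (simp add: lborel_distr_plus)
  then show "(\<integral>s. F (a + s) \<partial>lborel) = (\<integral>s. F s \<partial>lborel)" by (simp add: integral_distr)
  have "integrable lborel F \<longleftrightarrow> integrable (distr lborel borel ((+) a)) F" by (simp add: lborel_distr_plus)
  then show "integrable lborel (\<lambda>s. F (a + s)) \<longleftrightarrow> integrable lborel F"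
    by (simp add: integrable_distr_eq)
qed

lemma integral_count_space_single:
  fixes z :: complex
  assumes "m0 \<in> A" "\<And>m. m \<in> A \<Longrightarrow> f m = (if m = m0 then z else 0)"
  shows "(\<integral>m. f m \<partial>count_space A) = z"
proof -
  have eq: "{a \<in> A. f a \<noteq> 0} = (if z = 0 then {} else {m0})"
    using assms by (auto split: if_splits)
  then show ?thesis
    using lebesgue_integral_count_space_finite_support[of A f, unfolded eq] assms(2)[OF assms(1)]
    by (simp split: if_splits)
qed

text \<open>For every \<open>s\<close> exactly one integer vector moves \<open>s\<close> into the
  cube, so \<open>F s\<close> is a sum over \<open>m\<close> with a single nonzero term. Fubini
  exchanges sum and integral, and a translation by \<open>m\<close> in each piece gathers everything
  on one cube.\<close>

lemma tiling:
  fixes F :: "real ^ 'd \<Rightarrow> complex"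
  assumes F: "integrable lborel F"
  shows "integrable (count_space int_vecs \<Otimes>\<^sub>M lborel) (\<lambda>(m, s). indicator (cube c) s *\<^sub>R F (s - m))"
    and "(\<integral>s. F s \<partial>lborel) =
      (\<integral>s. indicator (cube c) s *\<^sub>R (\<integral>m. F (s - m) \<partial>count_space int_vecs) \<partial>lborel)"
proof -
  interpret L: sigma_finite_measure "count_space (int_vecs :: (real ^ 'd) set)"
    by (rule sigma_finite_measure_count_space_countable[OF countable_int_vecs])
  interpret pair_sigma_finite "count_space (int_vecs :: (real ^ 'd) set)" "lborel :: (real ^ 'd) measure" ..
  have Fm [measurable]: "F \<in> borel_measurable borel" using F by auto
  let ?N = "count_space (int_vecs :: (real ^ 'd) set) \<Otimes>\<^sub>M (lborel :: (real ^ 'd) measure)"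
  \<comment> \<open>\<open>h\<close> cuts \<open>F\<close> into pieces and \<open>k\<close> is the
    same family after moving the piece with index \<open>m\<close> into the cube:
    \<open>k (m, m + s) = h (m, s)\<close>.\<close>
  define h where "h = (\<lambda>(m, s). indicator (cube c) (m + s) *\<^sub>R F s)"
  define k where "k = (\<lambda>(m, s). indicator (cube c) s *\<^sub>R F (s - m))"
  have hm: "h \<in> borel_measurable ?N" and km: "k \<in> borel_measurable ?N"
    unfolding h_def k_def
    by (intro measurable_pair_measure_countable1[OF countable_int_vecs]; simp)+
  have sup: "\<exists>m0\<in>int_vecs. \<forall>m\<in>int_vecs. h (m, s) = (if m = m0 then F s else 0)" for s
  proof -
    obtain m0 where "m0 \<in> int_vecs" "\<And>n. n \<in> int_vecs \<Longrightarrow> s + n \<in> cube c \<longleftrightarrow> n = m0"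
      using cube_translate_unique by blast
    then show ?thesis by (auto simp: h_def indicator_def add.commute intro!: bexI[of _ m0])
  qed
  have nn: "(\<integral>\<^sup>+m. ennreal (norm (h (m, s))) \<partial>count_space int_vecs) = ennreal (norm (F s))" for s
  proof -
    obtain m0 where m0: "m0 \<in> int_vecs" "\<forall>m\<in>int_vecs. h (m, s) = (if m = m0 then F s else 0)"
      using sup by blast
    have "(\<integral>\<^sup>+m. ennreal (norm (h (m, s))) \<partial>count_space int_vecs) = (\<Sum>m\<in>{m0}. ennreal (norm (h (m, s))))"
      by (rule nn_integral_count_space') (use m0 in auto)
    then show ?thesis using m0 by simp
  qed
  have int_h: "(\<integral>m. h (m, s) \<partial>count_space int_vecs) = F s" for s
  proof -
    obtain m0 where m0: "m0 \<in> int_vecs" "\<forall>m\<in>int_vecs. h (m, s) = (if m = m0 then F s else 0)"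
      using sup by blast
    then show ?thesis by (intro integral_count_space_single[of m0]) auto
  qed
  have "(\<integral>\<^sup>+x. ennreal (norm (h x)) \<partial>?N) = (\<integral>\<^sup>+s. (\<integral>\<^sup>+m. ennreal (norm (h (m, s))) \<partial>count_space int_vecs) \<partial>lborel)"
    by (rule nn_integral_snd[symmetric]) (use hm in measurable)
  also have "\<dots> < \<infinity>" using F by (simp add: nn integrable_iff_bounded)
  finally have h: "integrable ?N h" using hm by (simp add: integrable_iff_bounded)
  have hk: "(\<integral>s. k (m, s) \<partial>lborel) = (\<integral>s. h (m, s) \<partial>lborel)"
    "(\<integral>s. norm (k (m, s)) \<partial>lborel) = (\<integral>s. norm (h (m, s)) \<partial>lborel)"
    "integrable lborel (\<lambda>s. k (m, s))" for m
  proof -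
    have kh: "k (m, m + s) = h (m, s)" for s by (simp add: k_def h_def)
    have meas: "(\<lambda>s. k (m, s)) \<in> borel_measurable borel" unfolding k_def by simp
    show "(\<integral>s. k (m, s) \<partial>lborel) = (\<integral>s. h (m, s) \<partial>lborel)"
      using lborel_integral_translate(1)[OF meas, of m] by (simp add: kh)
    show "(\<integral>s. norm (k (m, s)) \<partial>lborel) = (\<integral>s. norm (h (m, s)) \<partial>lborel)"
      using lborel_integral_translate(1)[OF borel_measurable_norm[THEN measurable_compose[OF meas]], of m]
      by (simp add: kh)
    have "integrable lborel (\<lambda>s. h (m, s))"
    proof (rule Bochner_Integration.integrable_bound[OF F])
      show "(\<lambda>s. h (m, s)) \<in> borel_measurable lborel" unfolding h_def by simp
    qed (simp add: h_def indicator_def)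
    then show "integrable lborel (\<lambda>s. k (m, s))"
      using lborel_integral_translate(2)[OF meas, of m] by (simp add: kh)
  qed
  have k: "integrable ?N k"
  proof (rule Fubini_integrable[OF km])
    show "integrable (count_space int_vecs) (\<lambda>m. \<integral>s. norm (k (m, s)) \<partial>lborel)"
      unfolding hk(2) using integrable_fst'[OF integrable_norm[OF h]] .
  qed (use hk(3) in auto)
  then show "integrable ?N (\<lambda>(m, s). indicator (cube c) s *\<^sub>R F (s - m))" by (simp add: k_def)
  have k': "integrable ?N (case_prod (\<lambda>m s. k (m, s)))" and h': "integrable ?N (case_prod (\<lambda>m s. h (m, s)))"
    using k h by simp_all
  have "(\<integral>s. F s \<partial>lborel) = (\<integral>s. (\<integral>m. h (m, s) \<partial>count_space int_vecs) \<partial>lborel)"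
    by (simp only: int_h)
  also have "\<dots> = (\<integral>m. (\<integral>s. h (m, s) \<partial>lborel) \<partial>count_space int_vecs)"
    using integral_snd[OF h'] integral_fst[OF h'] by simp
  also have "\<dots> = (\<integral>m. (\<integral>s. k (m, s) \<partial>lborel) \<partial>count_space int_vecs)"
    by (simp only: hk(1))
  also have "\<dots> = (\<integral>s. (\<integral>m. k (m, s) \<partial>count_space int_vecs) \<partial>lborel)"
    using integral_snd[OF k'] integral_fst[OF k'] by simp
  also have "\<dots> = (\<integral>s. indicator (cube c) s *\<^sub>R (\<integral>m. F (s - m) \<partial>count_space int_vecs) \<partial>lborel)"
    unfolding k_def by simp
  finally show "(\<integral>s. F s \<partial>lborel) = \<dots>" .
qed

lemma integral_count_space_cube:
  fixes s c :: "real ^ 'd" and z :: complex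
  shows "(\<integral>m. indicator (cube c) (s - m) *\<^sub>R z \<partial>count_space int_vecs) = z"
proof -
  obtain m0 where m0: "m0 \<in> int_vecs" "\<And>n. n \<in> int_vecs \<Longrightarrow> s + n \<in> cube c \<longleftrightarrow> n = m0"
    using cube_translate_unique by blast
  show ?thesis
  proof (rule integral_count_space_single)
    show "- m0 \<in> int_vecs" using m0 int_vecs_arith(4) by blast
    fix m :: "real ^ 'd" assume "m \<in> int_vecs"
    then have "s - m \<in> cube c \<longleftrightarrow> m = - m0"
      using m0(2)[of "- m"] int_vecs_arith(4)[of m] by (auto simp: minus_equation_iff)
    then show "indicator (cube c) (s - m) *\<^sub>R z = (if m = - m0 then z else 0)"
      by (simp add: indicator_def)
  qed
qed

section \<open>Characters of the torus and their orthogonality\<close>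

definition chr :: "real ^ 'd \<Rightarrow> real ^ 'd \<Rightarrow> complex" where
  "chr l s = cis (2 * pi * (l \<bullet> s))"

lemma chr_simps:
  "norm (chr l s) = 1" "chr (l + l') s = chr l s * chr l' s" "chr l (s + s') = chr l s * chr l s'"
  "chr 0 s = 1"
  by (simp_all add: chr_def inner_add_left inner_add_right distrib_left cis_mult)

lemma chr_int:
  assumes "l \<in> int_vecs" "m \<in> int_vecs"
  shows "chr l (s - m) = chr l s"
proof -
  have "l \<bullet> m \<in> \<int>"
    using assms unfolding inner_vec_def int_vecs_def by (auto intro!: Ints_sum)
  then have "cis (2 * pi * (l \<bullet> - m)) = 1" by (intro cis_multiple_2pi) auto
  then have "chr l (- m) = 1" by (simp add: chr_def)
  then show ?thesis using chr_simps(3)[of l s "- m"] by simp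
qed

lemma continuous_on_chr [continuous_intros]:
  "continuous_on S f \<Longrightarrow> continuous_on S (\<lambda>s. chr l (f s))"
  unfolding chr_def by (intro continuous_intros)

lemma chr_measurable [measurable]: "chr l \<in> borel_measurable borel"
  by (intro borel_measurable_continuous_onI continuous_on_chr continuous_on_id)

lemma integrable_cube:
  fixes f :: "real ^ 'd \<Rightarrow> complex"
  assumes [measurable]: "f \<in> borel_measurable borel" and "\<And>s. s \<in> cube c \<Longrightarrow> norm (f s) \<le> B"
  shows "integrable lborel (\<lambda>s. indicator (cube c) s *\<^sub>R f s)"
proof (rule Bochner_Integration.integrable_bound[where f="\<lambda>s. indicator (cube c) s *\<^sub>R B"])
  show "integrable lborel (\<lambda>s. indicator (cube c) s *\<^sub>R B)"
    using cube_finite_measure[of c] by (intro integrable_scaleR_left) simp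
  show "AE s in lborel. norm (indicator (cube c) s *\<^sub>R f s) \<le> norm (indicator (cube c) s *\<^sub>R B)"
    using assms(2) by (intro AE_I2) (fastforce simp: indicator_def)
qed simp

text \<open>Kept as a symbol; what enters is that it is positive and does not depend on the
  centre.\<close>

definition cube_volume :: "'d::finite itself \<Rightarrow> real" where
  "cube_volume _ = measure lborel (cube (0 :: real ^ 'd))"

text \<open>Tiling is applied to the indicator of the cube at 0: its integer translates add up to 1
  everywhere, whichever cube serves for the folding.\<close>

lemma measure_cube: "measure lborel (cube (c :: real ^ 'd)) = cube_volume TYPE('d)"
proof -
  have i: "integrable lborel (\<lambda>s. indicator (cube (0::real^'d)) s *\<^sub>R (1::complex))"
    by (rule integrable_cube[where B=1]) auto
  have "complex_of_real (measure lborel (cube (0::real^'d))) = (\<integral>s. indicator (cube (0::real^'d)) s *\<^sub>R 1 \<partial>lborel)"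
    using cube_finite_measure[of "0::real^'d"] by (subst integral_scaleR_left) (auto simp: scaleR_conv_of_real)
  also have "\<dots> = (\<integral>s. indicator (cube c) s *\<^sub>R 1 \<partial>lborel)"
    by (subst tiling(2)[OF i, of c]) (simp only: integral_count_space_cube)
  also have "\<dots> = complex_of_real (measure lborel (cube c))"
    using cube_finite_measure[of c] by (subst integral_scaleR_left) (auto simp: scaleR_conv_of_real)
  finally show ?thesis by (simp add: cube_volume_def)
qed

text \<open>Moving the cube by a vector \<open>h\<close> with \<open>chr l h = - 1\<close> changes
  the sign of the integral by translation, and leaves the integral as it is by tiling, because
  \<open>chr l\<close> is periodic.\<close>

lemma chr_orthogonal:
  fixes l c :: "real ^ 'd"
  assumes l: "l \<in> int_vecs" and "l \<noteq> 0"
  shows "(\<integral>s. indicator (cube c) s *\<^sub>R chr l s \<partial>lborel) = 0"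
proof -
  obtain j where j: "l $ j \<noteq> 0" using \<open>l \<noteq> 0\<close> by (auto simp: vec_eq_iff)
  \<comment> \<open>Half a period of the character, along a coordinate in which \<open>l\<close>
    does not vanish.\<close>
  define h :: "real ^ 'd" where "h = axis j (1 / (2 * l $ j))"
  have "l \<bullet> h = 1 / 2" using j by (simp add: h_def inner_axis)
  then have h: "chr l h = - 1" unfolding chr_def by (simp only: mult.assoc) simp
  let ?F = "\<lambda>s. indicator (cube (h + c)) s *\<^sub>R chr l s"
  have F: "integrable lborel ?F" by (rule integrable_cube[where B=1]) (auto simp: chr_simps)
  have "(\<integral>s. ?F s \<partial>lborel) = (\<integral>s. indicator (cube c) s *\<^sub>R (\<integral>m. ?F (s - m) \<partial>count_space int_vecs) \<partial>lborel)"
    by (rule tiling(2)[OF F])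
  moreover have "(\<integral>m. ?F (s - m) \<partial>count_space int_vecs) = chr l s" for s
  proof -
    have "(\<integral>m. ?F (s - m) \<partial>count_space int_vecs) =
        (\<integral>m. indicator (cube (h + c)) (s - m) *\<^sub>R chr l s \<partial>count_space int_vecs)"
      by (rule Bochner_Integration.integral_cong) (auto simp: chr_int[OF l])
    then show ?thesis by (simp only: integral_count_space_cube)
  qed
  ultimately have 1: "(\<integral>s. ?F s \<partial>lborel) = (\<integral>s. indicator (cube c) s *\<^sub>R chr l s \<partial>lborel)"
    by (simp only:)
  have "(\<integral>s. ?F s \<partial>lborel) = (\<integral>s. ?F (h + s) \<partial>lborel)"
    by (rule lborel_integral_translate(1)[symmetric]) measurable
  also have "\<dots> = (\<integral>s. - (indicator (cube c) s *\<^sub>R chr l s) \<partial>lborel)"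
  proof (rule Bochner_Integration.integral_cong[OF refl])
    fix s
    have "h + s \<in> cube (h + c) \<longleftrightarrow> s \<in> cube c" by (simp add: cube_def)
    then show "?F (h + s) = - (indicator (cube c) s *\<^sub>R chr l s)"
      by (simp add: chr_simps h indicator_def)
  qed
  also have "\<dots> = - (\<integral>s. indicator (cube c) s *\<^sub>R chr l s \<partial>lborel)" by simp
  finally show ?thesis using 1 by simp
qed

text \<open>Rudin's argument: the trigonometric polynomial \<open>p = \<eta>/2 + (\<Sum>j. cos (2\<pi>(s\<^sub>j - c\<^sub>j)))/d\<close> exceeds
  \<open>1 + \<eta>/4\<close> near the centre \<open>c\<close> of the cube and is at most 1 in absolute value away from it,
  so that the integral of \<open>D p\<^sup>n\<close> would blow up if \<open>D c \<noteq> 0\<close>.\<close>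

lemma fourier_coefficients_unique:
  fixes D :: "real ^ 'd \<Rightarrow> complex" and c :: "real ^ 'd"
  assumes cont: "continuous_on UNIV D"
    and zero: "\<And>l. l \<in> int_vecs \<Longrightarrow> (\<integral>s. indicator (cube c) s *\<^sub>R (D s * chr l s) \<partial>lborel) = 0"
  shows "D c = 0"
proof (rule ccontr)
  assume Dc: "D c \<noteq> 0"
  define d where "d = real CARD('d)"
  have d: "d > 0" by (simp add: d_def)
  have [measurable]: "D \<in> borel_measurable borel" by (rule borel_measurable_continuous_onI[OF cont])
  have "compact (D ` cball 0 (norm c + d))"
    by (intro compact_continuous_image continuous_on_subset[OF cont]) auto
  then obtain B0 where B0: "\<And>s. s \<in> cube c \<Longrightarrow> norm (D s) \<le> B0"
    using cube_norm_le unfolding d_def by (fastforce dest!: compact_imp_bounded simp: bounded_iff)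
  \<comment> \<open>Rotating by the conjugate of \<open>D c\<close> and taking real parts gives a
    real function with the positive value \<open>a\<close> at \<open>c\<close>; its integrals
    against powers of the real polynomial \<open>P\<close> vanish as well.\<close>
  define r where "r = (\<lambda>s. Re (cnj (D c) * D s))"
  define a where "a = (norm (D c))\<^sup>2"
  have a: "a > 0" using Dc by (simp add: a_def)
  have rc: "r c = a" unfolding r_def a_def
    by (metis Re_complex_of_real complex_norm_square mult.commute)
  define B where "B = max 0 (norm (D c) * B0)"
  have B: "\<bar>r s\<bar> \<le> B" if "s \<in> cube c" for s
  proof -
    have "\<bar>r s\<bar> \<le> norm (cnj (D c) * D s)" unfolding r_def by (rule abs_Re_le_cmod)
    also have "\<dots> \<le> norm (D c) * B0" using B0[OF that] by (simp add: norm_mult mult_left_mono)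
    finally show ?thesis by (simp add: B_def)
  qed
  have B_nonneg: "B \<ge> 0" by (simp add: B_def)
  have rcont: "continuous_on UNIV r" unfolding r_def by (intro continuous_intros cont)
  then have "isCont r c" by (simp add: continuous_on_eq_continuous_at)
  then obtain e where e0: "e > 0" "\<And>s. dist s c < e \<Longrightarrow> dist (r s) (r c) < a / 2"
    using half_gt_zero[OF a] unfolding continuous_at_eps_delta by blast
  have e: "e > 0" "dist s c < e \<Longrightarrow> r s > a / 2" for s
    using e0(1) e0(2)[of s] unfolding rc dist_real_def by linarith+
  \<comment> \<open>The bound \<open>1 / 4\<close> keeps the cosines nonnegative near the centre.
    The other one passes from coordinates to the Euclidean norm:
    \<open>d * \<delta> < e\<close>.\<close>
  define \<delta> where "\<delta> = min (1 / 4) (e / (d + 1))"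
  have \<delta>: "\<delta> > 0" "\<delta> \<le> 1 / 4"
    using e(1) d min.cobounded1[of "1 / 4" "e / (d + 1)"] by (auto simp: \<delta>_def simp del: min.cobounded1)
  have near: "r s > a / 2" if "\<And>j. \<bar>s $ j - c $ j\<bar> < \<delta>" for s
  proof -
    have "dist s c \<le> (\<Sum>j\<in>UNIV. \<bar>(s - c) $ j\<bar>)" unfolding dist_norm by (rule norm_le_l1_cart)
    also have "\<dots> \<le> (\<Sum>j\<in>(UNIV::'d set). \<delta>)"
      by (rule sum_mono) (use that in \<open>auto intro: less_imp_le\<close>)
    also have "\<dots> = d * \<delta>" by (simp add: d_def)
    also have "\<dots> \<le> d * (e / (d + 1))" using d by (intro mult_left_mono) (auto simp: \<delta>_def)
    also have "\<dots> < e" using d e(1) by (simp add: field_simps)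
    finally show ?thesis by (rule e(2))
  qed
  \<comment> \<open>If one coordinate is at least \<delta> away from the centre, the mean of the
    \<open>d\<close> cosines drops to \<open>1 - \<eta>\<close> or less, so that adding
    \<open>\<eta> / 2\<close> in \<open>P\<close> stays below 1.\<close>
  define \<eta> where "\<eta> = (1 - cos (2 * pi * \<delta>)) / d"
  have cos_far: "cos (2 * pi * x) \<le> cos (2 * pi * \<delta>)" if "\<delta> \<le> \<bar>x\<bar>" "\<bar>x\<bar> \<le> 1 / 2" for x
  proof -
    have "cos (2 * pi * \<bar>x\<bar>) \<le> cos (2 * pi * \<delta>)"
      using that \<delta> by (intro cos_monotone_0_pi_le) auto
    then show ?thesis by (cases "x \<ge> 0") auto
  qed
  have cos_near: "cos (2 * pi * x) \<ge> 0" if "\<bar>x\<bar> < \<delta>" for x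
  proof -
    have "2 * pi * \<bar>x\<bar> \<le> 2 * pi * (1 / 4)" using that \<delta> by (intro mult_left_mono) auto
    then have "cos (2 * pi * \<bar>x\<bar>) \<ge> 0" by (intro cos_ge_zero) (auto intro: order_trans[of _ 0])
    then show ?thesis by (cases "x \<ge> 0") auto
  qed
  have "cos (2 * pi * \<delta>) < cos 0"
    using \<delta> by (intro cos_monotone_0_pi) auto
  then have \<eta>: "\<eta> > 0" using d by (simp add: \<eta>_def)
  have "isCont (\<lambda>x. cos (2 * pi * x)) 0" by (intro continuous_intros)
  then obtain \<epsilon> where \<epsilon>0: "\<epsilon> > 0"
    "\<And>x. dist x 0 < \<epsilon> \<Longrightarrow> dist (cos (2 * pi * x)) (cos (2 * pi * 0)) < \<eta> / 4"
    using divide_pos_pos[OF \<eta>, of 4] unfolding continuous_at_eps_delta by (meson zero_less_numeral)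
  have \<epsilon>: "\<epsilon> > 0" "\<bar>x\<bar> < \<epsilon> \<Longrightarrow> \<bar>cos (2 * pi * x) - 1\<bar> < \<eta> / 4" for x
    using \<epsilon>0(1) \<epsilon>0(2)[of x] by (simp_all add: dist_real_def)
  \<comment> \<open>Within this smaller distance all cosines exceed \<open>1 - \<eta> / 4\<close>,
    and the summand \<open>\<eta> / 2\<close> lifts \<open>P\<close> to at least
    \<open>1 + \<eta> / 4\<close>.\<close>
  define \<delta>' where "\<delta>' = min \<delta> \<epsilon>"
  have \<delta>': "\<delta>' > 0" "\<delta>' \<le> \<delta>" using \<delta> \<epsilon> by (auto simp: \<delta>'_def)
  define P where "P = (\<lambda>s. \<eta> / 2 + (\<Sum>j\<in>(UNIV::'d set). cos (2 * pi * (s $ j - c $ j))) / d)"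
  have P_near: "P s \<ge> 0" if "\<And>j. \<bar>s $ j - c $ j\<bar> < \<delta>" for s
    unfolding P_def using \<eta> d cos_near that by (intro add_nonneg_nonneg divide_nonneg_nonneg sum_nonneg) auto
  have P_nearer: "P s \<ge> 1 + \<eta> / 4" if s: "\<And>j. \<bar>s $ j - c $ j\<bar> < \<delta>'" for s
  proof -
    have "(\<Sum>j\<in>(UNIV::'d set). 1 - \<eta> / 4) \<le> (\<Sum>j\<in>UNIV. cos (2 * pi * (s $ j - c $ j)))"
    proof (rule sum_mono)
      fix j show "1 - \<eta> / 4 \<le> cos (2 * pi * (s $ j - c $ j))"
        using \<epsilon>(2)[of "s $ j - c $ j"] s[of j] by (auto simp: \<delta>'_def abs_less_iff)
    qed
    then have "d * (1 - \<eta> / 4) \<le> (\<Sum>j\<in>UNIV. cos (2 * pi * (s $ j - c $ j)))" by (simp add: d_def)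
    then have "1 - \<eta> / 4 \<le> (\<Sum>j\<in>UNIV. cos (2 * pi * (s $ j - c $ j))) / d"
      using d by (simp add: pos_le_divide_eq mult.commute)
    then show ?thesis by (simp add: P_def)
  qed
  have P_far: "\<bar>P s\<bar> \<le> 1" if s: "s \<in> cube c" and far: "\<not> (\<forall>j. \<bar>s $ j - c $ j\<bar> < \<delta>)" for s
  proof -
    obtain j0 where j0: "\<bar>s $ j0 - c $ j0\<bar> \<ge> \<delta>" using far by (auto simp: not_less)
    have "\<bar>s $ j0 - c $ j0\<bar> \<le> 1 / 2"
      using s[unfolded cube_def, THEN CollectD, rule_format, of j0] by linarith
    then have c1: "cos (2 * pi * (s $ j0 - c $ j0)) \<le> cos (2 * pi * \<delta>)" by (rule cos_far[OF j0])
    have "(\<Sum>j\<in>UNIV. cos (2 * pi * (s $ j - c $ j))) =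
        cos (2 * pi * (s $ j0 - c $ j0)) + (\<Sum>j\<in>UNIV - {j0}. cos (2 * pi * (s $ j - c $ j)))"
      by (rule sum.remove) auto
    also have "\<dots> \<le> cos (2 * pi * \<delta>) + (\<Sum>j\<in>UNIV - {j0}. 1)"
      by (intro add_mono c1 sum_mono) auto
    also have "\<dots> = d * (1 - \<eta>)"
      using d by (simp add: \<eta>_def d_def card_Diff_singleton of_nat_diff Suc_leI field_simps)
    finally have up: "(\<Sum>j\<in>UNIV. cos (2 * pi * (s $ j - c $ j))) / d \<le> 1 - \<eta>"
      using d by (simp add: pos_divide_le_eq mult.commute)
    have "(\<Sum>j\<in>(UNIV::'d set). - 1) \<le> (\<Sum>j\<in>UNIV. cos (2 * pi * (s $ j - c $ j)))"
      by (rule sum_mono) auto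
    then have "- 1 \<le> (\<Sum>j\<in>UNIV. cos (2 * pi * (s $ j - c $ j))) / d"
      using d by (simp add: pos_le_divide_eq d_def)
    then show ?thesis using up \<eta> by (simp add: P_def abs_le_iff)
  qed
  have Pcont: "continuous_on UNIV P" unfolding P_def using d by (intro continuous_intros) auto
  \<comment> \<open>The property to be carried from one power of \<open>P\<close> to the next: all
    Fourier coefficients of \<open>D * q\<close> vanish. A factor \<open>P\<close> only mixes
    frequencies \<open>l\<close>, \<open>l + axis j 1\<close> and \<open>l - axis j 1\<close>, so
    the property is stable.\<close>
  define T where "T = (\<lambda>q::real^'d \<Rightarrow> complex. continuous_on UNIV q \<and>
    (\<forall>l\<in>int_vecs. (\<integral>s. indicator (cube c) s *\<^sub>R (D s * q s * chr l s) \<partial>lborel) = 0))"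
  have intble: "integrable lborel (\<lambda>s. indicator (cube c) s *\<^sub>R q s)" if q: "continuous_on UNIV q" for q :: "real ^ 'd \<Rightarrow> complex"
  proof -
    have "compact (q ` cball 0 (norm c + d))"
      by (intro compact_continuous_image continuous_on_subset[OF q]) auto
    then obtain Bq where Bq: "\<And>s. s \<in> cube c \<Longrightarrow> norm (q s) \<le> Bq"
      using cube_norm_le unfolding d_def by (fastforce dest!: compact_imp_bounded simp: bounded_iff)
    show ?thesis by (rule integrable_cube[OF borel_measurable_continuous_onI[OF q] Bq])
  qed
  have T_step: "T (\<lambda>s. q s * of_real (P s))" if q: "T q" for q
  proof -
    have qc: "continuous_on UNIV q" using q by (simp add: T_def)
    have "(\<integral>s. indicator (cube c) s *\<^sub>R (D s * (q s * of_real (P s)) * chr l s) \<partial>lborel) = 0"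
      if l: "l \<in> int_vecs" for l
    proof -
      let ?G = "\<lambda>k s. indicator (cube c) s *\<^sub>R (D s * q s * chr k s)"
      have G: "integrable lborel (?G k)" for k
        by (rule intble) (intro continuous_intros cont qc)
      have G0: "(\<integral>s. ?G k s \<partial>lborel) = 0" if "k \<in> int_vecs" for k
        using q that by (simp add: T_def)
      \<comment> \<open>A phase that makes up for the cosines being centred at \<open>c\<close> and
        not at the origin.\<close>
      define \<kappa> where "\<kappa> = (\<lambda>j. cis (2 * pi * c $ j))"
      have cosexp: "complex_of_real (cos (2 * pi * (s $ j - c $ j))) * chr l s =
          (cnj (\<kappa> j) * chr (l + axis j 1) s + \<kappa> j * chr (l - axis j 1) s) / 2" for s j
      proof -
        have c1: "complex_of_real (cos x) = (cis x + cis (- x)) / 2" for x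
          by (simp add: complex_eq_iff)
        have c2: "cis (2 * pi * (s $ j - c $ j)) = cnj (\<kappa> j) * chr (axis j 1) s"
          by (simp add: \<kappa>_def chr_def inner_axis' cis_cnj cis_mult algebra_simps)
        have c3: "cis (- (2 * pi * (s $ j - c $ j))) = \<kappa> j * chr (- axis j 1) s"
          by (simp add: \<kappa>_def chr_def inner_axis' cis_cnj cis_mult algebra_simps)
        have c4: "chr (l - axis j 1) s = chr l s * chr (- axis j 1) s"
          using chr_simps(2)[of l "- axis j 1" s] by simp
        show ?thesis
          unfolding c1 c2 c3 c4 chr_simps(2) by (simp add: field_simps)
      qed
      have "indicator (cube c) s *\<^sub>R (D s * (q s * of_real (P s)) * chr l s) =
          of_real (\<eta> / 2) * ?G l s + (\<Sum>j\<in>UNIV. (cnj (\<kappa> j) / (2 * of_real d)) * ?G (l + axis j 1) s +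
            (\<kappa> j / (2 * of_real d)) * ?G (l - axis j 1) s)" for s
      proof (cases "s \<in> cube c")
        case True
        have "of_real (P s) * chr l s = of_real (\<eta> / 2) * chr l s +
            (\<Sum>j\<in>UNIV. complex_of_real (cos (2 * pi * (s $ j - c $ j))) * chr l s) / of_real d"
          by (simp add: P_def algebra_simps sum_distrib_left sum_divide_distrib add_divide_distrib)
        also have "\<dots> = of_real (\<eta> / 2) * chr l s + (\<Sum>j\<in>UNIV. (cnj (\<kappa> j) / (2 * of_real d)) * chr (l + axis j 1) s +
            (\<kappa> j / (2 * of_real d)) * chr (l - axis j 1) s)"
          unfolding cosexp sum_divide_distrib by (simp add: add_divide_distrib)
        finally have *: "of_real (P s) * chr l s = \<dots>" .
        have "D s * (q s * of_real (P s)) * chr l s = (D s * q s) * (of_real (P s) * chr l s)"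
          by (simp only: mult_ac)
        then show ?thesis using True
          unfolding * by (simp add: distrib_left sum_distrib_left mult_ac)
      qed simp
      then have "(\<integral>s. indicator (cube c) s *\<^sub>R (D s * (q s * of_real (P s)) * chr l s) \<partial>lborel) =
          of_real (\<eta> / 2) * (\<integral>s. ?G l s \<partial>lborel) +
          (\<Sum>j\<in>UNIV. (cnj (\<kappa> j) / (2 * of_real d)) * (\<integral>s. ?G (l + axis j 1) s \<partial>lborel) +
            (\<kappa> j / (2 * of_real d)) * (\<integral>s. ?G (l - axis j 1) s \<partial>lborel))"
        by (simp only: Bochner_Integration.integral_add Bochner_Integration.integral_sum
            Bochner_Integration.integrable_add Bochner_Integration.integrable_sum G
            integral_mult_right_zero integrable_mult_right)
      also have "\<dots> = 0"
        using l by (simp add: G0 int_vecs_arith)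
      finally show ?thesis .
    qed
    then show ?thesis using qc Pcont unfolding T_def by (auto intro!: continuous_intros)
  qed
  have T_pow: "T (\<lambda>s. of_real (P s) ^ n)" for n
  proof (induction n)
    case 0
    then show ?case using zero by (simp add: T_def)
  next
    case (Suc n)
    from T_step[OF this] show ?case by (simp add: mult.commute)
  qed
  define V where "V = measure lborel (cube c)"
  define Q where "Q = box (c - \<delta>' *\<^sub>R 1) (c + \<delta>' *\<^sub>R 1)"
  have Q_iff: "s \<in> Q \<longleftrightarrow> (\<forall>j. \<bar>s $ j - c $ j\<bar> < \<delta>')" for s
    by (auto simp: Q_def mem_box_cart abs_less_iff algebra_simps)
  have Q_sub: "Q \<subseteq> cube c"
  proof
    fix s assume "s \<in> Q"
    then have *: "\<bar>s $ j - c $ j\<bar> < \<delta>'" for j using Q_iff[of s] by blast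
    have "c $ j - 1 / 2 \<le> s $ j \<and> s $ j < c $ j + 1 / 2" for j
      using *[of j] \<delta>(2) \<delta>'(2) by linarith
    then show "s \<in> cube c" by (simp add: cube_def)
  qed
  have Qm: "Q \<in> sets lborel" unfolding Q_def by simp
  have Qfin: "emeasure lborel Q < \<infinity>"
    unfolding Q_def using emeasure_lborel_box_finite by blast
  have Qpos: "measure lborel Q > 0"
  proof -
    have "c \<in> Q" using \<delta>' Q_iff[of c] by simp
    moreover have "open Q" unfolding Q_def by (rule open_box)
    ultimately have "\<not> negligible Q" using open_not_negligible by blast
    then have "Q \<notin> null_sets lborel"
      using negligible_iff_null_sets null_sets_completionI by blast
    then have "emeasure lborel Q \<noteq> 0" using Qm by auto
    then show ?thesis using Qfin by (simp add: measure_def enn2real_positive_iff less_top zero_less_iff_neq_zero)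
  qed
  \<comment> \<open>The integral of \<open>r * P ^ n\<close> is 0. Its integrand is at least
    \<open>(a / 2) * (1 + \<eta> / 4) ^ n\<close> on \<open>Q\<close>, nonnegative on the rest of
    the \<delta>-neighbourhood, and at least \<open>- B\<close> elsewhere in the cube.\<close>
  have bound: "(a / 2) * (1 + \<eta> / 4) ^ n * measure lborel Q \<le> B * V" for n
  proof -
    have 1: "(\<integral>s. indicator (cube c) s *\<^sub>R (r s * P s ^ n) \<partial>lborel) = 0"
      and 2: "integrable lborel (\<lambda>s. indicator (cube c) s *\<^sub>R (r s * P s ^ n))"
    proof -
      let ?h = "\<lambda>s. indicator (cube c) s *\<^sub>R (D s * of_real (P s) ^ n)"
      have h0: "(\<integral>s. ?h s \<partial>lborel) = 0"
        using T_pow[of n, unfolded T_def] int_vecs_arith(1) by (auto simp: chr_simps dest!: bspec[of _ _ 0])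
      have hi: "integrable lborel ?h" by (rule intble) (intro continuous_intros cont Pcont)
      have eq: "Re (cnj (D c) * ?h s) = indicator (cube c) s *\<^sub>R (r s * P s ^ n)" for s
      proof -
        have "cnj (D c) * ?h s = of_real (indicator (cube c) s * P s ^ n) * (cnj (D c) * D s)"
          by (simp add: scaleR_conv_of_real)
        moreover have "Re (of_real x * w) = x * Re w" for x w by simp
        ultimately show ?thesis unfolding r_def by (simp only:) simp
      qed
      have "(\<integral>s. Re (cnj (D c) * ?h s) \<partial>lborel) = Re (\<integral>s. cnj (D c) * ?h s \<partial>lborel)"
        by (intro integral_Re integrable_mult_right hi)
      also have "\<dots> = 0" unfolding integral_mult_right_zero h0 by simp
      finally show "(\<integral>s. indicator (cube c) s *\<^sub>R (r s * P s ^ n) \<partial>lborel) = 0" unfolding eq .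
      have "integrable lborel (\<lambda>s. Re (cnj (D c) * ?h s))" 
        by (intro integrable_Re integrable_mult_right hi)
      then show "integrable lborel (\<lambda>s. indicator (cube c) s *\<^sub>R (r s * P s ^ n))" unfolding eq .
    qed
    let ?A = "(a / 2) * (1 + \<eta> / 4) ^ n"
    have iQ0: "integrable lborel (indicator Q :: _ \<Rightarrow> real)"
      by (rule integrable_real_indicator[OF Qm Qfin])
    have ic0: "integrable lborel (indicator (cube c) :: _ \<Rightarrow> real)"
      by (rule integrable_real_indicator[OF _ cube_finite_measure]) simp
    have iQ: "integrable lborel (\<lambda>s. indicator Q s *\<^sub>R x)" for x :: real
      by (rule integrable_scaleR_left[OF iQ0])
    have ic: "integrable lborel (\<lambda>s. indicator (cube c) s *\<^sub>R x)" for x :: real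
      by (rule integrable_scaleR_left[OF ic0])
    have "(\<integral>s. indicator Q s *\<^sub>R ?A - indicator (cube c) s *\<^sub>R B \<partial>lborel) \<le>
        (\<integral>s. indicator (cube c) s *\<^sub>R (r s * P s ^ n) \<partial>lborel)"
    proof (rule integral_mono[OF _ 2])
      show "integrable lborel (\<lambda>s. indicator Q s *\<^sub>R ?A - indicator (cube c) s *\<^sub>R B)"
        by (rule Bochner_Integration.integrable_diff[OF iQ ic])
      fix s
      show "indicator Q s *\<^sub>R ?A - indicator (cube c) s *\<^sub>R B \<le> indicator (cube c) s *\<^sub>R (r s * P s ^ n)"
      proof (cases "s \<in> cube c")
        case False
        then show ?thesis using Q_sub by (auto simp: indicator_def)
      next
        case True
        consider "s \<in> Q" | "s \<notin> Q" "\<forall>j. \<bar>s $ j - c $ j\<bar> < \<delta>" | "s \<notin> Q" "\<not> (\<forall>j. \<bar>s $ j - c $ j\<bar> < \<delta>)"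
          by blast
        then show ?thesis
        proof cases
          case 1
          then have "\<And>j. \<bar>s $ j - c $ j\<bar> < \<delta>'" using Q_iff by blast
          moreover from this have "\<And>j. \<bar>s $ j - c $ j\<bar> < \<delta>" using \<delta>' by (meson less_le_trans)
          ultimately have "r s \<ge> a / 2" "P s \<ge> 1 + \<eta> / 4" using near[of s] P_nearer[of s] by auto
          then have "?A \<le> r s * P s ^ n"
            using a \<eta> by (intro mult_mono power_mono) auto
          then show ?thesis using 1 True B_nonneg by simp
        next
          case 2
          then have "r s \<ge> 0" "P s \<ge> 0" using near[of s] P_near[of s] a by auto
          then have "r s * P s ^ n \<ge> 0" by simp
          then show ?thesis using 2 True B_nonneg by simp
        next
          case 3
          then have "\<bar>P s\<bar> \<le> 1" using P_far True by blast
          then have "\<bar>r s\<bar> * \<bar>P s\<bar> ^ n \<le> B * 1"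
            using B[OF True] B_nonneg by (intro mult_mono power_le_one) auto
          then have "\<bar>r s * P s ^ n\<bar> \<le> B" by (simp add: abs_mult power_abs)
          then show ?thesis using 3 True by (simp add: abs_le_iff)
        qed
      qed
    qed
    also have "(\<integral>s. indicator Q s *\<^sub>R ?A - indicator (cube c) s *\<^sub>R B \<partial>lborel) = ?A * measure lborel Q - B * V"
      unfolding Bochner_Integration.integral_diff[OF iQ ic] integral_scaleR_left[OF iQ0] integral_scaleR_left[OF ic0]
      by (simp add: V_def mult.commute)
    finally show ?thesis using 1 by simp
  qed
  have "1 < 1 + \<eta> / 4" using \<eta> by simp
  then obtain n where "B * V / (a / 2 * measure lborel Q) < (1 + \<eta> / 4) ^ n"
    using real_arch_pow by blast
  then have "B * V < (a / 2) * (1 + \<eta> / 4) ^ n * measure lborel Q"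
    using a Qpos by (simp add: field_simps)
  with bound[of n] show False by simp
qed

section \<open>Poisson summation for Gaussians\<close>

lemma integrable_exp_neg_abs: "integrable lborel (\<lambda>s::real. exp (- \<bar>s\<bar>))"
proof -
  let ?f = "\<lambda>s::real. indicator {0..} s * exp (- s) :: real"
  have "integrable lborel (\<lambda>s. ?f (0 + (- 1) * s))"
    using integrable_exp_tail by (rule lborel_integrable_real_affine) simp
  then have "integrable lborel (\<lambda>s. ?f s + ?f (0 + (- 1) * s))"
    using integrable_exp_tail by (intro Bochner_Integration.integrable_add)
  then show ?thesis
    by (rule Bochner_Integration.integrable_bound) (auto simp: indicator_def)
qed

text \<open>In one dimension by comparison with \<open>exp (- \<bar>x\<bar>)\<close>, then by
  Tonelli, since the Gaussian is a product over the coordinates.\<close>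

lemma integrable_gaussian:
  fixes c :: real
  assumes c: "c > 0"
  shows "integrable lborel (\<lambda>s::'a::euclidean_space. exp (- c * (norm s)\<^sup>2))"
proof (rule integrableI_nonneg)
  have 1: "(\<integral>\<^sup>+x. ennreal (exp (- c * x\<^sup>2)) \<partial>lborel) < \<infinity>"
  proof -
    have "integrable lborel (\<lambda>x::real. exp (1 / (4 * c)) * exp (- \<bar>x\<bar>))"
      using integrable_exp_neg_abs by (rule integrable_mult_right)
    then have "integrable lborel (\<lambda>x::real. exp (- c * x\<^sup>2))"
    proof (rule Bochner_Integration.integrable_bound)
      show "AE x in lborel. norm (exp (- c * x\<^sup>2)) \<le> norm (exp (1 / (4 * c)) * exp (- \<bar>x\<bar>))"
      proof (rule AE_I2)
        fix x :: real
        have "1 * \<bar>x\<bar> - c * \<bar>x\<bar>\<^sup>2 \<le> 1\<^sup>2 / (4 * c)" by (rule quadratic_le[OF c])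
        then have "- c * x\<^sup>2 \<le> 1 / (4 * c) + - \<bar>x\<bar>" by simp
        then show "norm (exp (- c * x\<^sup>2)) \<le> norm (exp (1 / (4 * c)) * exp (- \<bar>x\<bar>))"
          by (simp flip: exp_add)
      qed
    qed simp
    then show ?thesis by (simp add: integrable_iff_bounded)
  qed
  have "(\<integral>\<^sup>+s. ennreal (exp (- c * (norm s)\<^sup>2)) \<partial>(lborel :: 'a measure)) =
      (\<integral>\<^sup>+s. (\<Prod>b\<in>Basis. ennreal (exp (- c * (s \<bullet> b)\<^sup>2))) \<partial>(lborel :: 'a measure))"
  proof (rule nn_integral_cong)
    fix s :: 'a
    have "(norm s)\<^sup>2 = (\<Sum>b\<in>Basis. (s \<bullet> b)\<^sup>2)"
      unfolding power2_norm_eq_inner by (subst euclidean_inner) (simp add: power2_eq_square)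
    then have "- c * (norm s)\<^sup>2 = (\<Sum>b\<in>Basis. - c * (s \<bullet> b)\<^sup>2)"
      by (simp add: sum_distrib_left sum_negf)
    then show "ennreal (exp (- c * (norm s)\<^sup>2)) = (\<Prod>b\<in>Basis. ennreal (exp (- c * (s \<bullet> b)\<^sup>2)))"
      by (simp add: exp_sum prod_ennreal)
  qed
  also have "\<dots> = (\<Prod>b\<in>(Basis :: 'a set). \<integral>\<^sup>+x. ennreal (exp (- c * x\<^sup>2)) \<partial>lborel)"
    by (rule nn_integral_lborel_prod) auto
  also have "\<dots> < \<infinity>" using 1 by (simp add: power_less_top_ennreal)
  finally show "(\<integral>\<^sup>+s. ennreal (exp (- c * (norm s)\<^sup>2)) \<partial>(lborel :: 'a measure)) < \<infinity>" .
qed auto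

lemma cube_volume_pos: "cube_volume TYPE('d::finite) > 0"
proof -
  let ?Q = "cube (0 :: real ^ 'd)"
  let ?B = "box (- (1 / 4) *\<^sub>R 1) ((1 / 4) *\<^sub>R 1) :: (real ^ 'd) set"
  have "0 \<in> ?B" by (auto simp: mem_box_cart)
  moreover have "open ?B" by (rule open_box)
  ultimately have "\<not> negligible ?B" using open_not_negligible by blast
  then have "?B \<notin> null_sets lborel"
    using negligible_iff_null_sets null_sets_completionI by blast
  moreover have "?B \<subseteq> ?Q"
  proof
    fix s :: "real ^ 'd" assume "s \<in> ?B"
    then have *: "- (1 / 4) < s $ j \<and> s $ j < 1 / 4" for j by (auto simp: mem_box_cart)
    have "- (1 / 2) \<le> s $ j \<and> s $ j < 1 / 2" for j using *[of j] by linarith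
    then show "s \<in> ?Q" by (simp add: cube_def)
  qed
  ultimately have "?Q \<notin> null_sets lborel" using null_sets_subset[of ?Q lborel ?B] by auto
  then have "emeasure lborel ?Q \<noteq> 0" by auto
  then show ?thesis using cube_finite_measure[of "0 :: real ^ 'd"]
    by (simp add: cube_volume_def measure_def enn2real_positive_iff less_top zero_less_iff_neq_zero)
qed

text \<open>An integral test: tiling makes the integrals of a Gaussian over the translated cubes
  summable, and each of them dominates a fixed multiple of the term at the corresponding integer
  vector.\<close>

lemma gauss_summable_int_vecs: "gauss_summable (int_vecs :: (real ^ 'd) set)"
  unfolding gauss_summable_def
proof (intro allI impI)
  fix c :: real assume c: "c > 0"
  let ?F = "\<lambda>s::real^'d. complex_of_real (exp (- (c / 2) * (norm s)\<^sup>2))"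
  have F: "integrable lborel ?F" using c by (intro integrable_of_real integrable_gaussian) simp
  interpret L: sigma_finite_measure "count_space (int_vecs :: (real ^ 'd) set)"
    by (rule sigma_finite_measure_count_space_countable[OF countable_int_vecs])
  interpret pair_sigma_finite "count_space (int_vecs :: (real ^ 'd) set)" "lborel :: (real ^ 'd) measure" ..
  let ?N = "count_space (int_vecs :: (real ^ 'd) set) \<Otimes>\<^sub>M (lborel :: (real ^ 'd) measure)"
  let ?k = "\<lambda>(m, s). indicator (cube 0) s *\<^sub>R ?F (s - m)"
  define d where "d = real CARD('d)"
  \<comment> \<open>On \<open>cube 0\<close> the square of \<open>norm (s - m)\<close> is at most
    \<open>2 * d\<^sup>2 + 2 * (norm m)\<^sup>2\<close>. The factor 2 is the reason for the exponent
    \<open>c / 2\<close> in \<open>?F\<close>; \<open>K\<close> collects what is independent of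
    \<open>m\<close>.\<close>
  define K where "K = exp (- c * d\<^sup>2) * cube_volume TYPE('d)"
  have K: "K > 0" using cube_volume_pos[where 'd='d] by (simp add: K_def)
  have k: "integrable ?N ?k" by (rule tiling(1)[OF F])
  have "integrable (count_space int_vecs) (\<lambda>m. \<integral>s. norm (?k (m, s)) \<partial>lborel)"
    by (rule integrable_fst'[OF integrable_norm[OF k]])
  then have sm: "(\<lambda>m. norm (\<integral>s. norm (?k (m, s)) \<partial>lborel)) summable_on int_vecs"
    by (simp only: integrable_count_space_iff)
  have bd: "K * exp (- c * (norm m)\<^sup>2) \<le> norm (\<integral>s. norm (?k (m, s)) \<partial>lborel)" for m :: "real ^ 'd"
  proof -
    let ?g = "\<lambda>s::real^'d. indicator (cube 0) s *\<^sub>R (exp (- c * d\<^sup>2) * exp (- c * (norm m)\<^sup>2))"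
    have ic0: "integrable lborel (indicator (cube (0 :: real ^ 'd)) :: _ \<Rightarrow> real)"
      by (rule integrable_real_indicator[OF _ cube_finite_measure]) simp
    have "K * exp (- c * (norm m)\<^sup>2) = (\<integral>s. ?g s \<partial>lborel)"
      unfolding integral_scaleR_left[OF ic0] by (simp add: K_def cube_volume_def)
    also have "\<dots> \<le> (\<integral>s. norm (?k (m, s)) \<partial>lborel)"
    proof (rule integral_mono)
      show "integrable lborel ?g" by (rule integrable_scaleR_left[OF ic0])
      have "integrable lborel (\<lambda>s. indicator (cube (0 :: real ^ 'd)) s *\<^sub>R ?F (s - m))"
        by (rule integrable_cube[where B=1]) (use c in auto)
      from integrable_norm[OF this] show "integrable lborel (\<lambda>s. norm (?k (m, s)))" by simp
      fix s show "?g s \<le> norm (?k (m, s))"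
      proof (cases "s \<in> cube 0")
        case True
        have "norm s \<le> d" using cube_norm_le[OF True] by (simp add: d_def)
        then have "norm (s - m) \<le> d + norm m" using norm_triangle_ineq4[of s m] by linarith
        then have "(norm (s - m))\<^sup>2 \<le> (d + norm m)\<^sup>2" by (intro power_mono) auto
        also have "\<dots> \<le> 2 * d\<^sup>2 + 2 * (norm m)\<^sup>2"
          using zero_le_power2[of "d - norm m"] by (simp add: power2_eq_square algebra_simps)
        finally have "(c / 2) * (norm (s - m))\<^sup>2 \<le> (c / 2) * (2 * d\<^sup>2 + 2 * (norm m)\<^sup>2)"
          using c by (intro mult_left_mono) auto
        then have "- c * d\<^sup>2 + - c * (norm m)\<^sup>2 \<le> - (c / 2) * (norm (s - m))\<^sup>2"
          by (simp add: algebra_simps)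
        then have "exp (- c * d\<^sup>2) * exp (- c * (norm m)\<^sup>2) \<le> exp (- (c / 2) * (norm (s - m))\<^sup>2)"
          unfolding exp_add[symmetric] by simp
        then show ?thesis using True by simp
      qed simp
    qed
    finally show ?thesis by simp
  qed
  have "(\<lambda>m::real^'d. K * exp (- c * (norm m)\<^sup>2)) summable_on int_vecs"
    by (rule summable_on_comparison_test[OF sm bd]) (use K in auto)
  then have "(\<lambda>m::real^'d. inverse K * (K * exp (- c * (norm m)\<^sup>2))) summable_on int_vecs"
    by (rule summable_on_cmult_right)
  then show "(\<lambda>m::real^'d. exp (- c * (norm m)\<^sup>2)) summable_on int_vecs"
    using K by (simp add: mult.assoc[symmetric])
qed

section \<open>Lattices as linear images of the integer vectors\<close>

lemma lattice_of_image: "lattice_of A = (*v) A ` int_vecs"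
  by (auto simp: lattice_of_def int_vecs_def)

lemma invertible_bounded_below:
  fixes A :: "real ^ 'd ^ 'd"
  assumes "invertible A"
  obtains b where "b > 0" "\<And>m. b * norm m \<le> norm (A *v m)"
  using linear_inj_bounded_below_pos[OF matrix_vector_mul_linear inj_matrix_vector_mult[OF assms]] by blast

lemma gauss_summable_lattice:
  fixes A :: "real ^ 'd ^ 'd"
  assumes "invertible A"
  shows "gauss_summable (lattice_of A)"
  unfolding gauss_summable_def lattice_of_image
proof (intro allI impI)
  fix c :: real assume c: "c > 0"
  obtain b where b: "b > 0" "\<And>m. b * norm m \<le> norm (A *v m)"
    using invertible_bounded_below[OF assms] by blast
  have inj: "inj_on ((*v) A) int_vecs"
    using inj_matrix_vector_mult[OF assms] by (rule inj_on_subset) simp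
  have s: "(\<lambda>m::real^'d. exp (- (c * b\<^sup>2) * (norm m)\<^sup>2)) summable_on int_vecs"
    using b c by (intro gauss_summable_int_vecs[unfolded gauss_summable_def, rule_format]) simp
  have "(\<lambda>m. exp (- c * (norm (A *v m))\<^sup>2)) summable_on int_vecs"
  proof (rule summable_on_comparison_test[OF s])
    fix m :: "real ^ 'd"
    have "(b * norm m)\<^sup>2 \<le> (norm (A *v m))\<^sup>2" using b by (intro power_mono) auto
    then show "exp (- c * (norm (A *v m))\<^sup>2) \<le> exp (- (c * b\<^sup>2) * (norm m)\<^sup>2)"
      using c by (simp add: power_mult_distrib)
  qed simp
  then show "(\<lambda>z. exp (- c * (norm z)\<^sup>2)) summable_on (*v) A ` int_vecs"
    using summable_on_reindex[OF inj, of "\<lambda>z. exp (- c * (norm z)\<^sup>2)"] by (simp add: o_def)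
qed

lemma matrix_inv_invertible:
  fixes A :: "real ^ 'd ^ 'd"
  assumes "invertible A"
  shows "A *v (matrix_inv A *v x) = x" "matrix_inv A *v (A *v x) = x" "invertible (matrix_inv A)"
    "invertible (transpose (matrix_inv A))"
proof -
  have "\<exists>A'. A ** A' = mat 1 \<and> A' ** A = mat 1" using assms unfolding invertible_def .
  then have inv: "A ** matrix_inv A = mat 1" "matrix_inv A ** A = mat 1"
    unfolding matrix_inv_def by (metis (mono_tags, lifting) someI_ex)+
  show "A *v (matrix_inv A *v x) = x" "matrix_inv A *v (A *v x) = x"
    by (simp_all add: matrix_vector_mul_assoc inv)
  show i: "invertible (matrix_inv A)" using inv unfolding invertible_def by blast
  show "invertible (transpose (matrix_inv A))" by (rule transpose_invertible[OF i])
qed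

lemma inner_transpose: "(transpose B *v l) \<bullet> x = l \<bullet> (B *v x)" for B :: "real ^ 'd ^ 'd"
  by (simp add: dot_lmul_matrix)

section \<open>The Gaussian integral with a complex shift\<close>

definition lattice_gauss_integral :: "real ^ 'd ^ 'd \<Rightarrow> complex" where
  "lattice_gauss_integral A = (\<integral>s. of_real (exp (- pi * (norm (A *v s))\<^sup>2)) \<partial>lborel)"

lemma gaussian_lattice_integrable:
  fixes A :: "real ^ 'd ^ 'd"
  assumes "invertible A"
  shows "integrable lborel (\<lambda>s. exp (- (norm (A *v s))\<^sup>2))"
proof -
  obtain b where b: "b > 0" "\<And>m. b * norm m \<le> norm (A *v m)"
    using invertible_bounded_below[OF assms] by blast
  have "continuous_on UNIV (\<lambda>s. exp (- (norm (A *v s))\<^sup>2))"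
    by (intro continuous_intros linear_continuous_on matrix_vector_mul_bounded_linear)
  then have m: "(\<lambda>s. exp (- (norm (A *v s))\<^sup>2)) \<in> borel_measurable borel"
    by (rule borel_measurable_continuous_onI)
  have "integrable lborel (\<lambda>s::real^'d. exp (- b\<^sup>2 * (norm s)\<^sup>2))"
    using b by (intro integrable_gaussian) simp
  then show ?thesis
  proof (rule Bochner_Integration.integrable_bound)
    show "AE s in lborel. norm (exp (- (norm (A *v s))\<^sup>2)) \<le> norm (exp (- b\<^sup>2 * (norm s)\<^sup>2))"
    proof (rule AE_I2)
      fix s
      have "(b * norm s)\<^sup>2 \<le> (norm (A *v s))\<^sup>2" using b by (intro power_mono) auto
      then show "norm (exp (- (norm (A *v s))\<^sup>2)) \<le> norm (exp (- b\<^sup>2 * (norm s)\<^sup>2))"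
        by (simp add: power_mult_distrib)
    qed
  qed (use m in simp)
qed

text \<open>The integral is entire in \<open>\<eta>\<close> and, by translation invariance, constant for real \<open>\<eta>\<close>.\<close>

lemma gauss_integral_shift:
  fixes A :: "real ^ 'd ^ 'd" and \<eta> :: "complex ^ 'd"
  assumes A: "invertible A"
  shows "(\<integral>s. exp (- of_real pi * cdot (complex_vec (A *v s) - \<eta>) (complex_vec (A *v s) - \<eta>)) \<partial>lborel) =
      lattice_gauss_integral A"
    and "integrable lborel (\<lambda>s. exp (- of_real pi * cdot (complex_vec (A *v s) - \<eta>) (complex_vec (A *v s) - \<eta>)))"
proof -
  define g where "g = (\<lambda>\<eta> s. exp (- of_real pi * cdot (complex_vec (A *v s) - \<eta>) (complex_vec (A *v s) - \<eta>)))"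
  have cv: "continuous_on UNIV (\<lambda>s. complex_vec (A *v s))"
    unfolding complex_vec_def
    by (intro continuous_on_vec_lambda continuous_intros linear_continuous_on matrix_vector_mul_bounded_linear)
  have gm: "g \<eta> \<in> borel_measurable borel" for \<eta>
    unfolding g_def cdot_def
    by (intro borel_measurable_continuous_onI continuous_intros cv)
  have holo: "holo_at (\<lambda>\<eta>. g \<eta> s) \<eta>" for \<eta> s
  proof -
    have "holo_at (\<lambda>\<eta>. (complex_vec (A *v s) - \<eta>) $ i) \<eta>" for i
      unfolding vector_minus_component by (intro holo_intros)
    then show ?thesis unfolding g_def by (intro holo_intros)
  qed
  have dom: "\<exists>C. \<forall>\<eta>\<in>ball \<eta>0 1. \<forall>s. norm (g \<eta> s) \<le> C * exp (- (norm (A *v s))\<^sup>2)" for \<eta>0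
  proof -
    obtain C where C: "\<And>u v (z::real^'d). norm u \<le> norm \<eta>0 + 1 \<Longrightarrow> norm v \<le> norm \<eta>0 + 1 \<Longrightarrow>
       exp (0 * norm (complex_vec z - u)) * norm (gauss_factor u v z) \<le> C * exp (- (norm z)\<^sup>2)"
      using gauss_factor_bound[of "norm \<eta>0 + 1" 0] by (metis add_nonneg_nonneg norm_ge_zero order_refl zero_le_one)
    have "norm (g \<eta> s) \<le> C * exp (- (norm (A *v s))\<^sup>2)" if "\<eta> \<in> ball \<eta>0 1" for \<eta> s
    proof -
      have "norm \<eta> \<le> norm \<eta>0 + 1"
        using that norm_triangle_ineq2[of \<eta> \<eta>0] by (auto simp: dist_norm norm_minus_commute)
      then show ?thesis using C[of \<eta> 0 "A *v s"]
        by (simp add: gauss_factor_def g_def cdot_def)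
    qed
    then show ?thesis by blast
  qed
  have int: "integrable lborel (g \<eta>)" and Jholo: "holo_at (\<lambda>\<eta>. \<integral>s. g \<eta> s \<partial>lborel) \<eta>" for \<eta>
  proof -
    obtain C where C: "\<And>\<eta>' s. \<eta>' \<in> ball \<eta> 1 \<Longrightarrow> norm (g \<eta>' s) \<le> C * exp (- (norm (A *v s))\<^sup>2)"
      using dom by blast
    have i: "integrable lborel (\<lambda>s. C * exp (- (norm (A *v s))\<^sup>2))"
      by (rule integrable_mult_right[OF gaussian_lattice_integrable[OF A]])
    show "integrable lborel (g \<eta>)"
    proof (rule Bochner_Integration.integrable_bound[OF i])
      show "AE s in lborel. norm (g \<eta> s) \<le> norm (C * exp (- (norm (A *v s))\<^sup>2))"
        by (intro AE_I2 order_trans[OF C]) auto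
    qed (use gm in simp)
    show "holo_at (\<lambda>\<eta>. \<integral>s. g \<eta> s \<partial>lborel) \<eta>"
      by (rule holo_at_integral[OF zero_less_one holo _ C i]) (use gm in simp)
  qed
  define J where "J = (\<lambda>\<eta>. \<integral>s. g \<eta> s \<partial>lborel)"
  have J0: "J 0 = lattice_gauss_integral A"
    unfolding J_def g_def lattice_gauss_integral_def
    by (intro Bochner_Integration.integral_cong refl)
      (simp add: cdot_complex_vec power2_norm_eq_inner exp_of_real[symmetric])
  have Jreal: "J (complex_vec a) = J 0" for a
  proof -
    define h where "h = matrix_inv A *v a"
    have "g (complex_vec a) (h + s) = g 0 s" for s
      by (simp add: g_def h_def matrix_vector_right_distrib matrix_inv_invertible[OF A] complex_vec_add)
    then show ?thesis
      using lborel_integral_translate(1)[OF gm, of "complex_vec a" h] by (simp add: J_def)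
  qed
  have "J \<eta> = J 0"
  proof -
    \<comment> \<open>The complex line through the real part of \<eta> in the direction of its
      imaginary part: real parameters give real shifts, and the parameter \<open>\<i>\<close> gives
      \<eta>. The identity theorem carries the constant value from the real axis to
      \<open>\<i>\<close>.\<close>
    define \<phi> where "\<phi> = (\<lambda>w. J (complex_vec (Re_vec \<eta>) + scaleC w (complex_vec (Im_vec \<eta>))))"
    have "\<phi> holomorphic_on UNIV"
    proof (rule holomorphic_onI)
      fix w :: complex
      obtain f' where "has_clinear_derivative J f' (complex_vec (Re_vec \<eta>) + scaleC w (complex_vec (Im_vec \<eta>)))"
        using Jholo unfolding J_def holo_at_def by blast
      from has_field_derivative_line[OF this] show "\<phi> field_differentiable at w within UNIV"
        unfolding \<phi>_def field_differentiable_def by blast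
    qed
    moreover have "\<phi> (of_real x) = J 0" for x
      unfolding \<phi>_def using Jreal[of "Re_vec \<eta> + x *\<^sub>R Im_vec \<eta>"]
      by (simp add: complex_vec_add complex_vec_scaleR)
    ultimately have "\<phi> \<i> = J 0"
    proof -
      assume h: "\<phi> holomorphic_on UNIV" and r: "\<And>x. \<phi> (of_real x) = J 0"
      have "\<phi> \<i> - J 0 = 0"
      proof (rule analytic_continuation[where f="\<lambda>w. \<phi> w - J 0" and S=UNIV and U="\<real>" and \<xi>=0 and w="\<i>"])
        show "(\<lambda>w. \<phi> w - J 0) holomorphic_on UNIV" by (intro holomorphic_intros h)
        show "(0::complex) islimpt \<real>"
          unfolding islimpt_approachable
        proof (intro allI impI)
          fix e :: real assume "e > 0"
          then show "\<exists>x'\<in>\<real>. x' \<noteq> (0::complex) \<and> dist x' 0 < e"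
            by (intro bexI[of _ "of_real (e / 2)"]) auto
        qed
        show "\<And>z. z \<in> \<real> \<Longrightarrow> \<phi> z - J 0 = 0" using r by (auto elim!: Reals_cases)
      qed auto
      then show ?thesis by simp
    qed
    moreover have "complex_vec (Re_vec \<eta>) + scaleC \<i> (complex_vec (Im_vec \<eta>)) = \<eta>"
      by (simp add: vec_eq_iff complex_vec_def Re_vec_def Im_vec_def scaleC_vec_def scaleC_complex_def
          complex_eq[symmetric] mult.commute)
    ultimately show ?thesis by (simp add: \<phi>_def)
  qed
  then show "(\<integral>s. exp (- of_real pi * cdot (complex_vec (A *v s) - \<eta>) (complex_vec (A *v s) - \<eta>)) \<partial>lborel) =
      lattice_gauss_integral A" using J0 by (simp add: J_def g_def)
  show "integrable lborel (\<lambda>s. exp (- of_real pi * cdot (complex_vec (A *v s) - \<eta>) (complex_vec (A *v s) - \<eta>)))"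
    using int by (simp add: g_def)
qed

section \<open>The Poisson formula without weights\<close>

lemma continuous_on_infsum:
  fixes f :: "'i \<Rightarrow> 'a::topological_space \<Rightarrow> complex"
  assumes "\<And>m. m \<in> I \<Longrightarrow> continuous_on S (f m)"
    and "\<And>m s. m \<in> I \<Longrightarrow> s \<in> S \<Longrightarrow> norm (f m s) \<le> M m" and "M summable_on I"
  shows "continuous_on S (\<lambda>s. \<Sum>\<^sub>\<infinity>m\<in>I. f m s)"
proof (rule uniform_limit_theorem)
  show "uniform_limit S (\<lambda>X s. \<Sum>m\<in>X. f m s) (\<lambda>s. \<Sum>\<^sub>\<infinity>m\<in>I. f m s) (finite_subsets_at_top I)"
    by (rule Weierstrass_m_test_general[OF assms(2,3)])
  show "\<forall>\<^sub>F X in finite_subsets_at_top I. continuous_on S (\<lambda>s. \<Sum>m\<in>X. f m s)"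
    using assms(1) by (intro eventually_finite_subsets_at_top_weakI continuous_on_sum) auto
qed (rule finite_subsets_at_top_neq_bot)

lemma integrable_cube_continuous:
  fixes q :: "real ^ 'd \<Rightarrow> complex"
  assumes q: "continuous_on UNIV q"
  shows "integrable lborel (\<lambda>s. indicator (cube c) s *\<^sub>R q s)"
proof -
  have "compact (q ` cball 0 (norm c + real CARD('d)))"
    by (intro compact_continuous_image continuous_on_subset[OF q]) auto
  then obtain Bq where Bq: "\<And>s. s \<in> cube c \<Longrightarrow> norm (q s) \<le> Bq"
    using cube_norm_le by (fastforce dest!: compact_imp_bounded simp: bounded_iff)
  show ?thesis by (rule integrable_cube[OF borel_measurable_continuous_onI[OF q] Bq])
qed

lemma summable_exp_lattice:
  fixes A :: "real ^ 'd ^ 'd"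
  assumes A: "invertible A"
  shows "(\<lambda>m. exp (- (norm (A *v m))\<^sup>2)) summable_on int_vecs"
proof -
  have inj: "inj_on ((*v) A) int_vecs"
    using inj_matrix_vector_mult[OF A] by (rule inj_on_subset) simp
  have "(\<lambda>z. exp (- 1 * (norm z)\<^sup>2)) summable_on (*v) A ` int_vecs"
    using gauss_summable_lattice[OF A] unfolding gauss_summable_def lattice_of_image by (meson zero_less_one)
  then show ?thesis
    using summable_on_reindex[OF inj, of "\<lambda>z. exp (- 1 * (norm z)\<^sup>2)"] by (simp add: o_def)
qed

lemma continuous_on_complex_vec [continuous_intros]:
  "continuous_on S f \<Longrightarrow> continuous_on S (\<lambda>s. complex_vec (f s))"
  unfolding complex_vec_def by (intro continuous_on_vec_lambda continuous_intros)

lemma continuous_on_cdot [continuous_intros]: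
  "continuous_on S f \<Longrightarrow> continuous_on S g \<Longrightarrow> continuous_on S (\<lambda>s. cdot (f s) (g s))"
  unfolding cdot_def by (intro continuous_intros)

lemma gauss_factor_shift:
  "gauss_factor 0 v (z - x) =
     gauss_factor (complex_vec x) v z * exp (2 * of_real pi * \<i> * cdot v (complex_vec x))"
  unfolding gauss_factor_def
  by (simp add: complex_vec_diff cdot_diff_right algebra_simps flip: exp_add)

lemma gauss_factor_zero_left_bound:
  fixes v :: "complex ^ 'd"
  obtains C where "C > 0"
    "\<And>z. norm (exp (- of_real pi * cdot (v + complex_vec z) (v + complex_vec z))) \<le> C * exp (- (norm z)\<^sup>2)"
proof -
  obtain C where C: "C > 0" "\<And>u w (z::real^'d). norm u \<le> norm v \<Longrightarrow> norm w \<le> norm v \<Longrightarrow>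
      exp (0 * norm (complex_vec z - u)) * norm (gauss_factor u w z) \<le> C * exp (- (norm z)\<^sup>2)"
    using gauss_factor_bound[of "norm v" 0] by (metis norm_ge_zero order_refl)
  show ?thesis
  proof (rule that[OF C(1)])
    fix z show "norm (exp (- of_real pi * cdot (v + complex_vec z) (v + complex_vec z))) \<le> C * exp (- (norm z)\<^sup>2)"
      using C(2)[of "- v" 0 z] by (simp add: gauss_factor_def cdot_def add.commute)
  qed
qed

text \<open>This is \<open>1 / |det A|\<close>, the inverse covolume of the lattice, in the form in
  which the Fourier coefficients produce it.\<close>

definition poisson_const :: "real ^ 'd ^ 'd \<Rightarrow> complex" where
  "poisson_const A = lattice_gauss_integral A / of_real (cube_volume TYPE('d))"

text \<open>The dual series \<open>G\<close> converges absolutely to a continuous function, and a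
  multiple of it has the same Fourier coefficients as the periodised Gaussian \<phi>. Uniqueness for
  continuous functions then gives equality at a point. The frequency \<open>v\<close> is complex, so
  that the identity can be differentiated in it.\<close>

lemma poisson_gauss:
  fixes A :: "real ^ 'd ^ 'd" and v :: "complex ^ 'd" and x :: "real ^ 'd"
  assumes A: "invertible A"
  shows "(\<Sum>\<^sub>\<infinity>z\<in>lattice_of A. gauss_factor (complex_vec x) v z) =
    poisson_const A * (\<Sum>\<^sub>\<infinity>k\<in>reciprocal_lattice_of A.
      exp (- 2 * of_real pi * \<i> * cdot (v - complex_vec k) (complex_vec x)) *
      exp (- of_real pi * cdot (v - complex_vec k) (v - complex_vec k)))"
proof -
  define B where "B = transpose (matrix_inv A)"
  have B: "invertible B" unfolding B_def by (rule matrix_inv_invertible[OF A])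
  have Binner: "(B *v l) \<bullet> (A *v s) = l \<bullet> s" for l s
    unfolding B_def inner_transpose matrix_inv_invertible(2)[OF A] ..
  \<comment> \<open>In coordinates pulled back by \<open>A\<close> the lattice is
    \<open>int_vecs\<close> and \<open>x\<close> becomes \<open>s0\<close>, the centre of the cube
    on which Fourier coefficients are taken.\<close>
  define s0 where "s0 = matrix_inv A *v x"
  have As0: "A *v s0 = x" by (simp add: s0_def matrix_inv_invertible[OF A])
  define V where "V = complex_of_real (cube_volume TYPE('d))"
  have V0: "V \<noteq> 0" using cube_volume_pos[where 'd='d] by (simp add: V_def)
  define f where "f = gauss_factor (0 :: complex ^ 'd) v"
  define C where "C = poisson_const A"
  define c where "c = (\<lambda>l. exp (- of_real pi * cdot (v + complex_vec (B *v l)) (v + complex_vec (B *v l))))"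
  define \<phi> where "\<phi> = (\<lambda>s. \<Sum>\<^sub>\<infinity>m\<in>int_vecs. f (A *v m - A *v s))"
  define G where "G = (\<lambda>s. \<Sum>\<^sub>\<infinity>l\<in>int_vecs. c l * chr (- l) s)"
  have fcont: "continuous_on S (\<lambda>s. f (h s))" if "continuous_on S h" for S :: "(real ^ 'd) set" and h
    unfolding f_def gauss_factor_def by (intro continuous_intros that)
  have fbound: "\<exists>K>0. \<forall>s m. norm s \<le> R \<longrightarrow> norm (f (A *v m - A *v s)) \<le> K * exp (- (norm (A *v m))\<^sup>2)" for R
  proof -
    obtain b where b: "b > 0" "\<And>s. norm (A *v s) \<le> norm s * b"
      using bounded_linear.pos_bounded[OF matrix_vector_mul_bounded_linear[of A]] by blast
    define R' where "R' = norm v + \<bar>R\<bar> * b"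
    have R': "R' \<ge> 0" "norm v \<le> R'" using b by (auto simp: R'_def)
    obtain K where K: "K > 0" "\<And>u w (z::real^'d). norm u \<le> R' \<Longrightarrow> norm w \<le> R' \<Longrightarrow>
        exp (0 * norm (complex_vec z - u)) * norm (gauss_factor u w z) \<le> K * exp (- (norm z)\<^sup>2)"
      using gauss_factor_bound[OF R'(1), of 0] by (metis order_refl)
    define E where "E = exp (2 * pi * (norm v * R'))"
    have "norm (f (A *v m - A *v s)) \<le> (K * E) * exp (- (norm (A *v m))\<^sup>2)" if s: "norm s \<le> R" for s m
    proof -
      have As: "norm (A *v s) \<le> R'"
      proof -
        have "norm (A *v s) \<le> norm s * b" by (rule b)
        also have "\<dots> \<le> \<bar>R\<bar> * b" using s b by (intro mult_right_mono) auto
        finally show ?thesis by (simp add: R'_def add_increasing)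
      qed
      have "norm (exp (2 * of_real pi * \<i> * cdot v (complex_vec (A *v s)))) \<le> E"
      proof -
        have "Re (2 * of_real pi * \<i> * cdot v (complex_vec (A *v s))) \<le>
            norm (2 * of_real pi * \<i> * cdot v (complex_vec (A *v s)))" by (rule complex_Re_le_cmod)
        also have "\<dots> = 2 * pi * norm (cdot v (complex_vec (A *v s)))" by (simp add: norm_mult)
        also have "\<dots> \<le> 2 * pi * (norm v * R')"
          using norm_cdot_le[of v "complex_vec (A *v s)"] mult_left_mono[OF As, of "norm v"]
          by (intro mult_left_mono) auto
        finally show ?thesis unfolding norm_exp_eq_Re E_def exp_le_cancel_iff .
      qed
      moreover have "norm (gauss_factor (complex_vec (A *v s)) v (A *v m)) \<le> K * exp (- (norm (A *v m))\<^sup>2)"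
        using K(2)[of "complex_vec (A *v s)" v "A *v m"] As R' by simp
      ultimately have "norm (gauss_factor (complex_vec (A *v s)) v (A *v m)) *
          norm (exp (2 * of_real pi * \<i> * cdot v (complex_vec (A *v s)))) \<le>
          (K * exp (- (norm (A *v m))\<^sup>2)) * E"
        using K(1) by (intro mult_mono) auto
      then show ?thesis unfolding f_def gauss_factor_shift norm_mult by (simp add: mult_ac)
    qed
    then show ?thesis using K(1) by (intro exI[of _ "K * E"]) (auto simp: E_def)
  qed
  have fsum: "(\<lambda>m. norm (f (A *v m - A *v s))) summable_on int_vecs" for s
  proof -
    obtain K where K: "K > 0" "\<And>m. norm (f (A *v m - A *v s)) \<le> K * exp (- (norm (A *v m))\<^sup>2)"
      using fbound[of "norm s"] by blast
    have "(\<lambda>m. K * exp (- (norm (A *v m))\<^sup>2)) summable_on int_vecs"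
      by (rule summable_on_cmult_right[OF summable_exp_lattice[OF A]])
    then show ?thesis by (rule summable_on_comparison_test) (use K in auto)
  qed
  obtain K where K: "K > 0"
    "\<And>z. norm (exp (- of_real pi * cdot (v + complex_vec z) (v + complex_vec z))) \<le> K * exp (- (norm z)\<^sup>2)"
    using gauss_factor_zero_left_bound[of v] by blast
  have csum: "(\<lambda>l. norm (c l)) summable_on int_vecs"
  proof -
    have "(\<lambda>m. K * exp (- (norm (B *v m))\<^sup>2)) summable_on int_vecs"
      by (rule summable_on_cmult_right[OF summable_exp_lattice[OF B]])
    then show ?thesis by (rule summable_on_comparison_test) (use K in \<open>auto simp: c_def\<close>)
  qed
  have Gcont: "continuous_on UNIV G" unfolding G_def
    by (rule continuous_on_infsum[OF _ _ csum]) (auto intro!: continuous_intros simp: norm_mult chr_simps)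
  have \<phi>cont: "continuous_on UNIV \<phi>"
  proof -
    have "continuous_on (ball 0 R) \<phi>" for R
    proof -
      obtain K where K: "\<And>s m. norm s \<le> R \<Longrightarrow> norm (f (A *v m - A *v s)) \<le> K * exp (- (norm (A *v m))\<^sup>2)"
        using fbound[of R] by blast
      have "(\<lambda>m. K * exp (- (norm (A *v m))\<^sup>2)) summable_on int_vecs"
        by (rule summable_on_cmult_right[OF summable_exp_lattice[OF A]])
      then show ?thesis unfolding \<phi>_def
        by (intro continuous_on_infsum[OF _ K]) (auto intro!: fcont continuous_intros)
    qed
    then have "isCont \<phi> s" for s
      by (rule continuous_on_interior[of "ball 0 (norm s + 1)"]) auto
    then show ?thesis by (simp add: continuous_on_eq_continuous_at)
  qed
  define D where "D = (\<lambda>s. \<phi> s - C * G s)"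
  have "D s0 = 0"
  proof (rule fourier_coefficients_unique)
    show "continuous_on UNIV D" unfolding D_def by (intro continuous_intros \<phi>cont Gcont)
    fix l :: "real ^ 'd" assume l: "l \<in> int_vecs"
    have \<phi>l: "(\<integral>s. indicator (cube s0) s *\<^sub>R (\<phi> s * chr l s) \<partial>lborel) = c l * lattice_gauss_integral A"
    proof -
      \<comment> \<open>Completing the square: the Gaussian, the factor with \<open>v\<close> and
        \<open>chr l\<close> merge into a Gaussian with the imaginary shift
        \<open>scaleC \<i> \<zeta>\<close>, times the constant \<open>c l\<close>. This is where
        complex shifts of the Gaussian integral come in.\<close>
      define \<zeta> where "\<zeta> = v + complex_vec (B *v l)"
      define F where "F = (\<lambda>s. f (- (A *v s)) * chr l s)"
      have F_eq: "F s = c l * exp (- of_real pi * cdot (complex_vec (A *v s) - scaleC \<i> \<zeta>) (complex_vec (A *v s) - scaleC \<i> \<zeta>))" for s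
      proof -
        have chr_eq: "chr l s = exp (2 * of_real pi * \<i> * cdot (complex_vec (B *v l)) (complex_vec (A *v s)))"
          by (simp add: chr_def cdot_complex_vec Binner cis_conv_exp mult_ac)
        have "F s = exp (- 2 * of_real pi * \<i> * cdot v (complex_vec (- (A *v s))) +
            - of_real pi * cdot (complex_vec (- (A *v s))) (complex_vec (- (A *v s))) +
            2 * of_real pi * \<i> * cdot (complex_vec (B *v l)) (complex_vec (A *v s)))"
          unfolding F_def f_def gauss_factor_def chr_eq exp_add diff_zero ..
        also have "\<dots> = exp (- of_real pi * cdot \<zeta> \<zeta> + - of_real pi *
            cdot (complex_vec (A *v s) - scaleC \<i> \<zeta>) (complex_vec (A *v s) - scaleC \<i> \<zeta>))"
        proof (rule arg_cong[where f=exp])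
          define a where "a = complex_vec (A *v s)"
          have sq: "cdot (a - scaleC \<i> \<zeta>) (a - scaleC \<i> \<zeta>) = cdot a a - 2 * \<i> * cdot \<zeta> a - cdot \<zeta> \<zeta>"
            by (simp add: cdot_diff_left cdot_diff_right cdot_scaleC_left cdot_scaleC_right
                cdot_commute[of a \<zeta>] right_diff_distrib)
          have za: "cdot \<zeta> a = cdot v a + cdot (complex_vec (B *v l)) a"
            by (simp add: \<zeta>_def cdot_add_left)
          show "- 2 * of_real pi * \<i> * cdot v (complex_vec (- (A *v s))) +
              - of_real pi * cdot (complex_vec (- (A *v s))) (complex_vec (- (A *v s))) +
              2 * of_real pi * \<i> * cdot (complex_vec (B *v l)) (complex_vec (A *v s)) =
              - of_real pi * cdot \<zeta> \<zeta> + - of_real pi *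
              cdot (complex_vec (A *v s) - scaleC \<i> \<zeta>) (complex_vec (A *v s) - scaleC \<i> \<zeta>)"
            unfolding complex_vec_minus cdot_minus_left cdot_minus_right a_def[symmetric] sq za
            by (simp add: ring_distribs)
        qed
        finally show ?thesis by (simp only: exp_add c_def \<zeta>_def)
      qed
      have Fint: "integrable lborel F"
        unfolding F_eq[abs_def] by (rule integrable_mult_right[OF gauss_integral_shift(2)[OF A]])
      have IF: "(\<integral>s. F s \<partial>lborel) = c l * lattice_gauss_integral A"
        unfolding F_eq[abs_def] integral_mult_right_zero gauss_integral_shift(1)[OF A] ..
      have "(\<integral>m. F (s - m) \<partial>count_space int_vecs) = \<phi> s * chr l s" for s
      proof -
        have Fm: "F (s - m) = f (A *v m - A *v s) * chr l s" if "m \<in> int_vecs" for m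
          using chr_int[OF l that] by (simp add: F_def matrix_vector_mult_diff_distrib)
        have "(\<integral>m. F (s - m) \<partial>count_space int_vecs) = (\<integral>m. f (A *v m - A *v s) * chr l s \<partial>count_space int_vecs)"
          by (rule Bochner_Integration.integral_cong) (auto simp: Fm)
        also have "\<dots> = (\<Sum>\<^sub>\<infinity>m\<in>int_vecs. f (A *v m - A *v s) * chr l s)"
          by (rule integral_count_space_eq_infsum) (simp add: norm_mult chr_simps fsum)
        also have "\<dots> = \<phi> s * chr l s" unfolding \<phi>_def by (rule infsum_cmult_left')
        finally show ?thesis .
      qed
      then show ?thesis using tiling(2)[OF Fint, of s0] IF by simp
    qed
    have Gl: "(\<integral>s. indicator (cube s0) s *\<^sub>R (G s * chr l s) \<partial>lborel) = c l * V"
    proof -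
      \<comment> \<open>Multiplying by \<open>chr l\<close> shifts all frequencies of the dual
        series, and orthogonality keeps the term with \<open>l' = l\<close>. The quotient in
        \<open>poisson_const\<close> is chosen to match this coefficient with that of
        \<phi>.\<close>
      let ?g = "\<lambda>l' s. indicator (cube s0) s *\<^sub>R (c l' * chr (l - l') s)"
      have chr_l: "chr (- l') s * chr l s = chr (l - l') s" for l' s
        using chr_simps(2)[of "- l'" l s] by simp
      have "(\<integral>s. indicator (cube s0) s *\<^sub>R (G s * chr l s) \<partial>lborel) = (\<integral>s. (\<Sum>\<^sub>\<infinity>l'\<in>int_vecs. ?g l' s) \<partial>lborel)"
      proof (rule Bochner_Integration.integral_cong[OF refl])
        fix s
        have "G s * chr l s = (\<Sum>\<^sub>\<infinity>l'\<in>int_vecs. c l' * chr (l - l') s)"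
          unfolding G_def infsum_cmult_left'[symmetric] by (simp only: mult.assoc chr_l)
        then show "indicator (cube s0) s *\<^sub>R (G s * chr l s) = (\<Sum>\<^sub>\<infinity>l'\<in>int_vecs. ?g l' s)"
          by (cases "s \<in> cube s0") auto
      qed
      also have "\<dots> = (\<Sum>\<^sub>\<infinity>l'\<in>int_vecs. \<integral>s. ?g l' s \<partial>lborel)"
      proof (rule integral_infsum_dominated[OF countable_int_vecs sigma_finite_lborel])
        show "?g l' \<in> borel_measurable lborel" for l' by simp
        show "norm (?g l' s) \<le> norm (c l') * indicator (cube s0) s" for l' s
          by (simp add: norm_mult chr_simps)
        show "(\<lambda>l'. norm (norm (c l'))) summable_on int_vecs" using csum by simp
        show "integrable lborel (indicator (cube s0) :: _ \<Rightarrow> real)"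
          by (rule integrable_real_indicator[OF _ cube_finite_measure]) simp
      qed
      also have "\<dots> = (\<Sum>\<^sub>\<infinity>l'\<in>int_vecs. if l' = l then c l * V else 0)"
      proof (rule infsum_cong)
        fix l' :: "real ^ 'd" assume l': "l' \<in> int_vecs"
        have "(\<integral>s. ?g l' s \<partial>lborel) = c l' * (\<integral>s. indicator (cube s0) s *\<^sub>R chr (l - l') s \<partial>lborel)"
          unfolding integral_mult_right_zero[symmetric] by simp
        also have "\<dots> = (if l' = l then c l * V else 0)"
          using chr_orthogonal[of "l - l'" s0] int_vecs_arith(3)[OF l l']
          by (auto simp: chr_simps(4) measure_cube V_def scaleR_conv_of_real)
        finally show "(\<integral>s. ?g l' s \<partial>lborel) = (if l' = l then c l * V else 0)" .
      qed
      also have "\<dots> = (\<Sum>\<^sub>\<infinity>l'\<in>{l}. c l * V)"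
        by (rule infsum_cong_neutral) (use l in auto)
      finally show ?thesis by simp
    qed
    have "(\<integral>s. indicator (cube s0) s *\<^sub>R (D s * chr l s) \<partial>lborel) =
        (\<integral>s. indicator (cube s0) s *\<^sub>R (\<phi> s * chr l s) - C * (indicator (cube s0) s *\<^sub>R (G s * chr l s)) \<partial>lborel)"
      by (rule Bochner_Integration.integral_cong) (simp_all add: D_def algebra_simps)
    also have "\<dots> = (\<integral>s. indicator (cube s0) s *\<^sub>R (\<phi> s * chr l s) \<partial>lborel) -
        C * (\<integral>s. indicator (cube s0) s *\<^sub>R (G s * chr l s) \<partial>lborel)"
      unfolding integral_mult_right_zero[symmetric]
      by (intro Bochner_Integration.integral_diff integrable_mult_right integrable_cube_continuous
          continuous_intros \<phi>cont Gcont)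
    also have "\<dots> = 0" using V0 by (simp add: \<phi>l Gl C_def poisson_const_def V_def)
    finally show "(\<integral>s. indicator (cube s0) s *\<^sub>R (D s * chr l s) \<partial>lborel) = 0" .
  qed
  then have eq: "\<phi> s0 = C * G s0" by (simp add: D_def)
  let ?e = "exp (2 * of_real pi * \<i> * cdot v (complex_vec x))"
  have injA: "inj_on ((*v) A) int_vecs"
    using inj_matrix_vector_mult[OF A] by (rule inj_on_subset) simp
  have L: "\<phi> s0 = (\<Sum>\<^sub>\<infinity>z\<in>lattice_of A. gauss_factor (complex_vec x) v z) * ?e"
    unfolding \<phi>_def As0 f_def gauss_factor_shift infsum_cmult_left' lattice_of_image
    by (simp add: infsum_reindex[OF injA] o_def)
  \<comment> \<open>The Fourier index \<open>l\<close> stands for the dual vector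
    \<open>- (B *v l)\<close>; the symmetry of \<open>int_vecs\<close> removes the sign from the
    range of summation.\<close>
  have injB: "inj_on (\<lambda>l. - (B *v l)) int_vecs"
    using inj_matrix_vector_mult[OF B] by (auto simp: inj_on_def)
  have imB: "(\<lambda>l. - (B *v l)) ` int_vecs = reciprocal_lattice_of A"
  proof -
    have neg: "B *v (- l) = - (B *v l)" for l
      using matrix_vector_mult_diff_distrib[of B 0 l] by simp
    have "(\<lambda>l. - (B *v l)) ` int_vecs = (*v) B ` uminus ` int_vecs"
      by (simp only: image_image neg)
    also have "uminus ` int_vecs = (int_vecs :: (real ^ 'd) set)"
    proof (intro equalityI subsetI)
      fix m :: "real ^ 'd" assume "m \<in> int_vecs"
      then show "m \<in> uminus ` int_vecs"
        using int_vecs_arith(4)[of m] by (intro image_eqI[of _ _ "- m"]) auto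
    qed (use int_vecs_arith(4) in auto)
    finally show ?thesis by (simp add: reciprocal_lattice_of_def lattice_of_image B_def)
  qed
  have R: "G s0 = (\<Sum>\<^sub>\<infinity>k\<in>reciprocal_lattice_of A.
      exp (- 2 * of_real pi * \<i> * cdot (v - complex_vec k) (complex_vec x)) *
      exp (- of_real pi * cdot (v - complex_vec k) (v - complex_vec k))) * ?e"
  proof -
    have "c l * chr (- l) s0 = exp (- 2 * of_real pi * \<i> * cdot (v - complex_vec (- (B *v l))) (complex_vec x)) *
      exp (- of_real pi * cdot (v - complex_vec (- (B *v l))) (v - complex_vec (- (B *v l)))) * ?e" for l
    proof -
      have "chr (- l) s0 = exp (- 2 * of_real pi * \<i> * cdot (complex_vec (B *v l)) (complex_vec x))"
        using Binner[of l s0] by (simp add: chr_def cdot_complex_vec As0 cis_conv_exp mult_ac)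
      also have "\<dots> = exp (- 2 * of_real pi * \<i> * cdot (v + complex_vec (B *v l)) (complex_vec x)) * ?e"
        unfolding exp_add[symmetric] by (rule arg_cong[where f=exp]) (simp add: cdot_add_left ring_distribs)
      finally have chr0: "chr (- l) s0 = exp (- 2 * of_real pi * \<i> * cdot (v + complex_vec (B *v l)) (complex_vec x)) * ?e" .
      show ?thesis unfolding chr0 c_def complex_vec_minus diff_minus_eq_add by (simp only: mult_ac)
    qed
    then show ?thesis
      unfolding G_def imB[symmetric] infsum_reindex[OF injB] o_def infsum_cmult_left'[symmetric] by (simp only:)
  qed
  show ?thesis using eq unfolding L R by (simp add: C_def)
qed

section \<open>Poisson summation with monomial weights\<close>

text \<open>Up to the Gaussian, \<open>hermite_ft n\<close> is the Fourier transform of \<open>w\<^sup>n exp (- \<pi> w\<^sup>2)\<close>.\<close>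

fun hermite_ft :: "nat \<Rightarrow> complex \<Rightarrow> complex" where
  "hermite_ft 0 \<xi> = 1"
| "hermite_ft (Suc 0) \<xi> = - \<i> * \<xi>"
| "hermite_ft (Suc (Suc n)) \<xi> =
     (of_nat (Suc n) * hermite_ft n \<xi> - 2 * of_real pi * \<i> * \<xi> * hermite_ft (Suc n) \<xi>) / (2 * of_real pi)"

text \<open>One recursion for all \<open>n\<close>: at \<open>n = 0\<close> the truncated index
  \<open>n - 1\<close> is harmless because its coefficient is 0.\<close>

lemma hermite_ft_Suc:
  "2 * of_real pi * hermite_ft (Suc n) \<xi> =
     of_nat n * hermite_ft (n - 1) \<xi> - 2 * of_real pi * \<i> * \<xi> * hermite_ft n \<xi>"
  by (cases n) (simp_all del: of_nat_Suc)

text \<open>The Appell property of Hermite polynomials, by differentiating the recursion and using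
  the recursion one step lower to eliminate the index \<open>n - 1\<close>. Together with
  \<open>hermite_ft_Suc\<close> it makes differentiation of polynomial times Gaussian raise the
  index.\<close>

lemma hermite_ft_deriv:
  "(hermite_ft n has_field_derivative (- \<i> * of_nat n * hermite_ft (n - 1) \<xi>)) (at \<xi>)"
proof (induction n arbitrary: \<xi> rule: induct_nat_012)
  case 0
  have "hermite_ft 0 = (\<lambda>_. 1)" by auto
  then show ?case by simp
next
  case 1
  have "hermite_ft (Suc 0) = (\<lambda>\<xi>. - \<i> * \<xi>)" by auto
  then show ?case by (auto intro!: derivative_eq_intros)
next
  case (ge2 n)
  have eq: "hermite_ft (Suc (Suc n)) = (\<lambda>\<xi>. (of_nat (Suc n) * hermite_ft n \<xi> -
      2 * of_real pi * \<i> * \<xi> * hermite_ft (Suc n) \<xi>) / (2 * of_real pi))" by auto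
  have d: "(hermite_ft (Suc (Suc n)) has_field_derivative
      (of_nat (Suc n) * (- \<i> * of_nat n * hermite_ft (n - 1) \<xi>) -
        (2 * of_real pi * \<i> * hermite_ft (Suc n) \<xi> +
         2 * of_real pi * \<i> * \<xi> * (- \<i> * of_nat (Suc n) * hermite_ft (Suc n - 1) \<xi>))) / (2 * of_real pi)) (at \<xi>)"
    unfolding eq
    by (rule DERIV_cdivide) (auto intro!: derivative_eq_intros ge2 simp: algebra_simps simp del: of_nat_Suc)
  have "2 * of_real pi * hermite_ft (Suc n) \<xi> =
      of_nat n * hermite_ft (n - 1) \<xi> - 2 * of_real pi * \<i> * \<xi> * hermite_ft n \<xi>"
    by (rule hermite_ft_Suc)
  then have "of_nat n * hermite_ft (n - 1) \<xi> =
      2 * of_real pi * hermite_ft (Suc n) \<xi> + 2 * of_real pi * \<i> * \<xi> * hermite_ft n \<xi>"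
    by (simp add: algebra_simps)
  then have "of_nat (Suc n) * (- \<i> * of_nat n * hermite_ft (n - 1) \<xi>) =
      - \<i> * of_nat (Suc n) * (2 * of_real pi * hermite_ft (Suc n) \<xi> + 2 * of_real pi * \<i> * \<xi> * hermite_ft n \<xi>)"
    by (simp add: mult_ac)
  then have val: "(of_nat (Suc n) * (- \<i> * of_nat n * hermite_ft (n - 1) \<xi>) -
        (2 * of_real pi * \<i> * hermite_ft (Suc n) \<xi> +
         2 * of_real pi * \<i> * \<xi> * (- \<i> * of_nat (Suc n) * hermite_ft (Suc n - 1) \<xi>))) / (2 * of_real pi) =
      - \<i> * of_nat (Suc (Suc n)) * hermite_ft (Suc (Suc n) - 1) \<xi>"
    by (simp add: field_simps)
  show ?case using d unfolding val .
qed

text \<open>At 0 the recursion links \<open>n + 2\<close> to \<open>n\<close> by the nonzero factor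
  \<open>(n + 1) / (2 * pi)\<close>, starting from 1 at \<open>n = 0\<close> and 0 at
  \<open>n = 1\<close>. This parity is the origin of the case distinction by
  \<open>even_indicator\<close>.\<close>

lemma hermite_ft_0_odd: "odd n \<Longrightarrow> hermite_ft n 0 = 0"
  by (induction n rule: induct_nat_012) auto

lemma hermite_ft_0_even: "even n \<Longrightarrow> hermite_ft n 0 \<noteq> 0"
proof (induction n rule: induct_nat_012)
  case (ge2 n)
  then have "hermite_ft n 0 \<noteq> 0" by simp
  moreover have "complex_of_nat (Suc n) \<noteq> 0" by (simp only: of_nat_eq_0_iff)
  ultimately show ?case by (simp del: of_nat_Suc)
qed auto

lemma hermite_ft_bound: "\<exists>B\<ge>1. \<forall>\<xi>. norm (hermite_ft n \<xi>) \<le> B * (1 + norm \<xi>) ^ n"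
proof (induction n rule: induct_nat_012)
  case 0
  then show ?case by (intro exI[of _ 1]) auto
next
  case 1
  then show ?case by (intro exI[of _ 1]) (auto simp: norm_mult)
next
  case (ge2 n)
  obtain B1 where B1: "B1 \<ge> 1" "\<And>\<xi>. norm (hermite_ft n \<xi>) \<le> B1 * (1 + norm \<xi>) ^ n" using ge2 by blast
  obtain B2 where B2: "B2 \<ge> 1" "\<And>\<xi>. norm (hermite_ft (Suc n) \<xi>) \<le> B2 * (1 + norm \<xi>) ^ Suc n" using ge2 by blast
  have "norm (hermite_ft (Suc (Suc n)) \<xi>) \<le> (real (Suc n) * B1 + B2) * (1 + norm \<xi>) ^ Suc (Suc n)" for \<xi>
  proof -
    have pi1: "1 \<le> 2 * pi" using pi_ge_two by simp
    have "hermite_ft (Suc (Suc n)) \<xi> = of_nat (Suc n) * hermite_ft n \<xi> / (2 * of_real pi) - \<i> * \<xi> * hermite_ft (Suc n) \<xi>"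
      by (simp add: field_simps)
    then have "norm (hermite_ft (Suc (Suc n)) \<xi>) \<le>
        norm (of_nat (Suc n) * hermite_ft n \<xi> / (2 * of_real pi)) + norm (\<i> * \<xi> * hermite_ft (Suc n) \<xi>)"
      using norm_triangle_ineq4 by simp
    also have "norm (of_nat (Suc n) * hermite_ft n \<xi> / (2 * of_real pi)) = real (Suc n) * norm (hermite_ft n \<xi>) / (2 * pi)"
      by (simp add: norm_mult norm_divide del: of_nat_Suc)
    also have "\<dots> \<le> real (Suc n) * norm (hermite_ft n \<xi>) / 1"
      using pi1 by (intro divide_left_mono) auto
    also have "\<dots> \<le> real (Suc n) * (B1 * (1 + norm \<xi>) ^ Suc (Suc n))"
    proof -
      have "norm (hermite_ft n \<xi>) \<le> B1 * (1 + norm \<xi>) ^ n" by (rule B1)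
      also have "\<dots> \<le> B1 * (1 + norm \<xi>) ^ Suc (Suc n)"
        using B1(1) by (intro mult_left_mono power_increasing) auto
      finally show ?thesis by (simp del: of_nat_Suc add: mult_left_mono)
    qed
    also have "norm (\<i> * \<xi> * hermite_ft (Suc n) \<xi>) \<le> (1 + norm \<xi>) * (B2 * (1 + norm \<xi>) ^ Suc n)"
      unfolding norm_mult using B2(2)[of \<xi>] by (intro mult_mono) auto
    finally show ?thesis by (simp add: algebra_simps)
  qed
  moreover have "real (Suc n) * B1 + B2 \<ge> 1" using B1(1) B2(1) by (intro add_increasing) auto
  ultimately show ?case by blast
qed

section \<open>Monomials and Hermite polynomials in several variables\<close>

definition cpow :: "complex ^ 'd \<Rightarrow> nat ^ 'd \<Rightarrow> complex" where
  "cpow w \<alpha> = (\<Prod>j\<in>UNIV. (w $ j) ^ (\<alpha> $ j))"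

definition multi_hermite :: "nat ^ 'd \<Rightarrow> complex ^ 'd \<Rightarrow> complex" where
  "multi_hermite \<alpha> w = (\<Prod>j\<in>UNIV. hermite_ft (\<alpha> $ j) (w $ j))"

lemma cpow_complex_vec: "cpow (complex_vec w) \<alpha> = of_real (multi_power w \<alpha>)"
  by (simp add: cpow_def multi_power_def complex_vec_def)

lemma norm_nth_le_complex: "norm (w $ j) \<le> norm w" for w :: "complex ^ 'd"
  by (rule Finite_Cartesian_Product.norm_nth_le)

lemma cpow_bound: "norm (cpow w \<alpha>) \<le> norm w ^ multi_abs \<alpha>"
proof -
  have "norm (cpow w \<alpha>) \<le> (\<Prod>j\<in>UNIV. norm w ^ (\<alpha> $ j))"
    unfolding cpow_def by (simp only: prod_norm[symmetric] norm_power)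
      (intro prod_mono conjI power_mono norm_nth_le_complex zero_le_power norm_ge_zero)
  then show ?thesis by (simp add: multi_abs_def power_sum)
qed

lemma one_plus_power_le_exp: "(1 + x) ^ n \<le> exp (real n * x)" if "x \<ge> 0" for x :: real
  using power_mono[OF exp_ge_add_one_self[of x], of n] that by (simp add: exp_of_nat_mult)

lemma cpow_exp_bound: "norm (cpow w \<alpha>) \<le> exp (real (multi_abs \<alpha>) * norm w)"
proof -
  have "norm (cpow w \<alpha>) \<le> (1 + norm w) ^ multi_abs \<alpha>"
    by (rule order_trans[OF cpow_bound power_mono]) auto
  also have "\<dots> \<le> exp (real (multi_abs \<alpha>) * norm w)" by (rule one_plus_power_le_exp) simp
  finally show ?thesis .
qed

lemma multi_hermite_bound:
  obtains B where "B \<ge> 1" "\<And>w. norm (multi_hermite \<alpha> w) \<le> B * (1 + norm w) ^ multi_abs \<alpha>"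
proof -
  have "\<forall>j. \<exists>B\<ge>1. \<forall>\<xi>. norm (hermite_ft (\<alpha> $ j) \<xi>) \<le> B * (1 + norm \<xi>) ^ (\<alpha> $ j)"
    using hermite_ft_bound by blast
  then obtain B where B: "\<And>j. B j \<ge> 1" "\<And>j \<xi>. norm (hermite_ft (\<alpha> $ j) \<xi>) \<le> B j * (1 + norm \<xi>) ^ (\<alpha> $ j)"
    by metis
  show ?thesis
  proof (rule that)
    show "(\<Prod>j\<in>UNIV. B j) \<ge> 1" by (rule prod_ge_1) (rule B)
    fix w
    have "norm (multi_hermite \<alpha> w) \<le> (\<Prod>j\<in>UNIV. B j * (1 + norm w) ^ (\<alpha> $ j))"
      unfolding multi_hermite_def prod_norm[symmetric]
    proof (intro prod_mono conjI norm_ge_zero)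
      fix j
      have "norm (hermite_ft (\<alpha> $ j) (w $ j)) \<le> B j * (1 + norm (w $ j)) ^ (\<alpha> $ j)" by (rule B)
      also have "\<dots> \<le> B j * (1 + norm w) ^ (\<alpha> $ j)"
        using B(1)[of j] norm_nth_le_complex[of w j] by (intro mult_left_mono power_mono) auto
      finally show "norm (hermite_ft (\<alpha> $ j) (w $ j)) \<le> B j * (1 + norm w) ^ (\<alpha> $ j)" .
    qed
    then show "norm (multi_hermite \<alpha> w) \<le> (\<Prod>j\<in>UNIV. B j) * (1 + norm w) ^ multi_abs \<alpha>"
      by (simp add: prod.distrib multi_abs_def power_sum)
  qed
qed

lemma multi_hermite_zero:
  "even_indicator \<alpha> = 0 \<Longrightarrow> multi_hermite \<alpha> 0 = 0"
  "even_indicator \<alpha> = 1 \<Longrightarrow> multi_hermite \<alpha> 0 \<noteq> 0"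
  using hermite_ft_0_odd hermite_ft_0_even
  by (auto simp: even_indicator_def multi_hermite_def split: if_splits)

text \<open>The Gaussian is distributed over the coordinates so that a partial derivative acts on a
  single factor.\<close>

definition hermite_gauss :: "nat ^ 'd \<Rightarrow> complex ^ 'd \<Rightarrow> complex" where
  "hermite_gauss \<alpha> y = (\<Prod>j\<in>UNIV. hermite_ft (\<alpha> $ j) (y $ j) * exp (- of_real pi * (y $ j)\<^sup>2))"

lemma hermite_gauss_eq: "hermite_gauss \<alpha> y = multi_hermite \<alpha> y * exp (- of_real pi * cdot y y)"
  by (simp add: hermite_gauss_def multi_hermite_def prod.distrib cdot_def sum_distrib_left
      exp_sum power2_eq_square sum_negf[symmetric])

lemma cpow_add_axis: "cpow w (\<beta> + axis j 1) = w $ j * cpow w \<beta>"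
proof -
  have "cpow w (\<beta> + axis j 1) = w $ j ^ ((\<beta> + axis j 1) $ j) * (\<Prod>i\<in>UNIV - {j}. (w $ i) ^ ((\<beta> + axis j 1) $ i))"
    unfolding cpow_def by (rule prod.remove) auto
  also have "(\<Prod>i\<in>UNIV - {j}. (w $ i) ^ ((\<beta> + axis j 1) $ i)) = (\<Prod>i\<in>UNIV - {j}. (w $ i) ^ (\<beta> $ i))"
    by (rule prod.cong) (auto simp: axis_def)
  also have "w $ j ^ ((\<beta> + axis j 1) $ j) * \<dots> = w $ j * (w $ j ^ (\<beta> $ j) * (\<Prod>i\<in>UNIV - {j}. (w $ i) ^ (\<beta> $ i)))"
    by (simp add: axis_def)
  also have "\<dots> = w $ j * cpow w \<beta>"
    unfolding cpow_def by (subst prod.remove[of UNIV j]) auto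
  finally show ?thesis .
qed

text \<open>In one variable the derivative of the polynomial and that of the Gaussian combine to the
  right-hand side of \<open>hermite_ft_Suc\<close>. The factor
  \<open>- 2 * of_real pi * \<i>\<close> is the one that a character yields when differentiated in
  its frequency.\<close>

lemma hermite_gauss_deriv:
  "((\<lambda>c. hermite_gauss \<beta> (y + scaleC c (axis j 1))) has_field_derivative
     (- 2 * of_real pi * \<i> * hermite_gauss (\<beta> + axis j 1) (y + scaleC c (axis j 1)))) (at c)"
proof -
  define g where "g = (\<lambda>n \<xi>. hermite_ft n \<xi> * exp (- of_real pi * \<xi>\<^sup>2))"
  have ax: "(y + scaleC c (axis j 1)) $ i = (if i = j then y $ j + c else y $ i)" for c i
    by (simp add: scaleC_vec_def scaleC_complex_def axis_def)
  have g: "(g n has_field_derivative - 2 * of_real pi * \<i> * g (Suc n) \<xi>) (at \<xi>)" for n \<xi>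
  proof -
    have "(g n has_field_derivative (- \<i> * of_nat n * hermite_ft (n - 1) \<xi>) * exp (- of_real pi * \<xi>\<^sup>2) +
        hermite_ft n \<xi> * (exp (- of_real pi * \<xi>\<^sup>2) * (- of_real pi * (2 * \<xi>)))) (at \<xi>)"
      unfolding g_def by (rule derivative_eq_intros hermite_ft_deriv refl | simp)+
    moreover have "(- \<i> * of_nat n * hermite_ft (n - 1) \<xi>) * exp (- of_real pi * \<xi>\<^sup>2) +
        hermite_ft n \<xi> * (exp (- of_real pi * \<xi>\<^sup>2) * (- of_real pi * (2 * \<xi>))) = - 2 * of_real pi * \<i> * g (Suc n) \<xi>"
    proof -
      have "- 2 * of_real pi * \<i> * g (Suc n) \<xi> = - \<i> * (2 * of_real pi * hermite_ft (Suc n) \<xi>) * exp (- of_real pi * \<xi>\<^sup>2)"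
        by (simp add: g_def)
      then show ?thesis unfolding hermite_ft_Suc by (simp add: algebra_simps)
    qed
    ultimately show ?thesis by simp
  qed
  define R where "R = (\<Prod>i\<in>UNIV - {j}. g (\<beta> $ i) (y $ i))"
  have split: "hermite_gauss \<beta> (y + scaleC c (axis j 1)) = g (\<beta> $ j) (y $ j + c) * R" for c
  proof -
    have "hermite_gauss \<beta> (y + scaleC c (axis j 1)) = g (\<beta> $ j) ((y + scaleC c (axis j 1)) $ j) *
        (\<Prod>i\<in>UNIV - {j}. g (\<beta> $ i) ((y + scaleC c (axis j 1)) $ i))"
      unfolding hermite_gauss_def g_def by (rule prod.remove) auto
    then show ?thesis by (simp add: ax R_def del: vector_add_component)
  qed
  have split': "hermite_gauss (\<beta> + axis j 1) (y + scaleC c (axis j 1)) = g (Suc (\<beta> $ j)) (y $ j + c) * R" for c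
  proof -
    have "hermite_gauss (\<beta> + axis j 1) (y + scaleC c (axis j 1)) =
        g ((\<beta> + axis j 1) $ j) ((y + scaleC c (axis j 1)) $ j) *
        (\<Prod>i\<in>UNIV - {j}. g ((\<beta> + axis j 1) $ i) ((y + scaleC c (axis j 1)) $ i))"
      unfolding hermite_gauss_def g_def by (rule prod.remove) auto
    moreover have "(\<Prod>i\<in>UNIV - {j}. g ((\<beta> + axis j 1) $ i) ((y + scaleC c (axis j 1)) $ i)) = R"
      unfolding R_def by (rule prod.cong) (auto simp: axis_def scaleC_vec_def scaleC_complex_def)
    moreover have "(\<beta> + axis j 1) $ j = Suc (\<beta> $ j)" by (simp add: axis_def)
    ultimately show ?thesis by (simp add: ax del: vector_add_component)
  qed
  have "((\<lambda>c. g (\<beta> $ j) (y $ j + c)) has_field_derivative - 2 * of_real pi * \<i> * g (Suc (\<beta> $ j)) (y $ j + c)) (at c)"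
    using g[of "\<beta> $ j" "y $ j + c"] DERIV_shift[of "g (\<beta> $ j)" _ c "y $ j"] by (simp add: add.commute)
  from DERIV_cmult_right[OF this, of R] show ?thesis unfolding split split' by (simp add: mult.assoc)
qed

section \<open>Differentiating the Poisson formula in the frequency\<close>

lemma has_clinear_derivative_complex:
  "(f has_field_derivative d) (at p) \<Longrightarrow> has_clinear_derivative f ((*) d) p" for p :: complex
  unfolding has_clinear_derivative_def has_field_derivative_def
  by (auto simp: scaleC_complex_def mult_ac)

text \<open>A sum is an integral over counting measure, so the theorem on parametric integrals
  applies and a summable bound for the terms near 0 is enough.\<close>

lemma has_field_derivative_infsum:
  fixes f :: "complex \<Rightarrow> 'i \<Rightarrow> complex"
  assumes f: "\<And>c z. z \<in> L \<Longrightarrow> ((\<lambda>c. f c z) has_field_derivative f' c z) (at c)"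
    and bound: "\<And>c z. norm c < 1 \<Longrightarrow> z \<in> L \<Longrightarrow> norm (f c z) \<le> g z"
    and g: "g summable_on L"
  shows "((\<lambda>c. \<Sum>\<^sub>\<infinity>z\<in>L. f c z) has_field_derivative (\<Sum>\<^sub>\<infinity>z\<in>L. f' 0 z)) (at 0)"
proof -
  have g0: "g z \<ge> 0" if "z \<in> L" for z using bound[of 0, OF _ that] by (auto intro: order_trans[OF norm_ge_zero])
  have gn: "(\<lambda>z. norm (g z)) summable_on L"
    using g by (rule summable_on_cong[THEN iffD1, rotated]) (simp add: g0)
  have gi: "integrable (count_space L) g" using gn by (simp only: integrable_count_space_iff)
  have cl: "has_clinear_derivative (\<lambda>c. f c z) ((*) (f' c z)) c" if "z \<in> space (count_space L)" for c z
    by (rule has_clinear_derivative_complex[OF f]) (use that in simp)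
  have i1: "integrable (count_space L) (\<lambda>z. f' 0 z * 1)"
    by (rule has_clinear_derivative_integral(1)[where f=f and f'="\<lambda>c z. (*) (f' c z)" and r=1, OF _ cl _ _ gi])
      (use bound in \<open>auto simp: dist_norm\<close>)
  have i2: "has_clinear_derivative (\<lambda>c. \<integral>z. f c z \<partial>count_space L) (\<lambda>h. \<integral>z. f' 0 z * h \<partial>count_space L) 0"
    by (rule has_clinear_derivative_integral(2)[where f=f and f'="\<lambda>c z. (*) (f' c z)" and r=1, OF _ cl _ _ gi])
      (use bound in \<open>auto simp: dist_norm\<close>)
  have fi: "(\<integral>z. f c z \<partial>count_space L) = (\<Sum>\<^sub>\<infinity>z\<in>L. f c z)" if "norm c < 1" for c
    by (rule integral_count_space_eq_infsum, rule summable_on_comparison_test[OF g])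
      (use bound[OF that] in auto)
  have f'i: "(\<integral>z. f' 0 z \<partial>count_space L) = (\<Sum>\<^sub>\<infinity>z\<in>L. f' 0 z)"
    using i1 by (intro integral_count_space_eq_infsum) (simp add: integrable_count_space_iff)
  have "((\<lambda>c. \<integral>z. f c z \<partial>count_space L) has_field_derivative (\<Sum>\<^sub>\<infinity>z\<in>L. f' 0 z)) (at 0)"
  proof -
    have "(\<lambda>h. \<integral>z. f' 0 z * h \<partial>count_space L) = (*) (\<Sum>\<^sub>\<infinity>z\<in>L. f' 0 z)"
      by (rule ext) (simp add: f'i)
    then show ?thesis using i2 by (simp add: has_clinear_derivative_def has_field_derivative_def)
  qed
  then show ?thesis
    by (rule has_field_derivative_transform_within[where d=1]) (auto simp: fi dist_norm)
qed

text \<open>The character is taken at \<open>z - x\<close> instead of \<open>z\<close>, so that a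
  derivative in \<open>v\<close> brings down a coordinate of \<open>z - x\<close>, one more factor
  of the monomial.\<close>

definition poisson_term :: "nat ^ 'd \<Rightarrow> real ^ 'd \<Rightarrow> complex ^ 'd \<Rightarrow> real ^ 'd \<Rightarrow> complex" where
  "poisson_term \<alpha> x v z = cpow (complex_vec z - complex_vec x) \<alpha> *
     exp (- 2 * of_real pi * \<i> * cdot v (complex_vec z - complex_vec x)) *
     exp (- of_real pi * cdot (complex_vec z - complex_vec x) (complex_vec z - complex_vec x))"

text \<open>With the character of \<open>poisson_term\<close> centred at \<open>x\<close>, the
  remaining exponential does not involve \<open>v\<close>, and a derivative in \<open>v\<close>
  meets \<open>hermite_gauss\<close> alone.\<close>

definition dual_term :: "nat ^ 'd \<Rightarrow> real ^ 'd \<Rightarrow> complex ^ 'd \<Rightarrow> real ^ 'd \<Rightarrow> complex" where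
  "dual_term \<alpha> x v k = hermite_gauss \<alpha> (v - complex_vec k) *
     exp (2 * of_real pi * \<i> * cdot (complex_vec k) (complex_vec x))"

lemma norm_exp_ii_cdot_le: "norm (exp (2 * of_real pi * \<i> * cdot v w)) \<le> exp (2 * pi * (norm v * norm w))"
proof -
  have "Re (2 * of_real pi * \<i> * cdot v w) \<le> norm (2 * of_real pi * \<i> * cdot v w)"
    by (rule complex_Re_le_cmod)
  also have "\<dots> = 2 * pi * norm (cdot v w)" by (simp add: norm_mult)
  also have "\<dots> \<le> 2 * pi * (norm v * norm w)"
    using norm_cdot_le[of v w] by (intro mult_left_mono) auto
  finally show ?thesis unfolding norm_exp_eq_Re exp_le_cancel_iff .
qed

text \<open>Uniformity over a ball of frequencies is what termwise differentiation asks for. The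
  monomial is bounded by an exponential, which \<open>gauss_factor_bound\<close> absorbs.\<close>

lemma poisson_term_bound:
  fixes x :: "real ^ 'd"
  obtains K where "\<And>v z. norm v \<le> R \<Longrightarrow> norm (poisson_term \<alpha> x v z) \<le> K * exp (- (norm z)\<^sup>2)"
proof -
  define R' where "R' = \<bar>R\<bar> + norm x"
  define N where "N = real (multi_abs \<alpha>)"
  obtain C where C: "C > 0" "\<And>u v (z::real^'d). norm u \<le> R' \<Longrightarrow> norm v \<le> R' \<Longrightarrow>
       exp (N * norm (complex_vec z - u)) * norm (gauss_factor u v z) \<le> C * exp (- (norm z)\<^sup>2)"
    using gauss_factor_bound[of R' N] by (auto simp: R'_def N_def)
  show ?thesis
  proof (rule that)
    fix v :: "complex ^ 'd" and z assume v: "norm v \<le> R"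
    have n: "norm v \<le> R'" "norm (complex_vec x) \<le> R'"
      using v norm_ge_zero[of x] abs_ge_self[of R] abs_ge_zero[of R]
      unfolding R'_def norm_complex_vec by linarith+
    define E where "E = exp (2 * of_real pi * \<i> * cdot v (complex_vec x))"
    have E: "norm E \<le> exp (2 * pi * (R' * R'))"
    proof -
      have "norm E \<le> exp (2 * pi * (norm v * norm (complex_vec x)))"
        unfolding E_def by (rule norm_exp_ii_cdot_le)
      also have "\<dots> \<le> exp (2 * pi * (R' * R'))"
        unfolding exp_le_cancel_iff using n by (intro mult_left_mono mult_mono) (auto simp: R'_def)
      finally show ?thesis .
    qed
    have "exp (- 2 * of_real pi * \<i> * cdot v (complex_vec z - complex_vec x)) =
        exp (- 2 * of_real pi * \<i> * cdot v (complex_vec z)) * E"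
      unfolding E_def exp_add[symmetric] by (rule arg_cong[where f=exp]) (simp add: cdot_diff_right ring_distribs)
    then have "norm (poisson_term \<alpha> x v z) = norm (cpow (complex_vec z - complex_vec x) \<alpha>) *
        norm (gauss_factor (complex_vec x) v z) * norm E"
      by (simp only: poisson_term_def gauss_factor_def norm_mult mult_ac)
    also have "\<dots> \<le> (C * exp (- (norm z)\<^sup>2)) * exp (2 * pi * (R' * R'))"
    proof (rule mult_mono[OF _ E])
      have "norm (cpow (complex_vec z - complex_vec x) \<alpha>) \<le> exp (N * norm (complex_vec z - complex_vec x))"
        unfolding N_def by (rule cpow_exp_bound)
      then have "norm (cpow (complex_vec z - complex_vec x) \<alpha>) * norm (gauss_factor (complex_vec x) v z) \<le>
          exp (N * norm (complex_vec z - complex_vec x)) * norm (gauss_factor (complex_vec x) v z)"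
        by (rule mult_right_mono) simp
      also have "\<dots> \<le> C * exp (- (norm z)\<^sup>2)" by (rule C(2)[OF n(2,1)])
      finally show "norm (cpow (complex_vec z - complex_vec x) \<alpha>) * norm (gauss_factor (complex_vec x) v z) \<le> C * exp (- (norm z)\<^sup>2)" .
    qed (use C(1) in auto)
    finally show "norm (poisson_term \<alpha> x v z) \<le> (C * exp (2 * pi * (R' * R'))) * exp (- (norm z)\<^sup>2)"
      by (simp only: mult_ac)
  qed
qed

lemma dual_term_bound:
  fixes x :: "real ^ 'd"
  obtains K where "\<And>v k. norm v \<le> R \<Longrightarrow> norm (dual_term \<alpha> x v k) \<le> K * exp (- (norm k)\<^sup>2)"
proof -
  define N where "N = real (multi_abs \<alpha>)"
  obtain C where C: "C > 0" "\<And>u v (z::real^'d). norm u \<le> \<bar>R\<bar> \<Longrightarrow> norm v \<le> \<bar>R\<bar> \<Longrightarrow>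
       exp (N * norm (complex_vec z - u)) * norm (gauss_factor u v z) \<le> C * exp (- (norm z)\<^sup>2)"
    using gauss_factor_bound[of "\<bar>R\<bar>" N] by (auto simp: N_def)
  obtain B where B: "B \<ge> 1" "\<And>w. norm (multi_hermite \<alpha> w) \<le> B * (1 + norm w) ^ multi_abs \<alpha>"
    using multi_hermite_bound by blast
  show ?thesis
  proof (rule that)
    fix v :: "complex ^ 'd" and k assume v: "norm v \<le> R"
    have "cdot (v - complex_vec k) (v - complex_vec k) = cdot (complex_vec k - v) (complex_vec k - v)"
      by (simp add: cdot_diff_left cdot_diff_right)
    then have "norm (dual_term \<alpha> x v k) = norm (multi_hermite \<alpha> (v - complex_vec k)) * norm (gauss_factor v 0 k)"
      by (simp add: dual_term_def hermite_gauss_eq gauss_factor_def norm_mult cdot_complex_vec norm_exp_eq_Re)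
        (simp add: cdot_def)
    also have "\<dots> \<le> (B * exp (N * norm (complex_vec k - v))) * norm (gauss_factor v 0 k)"
    proof (rule mult_right_mono)
      have "(1 + norm (v - complex_vec k)) ^ multi_abs \<alpha> \<le> exp (N * norm (v - complex_vec k))"
        unfolding N_def by (rule one_plus_power_le_exp) simp
      then have "B * (1 + norm (v - complex_vec k)) ^ multi_abs \<alpha> \<le> B * exp (N * norm (v - complex_vec k))"
        using B(1) by (intro mult_left_mono) auto
      then show "norm (multi_hermite \<alpha> (v - complex_vec k)) \<le> B * exp (N * norm (complex_vec k - v))"
        using B(2)[of "v - complex_vec k"] by (simp add: norm_minus_commute)
    qed simp
    also have "\<dots> \<le> B * (C * exp (- (norm k)\<^sup>2))"
      unfolding mult.assoc using B(1) v by (intro mult_left_mono C(2)) auto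
    finally show "norm (dual_term \<alpha> x v k) \<le> (B * C) * exp (- (norm k)\<^sup>2)"
      by (simp only: mult.assoc)
  qed
qed

lemma gauss_summable_exp: "gauss_summable L \<Longrightarrow> (\<lambda>z. K * exp (- (norm z)\<^sup>2)) summable_on L"
proof (rule summable_on_cmult_right)
  assume "gauss_summable L"
  from this[unfolded gauss_summable_def, rule_format, of 1]
  show "(\<lambda>z. exp (- (norm z)\<^sup>2)) summable_on L" by simp
qed

lemma poisson_term_deriv:
  "((\<lambda>c. poisson_term \<beta> x (v + scaleC c (axis j 1)) z) has_field_derivative
     - 2 * of_real pi * \<i> * poisson_term (\<beta> + axis j 1) x (v + scaleC c (axis j 1)) z) (at c)"
proof -
  define w where "w = complex_vec z - complex_vec x"
  have ax: "cdot (axis j 1) w = w $ j"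
    unfolding cdot_def axis_def by (simp add: if_distrib[where f="\<lambda>a. a * _"] cong: if_cong)
  have "((\<lambda>c. cpow w \<beta> * exp (- 2 * of_real pi * \<i> * (cdot v w + c * w $ j)) * exp (- of_real pi * cdot w w))
     has_field_derivative - 2 * of_real pi * \<i> * (w $ j * cpow w \<beta> *
       exp (- 2 * of_real pi * \<i> * (cdot v w + c * w $ j)) * exp (- of_real pi * cdot w w))) (at c)"
    by (auto intro!: derivative_eq_intros simp: mult_ac)
  then show ?thesis
    unfolding poisson_term_def w_def[symmetric] cdot_add_left cdot_scaleC_left ax cpow_add_axis
    by (simp only: mult_ac)
qed

lemma dual_term_deriv:
  "((\<lambda>c. dual_term \<beta> x (v + scaleC c (axis j 1)) k) has_field_derivative
     - 2 * of_real pi * \<i> * dual_term (\<beta> + axis j 1) x (v + scaleC c (axis j 1)) k) (at c)"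
proof -
  have eq: "v + scaleC c (axis j 1) - complex_vec k = (v - complex_vec k) + scaleC c (axis j 1)" for c
    by simp
  show ?thesis
    unfolding dual_term_def eq
    using DERIV_cmult_right[OF hermite_gauss_deriv] by (simp only: mult.assoc)
qed

text \<open>One component grows by 1 in each step, as under a single partial derivative.\<close>

lemma multi_index_induct [case_names zero add]:
  fixes \<alpha> :: "nat ^ 'd"
  assumes "P 0" "\<And>\<beta> j. P \<beta> \<Longrightarrow> P (\<beta> + axis j 1)"
  shows "P \<alpha>"
proof (induction "multi_abs \<alpha>" arbitrary: \<alpha>)
  case 0
  then have "\<alpha> = 0" by (simp add: multi_abs_def vec_eq_iff)
  then show ?case using assms(1) by simp
next
  case (Suc n)
  have "\<not> (\<forall>j. \<alpha> $ j = 0)"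
  proof
    assume "\<forall>j. \<alpha> $ j = 0"
    then have "multi_abs \<alpha> = 0" by (simp add: multi_abs_def)
    with Suc(2) show False by simp
  qed
  then obtain j where j: "\<alpha> $ j \<noteq> 0" by blast
  define \<beta> :: "nat ^ 'd" where "\<beta> = (\<chi> i. if i = j then \<alpha> $ j - 1 else \<alpha> $ i)"
  have \<alpha>: "\<alpha> = \<beta> + axis j 1" using j by (simp add: vec_eq_iff \<beta>_def axis_def)
  have "multi_abs \<alpha> = multi_abs \<beta> + 1"
    unfolding \<alpha> by (simp add: multi_abs_def sum.distrib axis_def)
  then have "P \<beta>" using Suc by simp
  then show ?case unfolding \<alpha> by (rule assms(2))
qed

text \<open>The induction is over all \<open>v\<close>, because the step differentiates the
  hypothesis along a complex line through \<open>v\<close>. On both sides the derivative raises the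
  multi-index and produces the same nonzero factor, which cancels.\<close>

lemma poisson_hermite:
  fixes A :: "real ^ 'd ^ 'd" and v :: "complex ^ 'd" and x :: "real ^ 'd"
  assumes A: "invertible A"
  shows "(\<Sum>\<^sub>\<infinity>z\<in>lattice_of A. poisson_term \<alpha> x v z) =
    poisson_const A * (\<Sum>\<^sub>\<infinity>k\<in>reciprocal_lattice_of A. dual_term \<alpha> x v k)"
proof (induction \<alpha> arbitrary: v rule: multi_index_induct)
  case (zero v)
  let ?e = "exp (2 * of_real pi * \<i> * cdot v (complex_vec x))"
  have h0: "hermite_gauss 0 y = exp (- of_real pi * cdot y y)" for y :: "complex ^ 'd"
    by (simp add: hermite_gauss_eq multi_hermite_def)
  have 1: "poisson_term 0 x v z = gauss_factor (complex_vec x) v z * ?e" for z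
  proof -
    have "exp (- 2 * of_real pi * \<i> * cdot v (complex_vec z - complex_vec x)) =
        exp (- 2 * of_real pi * \<i> * cdot v (complex_vec z)) * ?e"
      unfolding exp_add[symmetric] by (rule arg_cong[where f=exp]) (simp add: cdot_diff_right ring_distribs)
    then show ?thesis by (simp add: poisson_term_def gauss_factor_def cpow_def mult_ac)
  qed
  have 2: "dual_term 0 x v k = exp (- 2 * of_real pi * \<i> * cdot (v - complex_vec k) (complex_vec x)) *
      exp (- of_real pi * cdot (v - complex_vec k) (v - complex_vec k)) * ?e" for k
  proof -
    have "exp (2 * of_real pi * \<i> * cdot (complex_vec k) (complex_vec x)) =
        exp (- 2 * of_real pi * \<i> * cdot (v - complex_vec k) (complex_vec x)) * ?e"
      unfolding exp_add[symmetric] by (rule arg_cong[where f=exp]) (simp add: cdot_diff_left ring_distribs)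
    then show ?thesis by (simp only: dual_term_def h0 mult_ac)
  qed
  show ?case unfolding 1 2 infsum_cmult_left' poisson_gauss[OF A] by (simp only: mult.assoc)
next
  case (add \<beta> j v)
  let ?v = "\<lambda>c. v + scaleC c (axis j 1)"
  have B: "invertible (transpose (matrix_inv A))" by (rule matrix_inv_invertible[OF A])
  note gL = gauss_summable_exp[OF gauss_summable_lattice[OF A]]
  have gR: "(\<lambda>z. K * exp (- (norm z)\<^sup>2)) summable_on reciprocal_lattice_of A" for K
    unfolding reciprocal_lattice_of_def by (rule gauss_summable_exp[OF gauss_summable_lattice[OF B]])
  have nv: "norm (?v c) \<le> norm v + 1" if "norm c < 1" for c
  proof -
    have "norm (?v c) \<le> norm v + norm (scaleC c (axis j 1 :: complex ^ 'd))" by (rule norm_triangle_ineq)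
    also have "norm (scaleC c (axis j 1 :: complex ^ 'd)) \<le> 1" using that by (simp add: norm_scaleC)
    finally show ?thesis by simp
  qed
  obtain K1 where K1: "\<And>v' z. norm v' \<le> norm v + 1 \<Longrightarrow> norm (poisson_term \<beta> x v' z) \<le> K1 * exp (- (norm z)\<^sup>2)"
    using poisson_term_bound[where R="norm v + 1" and \<alpha>=\<beta> and x=x] by blast
  obtain K2 where K2: "\<And>v' z. norm v' \<le> norm v + 1 \<Longrightarrow> norm (dual_term \<beta> x v' z) \<le> K2 * exp (- (norm z)\<^sup>2)"
    using dual_term_bound[where R="norm v + 1" and \<alpha>=\<beta> and x=x] by blast
  have L: "((\<lambda>c. \<Sum>\<^sub>\<infinity>z\<in>lattice_of A. poisson_term \<beta> x (?v c) z) has_field_derivative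
      (\<Sum>\<^sub>\<infinity>z\<in>lattice_of A. - 2 * of_real pi * \<i> * poisson_term (\<beta> + axis j 1) x (?v 0) z)) (at 0)"
    by (rule has_field_derivative_infsum[OF poisson_term_deriv K1[OF nv] gL])
  have R: "((\<lambda>c. \<Sum>\<^sub>\<infinity>k\<in>reciprocal_lattice_of A. dual_term \<beta> x (?v c) k) has_field_derivative
      (\<Sum>\<^sub>\<infinity>k\<in>reciprocal_lattice_of A. - 2 * of_real pi * \<i> * dual_term (\<beta> + axis j 1) x (?v 0) k)) (at 0)"
    by (rule has_field_derivative_infsum[OF dual_term_deriv K2[OF nv] gR])
  have "(\<Sum>\<^sub>\<infinity>z\<in>lattice_of A. - 2 * of_real pi * \<i> * poisson_term (\<beta> + axis j 1) x (?v 0) z) =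
      poisson_const A * (\<Sum>\<^sub>\<infinity>k\<in>reciprocal_lattice_of A. - 2 * of_real pi * \<i> * dual_term (\<beta> + axis j 1) x (?v 0) k)"
    by (rule DERIV_unique[OF L]) (unfold add, rule DERIV_cmult[OF R])
  then have "- 2 * of_real pi * \<i> * (\<Sum>\<^sub>\<infinity>z\<in>lattice_of A. poisson_term (\<beta> + axis j 1) x v z) =
      - 2 * of_real pi * \<i> * (poisson_const A * (\<Sum>\<^sub>\<infinity>k\<in>reciprocal_lattice_of A. dual_term (\<beta> + axis j 1) x v k))"
    unfolding infsum_cmult_right' by (simp add: mult_ac)
  then show ?case by simp
qed

section \<open>Rescaling the lattice\<close>

lemma lattice_of_scaleR:
  fixes A :: "real ^ 'd ^ 'd"
  shows "lattice_of (r *\<^sub>R A) = (*\<^sub>R) r ` lattice_of A"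
  unfolding lattice_of_image image_image by (simp add: scaleR_matrix_vector_assoc)

lemma matrix_inv_scaleR:
  fixes A :: "real ^ 'd ^ 'd"
  assumes A: "invertible A" and r: "r \<noteq> 0"
  shows "invertible (r *\<^sub>R A)" "matrix_inv (r *\<^sub>R A) = (1 / r) *\<^sub>R matrix_inv A"
proof -
  show i: "invertible (r *\<^sub>R A)" by (rule scalar_invertible[OF r A])
  have "matrix_inv (r *\<^sub>R A) *v y = ((1 / r) *\<^sub>R matrix_inv A) *v y" for y
  proof -
    have "(r *\<^sub>R A) *v ((1 / r) *\<^sub>R (matrix_inv A *v y)) = y"
      using r by (simp add: scaleR_matrix_vector_assoc[symmetric] matrix_vector_mult_scaleR matrix_inv_invertible[OF A])
    then show ?thesis
      using matrix_inv_invertible(2)[OF i, of "(1 / r) *\<^sub>R (matrix_inv A *v y)"]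
      by (simp add: scaleR_matrix_vector_assoc)
  qed
  then show "matrix_inv (r *\<^sub>R A) = (1 / r) *\<^sub>R matrix_inv A" by (simp add: matrix_eq)
qed

lemma reciprocal_lattice_of_scaleR:
  fixes A :: "real ^ 'd ^ 'd"
  assumes "invertible A" "r \<noteq> 0"
  shows "reciprocal_lattice_of (r *\<^sub>R A) = (*\<^sub>R) (1 / r) ` reciprocal_lattice_of A"
proof -
  have "transpose ((1 / r) *\<^sub>R matrix_inv A) = (1 / r) *\<^sub>R transpose (matrix_inv A)"
    by (simp add: transpose_def vec_eq_iff)
  then show ?thesis
    unfolding reciprocal_lattice_of_def matrix_inv_scaleR(2)[OF assms] by (simp only: lattice_of_scaleR)
qed

text \<open>The substitution \<open>s \<mapsto> r *\<^sub>R s\<close> in the Gaussian integral; the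
  covolume is homogeneous of degree \<open>CARD('d)\<close>.\<close>

lemma poisson_const_scaleR:
  fixes A :: "real ^ 'd ^ 'd"
  assumes r: "r > 0"
  shows "poisson_const A = of_real r ^ CARD('d) * poisson_const (r *\<^sub>R A)"
proof -
  have m: "(\<lambda>s. of_real (exp (- pi * (norm (A *v s))\<^sup>2)) :: complex) \<in> borel_measurable borel"
    by (intro borel_measurable_continuous_onI continuous_intros)
  have "lborel = density (distr lborel borel (\<lambda>x::real^'d. 0 + r *\<^sub>R x)) (\<lambda>_. ennreal (\<bar>r\<bar> ^ DIM(real ^ 'd)))"
    using r by (intro lborel_affine) simp
  then have "lattice_gauss_integral A = (\<integral>s. of_real (exp (- pi * (norm (A *v s))\<^sup>2))
      \<partial>density (distr lborel borel (\<lambda>x::real^'d. 0 + r *\<^sub>R x)) (\<lambda>_. ennreal (\<bar>r\<bar> ^ DIM(real ^ 'd))))"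
    unfolding lattice_gauss_integral_def by (rule arg_cong)
  also have "\<dots> = (\<integral>s. (\<bar>r\<bar> ^ DIM(real ^ 'd)) *\<^sub>R complex_of_real (exp (- pi * (norm (A *v s))\<^sup>2))
      \<partial>distr lborel borel (\<lambda>x::real^'d. 0 + r *\<^sub>R x))"
    by (rule integral_density) (use m in auto)
  also have "\<dots> = (\<integral>s. (\<bar>r\<bar> ^ DIM(real ^ 'd)) *\<^sub>R complex_of_real (exp (- pi * (norm (A *v (0 + r *\<^sub>R s)))\<^sup>2)) \<partial>lborel)"
    by (rule integral_distr) (use m in auto)
  also have "\<dots> = of_real r ^ CARD('d) * lattice_gauss_integral (r *\<^sub>R A)"
    using r by (simp add: lattice_gauss_integral_def scaleR_conv_of_real[where 'a=complex] matrix_vector_mult_scaleR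
        scaleR_matrix_vector_assoc)
  finally show ?thesis by (simp add: poisson_const_def)
qed

lemma cpow_scaleC: "cpow (scaleC c w) \<alpha> = c ^ multi_abs \<alpha> * cpow w \<alpha>"
  by (simp add: cpow_def scaleC_vec_def scaleC_complex_def power_mult_distrib prod.distrib
      multi_abs_def power_sum)

text \<open>The functional equation of the theta series under \<open>t \<mapsto> 1 / t\<close>:
  \<open>poisson_hermite\<close> for the lattice of \<open>r *\<^sub>R A\<close>, the point
  \<open>r *\<^sub>R x\<close> and the frequency \<open>(1 / r) *\<^sub>R y\<close>. The dual
  lattice is scaled by \<open>1 / r\<close>, which turns \<open>exp (- s)\<close> into
  \<open>exp s\<close>.\<close>

lemma poisson_scaled:
  fixes A :: "real ^ 'd ^ 'd" and x y :: "real ^ 'd"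
  assumes A: "invertible A"
  shows "(\<Sum>\<^sub>\<infinity>z\<in>lattice_of A. of_real (multi_power (z - x) \<alpha>) *
        exp (- 2 * of_real pi * \<i> * of_real (y \<bullet> z)) * of_real (exp (- pi * exp (- s) * (norm (z - x))\<^sup>2))) =
    poisson_const A * of_real (exp (s / 2 * real (CARD('d) + multi_abs \<alpha>))) *
    (\<Sum>\<^sub>\<infinity>k\<in>reciprocal_lattice_of A. multi_hermite \<alpha> (complex_vec (exp (s / 2) *\<^sub>R (y - k))) *
        exp (- 2 * of_real pi * \<i> * of_real ((y - k) \<bullet> x)) * of_real (exp (- pi * exp s * (norm (y - k))\<^sup>2)))"
proof -
  \<comment> \<open>Its square is \<open>exp (- s)\<close>, the factor wanted in the Gaussian
    exponent.\<close>
  define r where "r = exp (- s / 2)"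
  have r: "r > 0" "r \<noteq> 0" by (simp_all add: r_def)
  have r3: "1 / r \<noteq> 0" using r by simp
  have r2: "r\<^sup>2 = exp (- s)" by (simp add: r_def flip: exp_double)
  have r1: "1 / r = exp (s / 2)" by (simp add: r_def exp_minus field_simps)
  have r12: "(1 / r)\<^sup>2 = exp s" unfolding r1 by (simp flip: exp_double)
  define n where "n = multi_abs \<alpha>"
  let ?e = "exp (2 * of_real pi * \<i> * of_real (y \<bullet> x))"
  define v where "v = complex_vec ((1 / r) *\<^sub>R y)"
  define a where "a = (\<lambda>z. of_real (multi_power (z - x) \<alpha>) *
        exp (- 2 * of_real pi * \<i> * of_real (y \<bullet> z)) * of_real (exp (- pi * exp (- s) * (norm (z - x))\<^sup>2)) :: complex)"
  define b where "b = (\<lambda>k. multi_hermite \<alpha> (complex_vec (exp (s / 2) *\<^sub>R (y - k))) *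
        exp (- 2 * of_real pi * \<i> * of_real ((y - k) \<bullet> x)) * of_real (exp (- pi * exp s * (norm (y - k))\<^sup>2)))"
  have P: "(\<Sum>\<^sub>\<infinity>z\<in>lattice_of (r *\<^sub>R A). poisson_term \<alpha> (r *\<^sub>R x) v z) =
      poisson_const (r *\<^sub>R A) * (\<Sum>\<^sub>\<infinity>k\<in>reciprocal_lattice_of (r *\<^sub>R A). dual_term \<alpha> (r *\<^sub>R x) v k)"
    by (rule poisson_hermite[OF matrix_inv_scaleR(1)[OF A r(2)]])
  have inj: "inj_on ((*\<^sub>R) c) S" if "c \<noteq> 0" for c and S :: "(real ^ 'd) set"
    using that by (auto simp: inj_on_def)
  have t1: "poisson_term \<alpha> (r *\<^sub>R x) v (r *\<^sub>R z) = of_real (r ^ n) * a z * ?e" for z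
  proof -
    have w: "complex_vec (r *\<^sub>R z) - complex_vec (r *\<^sub>R x) = complex_vec (r *\<^sub>R (z - x))"
      by (simp only: complex_vec_diff[symmetric] scaleR_diff_right)
    have p: "cpow (complex_vec (r *\<^sub>R (z - x))) \<alpha> = of_real (r ^ n) * of_real (multi_power (z - x) \<alpha>)"
      by (simp add: complex_vec_scaleR cpow_scaleC cpow_complex_vec n_def)
    have q: "exp (- 2 * of_real pi * \<i> * cdot v (complex_vec (r *\<^sub>R (z - x)))) =
        exp (- 2 * of_real pi * \<i> * of_real (y \<bullet> z)) * ?e"
      unfolding exp_add[symmetric] v_def cdot_complex_vec
      by (rule arg_cong[where f=exp]) (use r in \<open>simp add: inner_diff_right ring_distribs\<close>)
    have g: "- of_real pi * cdot (complex_vec (r *\<^sub>R (z - x))) (complex_vec (r *\<^sub>R (z - x))) =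
        complex_of_real (- pi * exp (- s) * (norm (z - x))\<^sup>2)"
      unfolding cdot_complex_vec r2[symmetric] power2_norm_eq_inner by (simp add: power2_eq_square)
    show ?thesis unfolding poisson_term_def w p q g a_def exp_of_real by (simp only: mult_ac)
  qed
  have t2: "dual_term \<alpha> (r *\<^sub>R x) v ((1 / r) *\<^sub>R k) = b k * ?e" for k
  proof -
    have w: "v - complex_vec ((1 / r) *\<^sub>R k) = complex_vec ((1 / r) *\<^sub>R (y - k))"
      by (simp only: v_def complex_vec_diff[symmetric] scaleR_diff_right)
    have q: "exp (2 * of_real pi * \<i> * cdot (complex_vec ((1 / r) *\<^sub>R k)) (complex_vec (r *\<^sub>R x))) =
        exp (- 2 * of_real pi * \<i> * of_real ((y - k) \<bullet> x)) * ?e"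
      unfolding exp_add[symmetric] cdot_complex_vec
      by (rule arg_cong[where f=exp]) (use r in \<open>simp add: inner_diff_left ring_distribs\<close>)
    have g: "- of_real pi * cdot (complex_vec ((1 / r) *\<^sub>R (y - k))) (complex_vec ((1 / r) *\<^sub>R (y - k))) =
        complex_of_real (- pi * exp s * (norm (y - k))\<^sup>2)"
      unfolding cdot_complex_vec r12[symmetric] power2_norm_eq_inner by (simp add: power2_eq_square)
    show ?thesis unfolding dual_term_def hermite_gauss_eq w q g b_def exp_of_real unfolding r1 by (simp only: mult_ac)
  qed
  have "of_real (r ^ n) * infsum a (lattice_of A) * ?e = poisson_const (r *\<^sub>R A) * (infsum b (reciprocal_lattice_of A) * ?e)"
    using P unfolding lattice_of_scaleR reciprocal_lattice_of_scaleR[OF A r(2)]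
      infsum_reindex[OF inj[OF r(2)]] infsum_reindex[OF inj[OF r3]] o_def t1 t2
      infsum_cmult_left' infsum_cmult_right' .
  then have "of_real (r ^ n) * infsum a (lattice_of A) = poisson_const (r *\<^sub>R A) * infsum b (reciprocal_lattice_of A)"
    unfolding mult.assoc[symmetric] by (simp only: mult_right_cancel exp_not_eq_zero not_False_eq_True simp_thms)
  then have "of_real (r ^ CARD('d)) * (of_real (r ^ n) * infsum a (lattice_of A)) =
      poisson_const A * infsum b (reciprocal_lattice_of A)"
    unfolding poisson_const_scaleR[OF r(1), of A] by simp
  \<comment> \<open>The covolume contributes \<open>CARD('d)\<close> powers of \<open>r\<close> and
    the monomial \<open>n\<close> powers; on the other side they become the exponential that shifts
    \<nu> by \<open>CARD('d) + n\<close> in the Mellin integral.\<close>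
  moreover have "complex_of_real (r ^ CARD('d)) * of_real (r ^ n) * of_real (exp (s / 2 * real (CARD('d) + n))) = 1"
  proof -
    have "r ^ CARD('d) * r ^ n = exp (- (s / 2 * real (CARD('d) + n)))"
      unfolding power_add[symmetric] unfolding r_def exp_of_nat_mult[symmetric]
      by (rule arg_cong[where f=exp]) (simp add: field_simps)
    then have "r ^ CARD('d) * r ^ n * exp (s / 2 * real (CARD('d) + n)) = 1"
      by (simp only: exp_add[symmetric]) simp
    then show ?thesis by (metis of_real_1 of_real_mult)
  qed
  ultimately have "infsum a (lattice_of A) =
      poisson_const A * of_real (exp (s / 2 * real (CARD('d) + n))) * infsum b (reciprocal_lattice_of A)"
    by (smt (verit, ccfv_threshold) mult.assoc mult.commute mult_1)
  then show ?thesis by (simp only: a_def b_def n_def)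
qed

section \<open>The analytic continuation\<close>

lemma kernel_factor_cpow: "kernel_factor (\<lambda>w s. cpow w (\<alpha> :: nat ^ 'd))"
  unfolding kernel_factor_def
proof (intro conjI allI exI[of _ "real (multi_abs \<alpha>)"] impI)
  fix w :: "complex ^ 'd" and s :: real
  show "holo_at (\<lambda>w. cpow w \<alpha>) w" unfolding cpow_def by (intro holo_intros)
  assume "s \<ge> 0"
  then have "real (multi_abs \<alpha>) * norm w \<le> real (multi_abs \<alpha>) * (1 + s + norm w)"
    by (intro mult_left_mono) auto
  then show "norm (cpow w \<alpha>) \<le> exp (real (multi_abs \<alpha>) * (1 + s + norm w))"
    using cpow_exp_bound[of w \<alpha>] by (meson exp_le_cancel_iff order_trans)
qed auto

text \<open>\<open>ekernel\<close> inserts the lattice point minus the centre, k - v, whereas the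
  Hermite polynomial belongs at v - k; hence the minus sign.\<close>

definition dual_factor :: "nat ^ 'd \<Rightarrow> (complex ^ 'd) \<Rightarrow> real \<Rightarrow> complex" where
  "dual_factor \<alpha> w s = multi_hermite \<alpha> (scaleC (- of_real (exp (s / 2))) w)"

text \<open>A polynomial of degree \<open>multi_abs \<alpha>\<close> at an argument of size
  \<open>exp (s / 2) * norm w\<close> grows at most like
  \<open>exp (multi_abs \<alpha> * s / 2)\<close> in \<open>s\<close>, which the growth condition
  permits. The bound \<open>B \<ge> 1\<close> makes \<open>ln B\<close> nonnegative.\<close>

lemma kernel_factor_dual: "kernel_factor (dual_factor \<alpha>)"
proof -
  obtain B where B: "B \<ge> 1" "\<And>w. norm (multi_hermite \<alpha> w) \<le> B * (1 + norm w) ^ multi_abs \<alpha>"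
    using multi_hermite_bound by blast
  define n where "n = real (multi_abs \<alpha>)"
  have nth: "scaleC c w $ j = c * w $ j" for c and w :: "complex ^ 'd" and j
    by (simp add: scaleC_vec_def scaleC_complex_def)
  have hc: "continuous_on UNIV (hermite_ft k)" for k
    by (rule DERIV_continuous_on[OF has_field_derivative_at_within[OF hermite_ft_deriv]])
  have "holo_at (\<lambda>w. dual_factor \<alpha> w s) w" for w s
    unfolding dual_factor_def multi_hermite_def nth
    by (intro holo_intros holo_at_comp[OF _ hermite_ft_deriv])
  moreover have "dual_factor \<alpha> w \<in> borel_measurable borel" for w
    unfolding dual_factor_def multi_hermite_def nth
    by (intro borel_measurable_continuous_onI continuous_intros continuous_on_compose2[OF hc]) auto
  moreover have "norm (dual_factor \<alpha> w s) \<le> exp ((ln B + n) * (1 + s + norm w))" if s: "s \<ge> 0" for w s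
  proof -
    let ?e = "exp (s / 2)"
    have e: "?e \<ge> 1" using s by simp
    have nw: "norm (scaleC (- of_real ?e) w) = ?e * norm w" by (simp add: norm_scaleC)
    have "norm (dual_factor \<alpha> w s) \<le> B * (1 + ?e * norm w) ^ multi_abs \<alpha>"
      unfolding dual_factor_def using B(2)[of "scaleC (- of_real ?e) w"] by (simp only: nw)
    also have "\<dots> \<le> B * (?e * (1 + norm w)) ^ multi_abs \<alpha>"
      using B(1) e by (intro mult_left_mono power_mono) (auto simp: distrib_left)
    also have "\<dots> \<le> exp (ln B) * (exp (n * (s / 2)) * exp (n * norm w))"
    proof -
      have p: "?e ^ multi_abs \<alpha> = exp (n * (s / 2))" by (simp only: n_def exp_of_nat_mult)
      show ?thesis
        unfolding power_mult_distrib p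
        using B(1) one_plus_power_le_exp[of "norm w" "multi_abs \<alpha>"]
        by (intro mult_mono) (auto simp: n_def)
    qed
    also have "\<dots> = exp (ln B + n * (s / 2 + norm w))" by (simp add: exp_add ring_distribs)
    also have "\<dots> \<le> exp ((ln B + n) * (1 + s + norm w))"
    proof -
      have "ln B * 1 \<le> ln B * (1 + s + norm w)" using B(1) s by (intro mult_left_mono) auto
      moreover have "n * (s / 2 + norm w) \<le> n * (1 + s + norm w)"
        using s by (intro mult_left_mono) (auto simp: n_def)
      ultimately show ?thesis by (simp add: ring_distribs)
    qed
    finally show ?thesis .
  qed
  moreover have "ln B + n \<ge> 0" using B(1) by (simp add: n_def)
  ultimately show ?thesis unfolding kernel_factor_def by blast
qed

section \<open>Elementary Mellin integrals\<close>

lemma gamma_integral_exp: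
  assumes \<sigma>: "Re \<sigma> > 0"
  shows "integrable lborel (\<lambda>s::real. exp (of_real s * \<sigma> - of_real (exp s)))"
    and "(\<integral>s. exp (of_real s * \<sigma> - of_real (exp s)) \<partial>lborel) = Gamma \<sigma>"
proof -
  define f where "f = (\<lambda>t::real. of_real t powr (\<sigma> - 1) / of_real (exp t) :: complex)"
  define g where "g = (\<lambda>s::real. exp (of_real s * \<sigma> - of_real (exp s)) :: complex)"
  have im: "range (exp :: real \<Rightarrow> real) = {0<..}" by (auto simp: image_iff intro: exp_ln[symmetric])
  have fg: "\<bar>exp s\<bar> *\<^sub>R f (exp s) = g s" for s
  proof -
    have "of_real (exp s) powr (\<sigma> - 1) = exp ((\<sigma> - 1) * of_real s)"
      by (simp add: powr_def Ln_of_real)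
    then have "\<bar>exp s\<bar> *\<^sub>R f (exp s) = exp (of_real s) * exp ((\<sigma> - 1) * of_real s) * exp (- of_real (exp s))"
      by (simp add: f_def scaleR_conv_of_real exp_of_real[symmetric] exp_minus divide_inverse)
    also have "\<dots> = g s" unfolding g_def exp_add[symmetric] by (rule arg_cong[where f=exp]) (simp add: algebra_simps)
    finally show ?thesis .
  qed
  have abs: "f absolutely_integrable_on {0<..}"
    using absolutely_integrable_Gamma_integral'[OF \<sigma>] by (simp add: f_def)
  have int: "integral {0<..} f = Gamma \<sigma>"
    using Gamma_integral_complex'[OF \<sigma>] by (simp add: f_def integral_unique)
  \<comment> \<open>The substitution \<open>t = exp s\<close> in Euler's integral; the Jacobian
    \<open>exp s\<close> raises the exponent \<open>\<sigma> - 1\<close> to \<sigma>.\<close>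
  have "(\<lambda>s. \<bar>exp s\<bar> *\<^sub>R f (exp s)) absolutely_integrable_on UNIV \<and> integral UNIV (\<lambda>s. \<bar>exp s\<bar> *\<^sub>R f (exp s)) = Gamma \<sigma>"
    by (subst has_absolute_integral_change_of_variables_real)
      (auto simp: im abs int inj_on_def intro!: derivative_eq_intros)
  then have *: "g absolutely_integrable_on UNIV" "integral UNIV g = Gamma \<sigma>" unfolding fg by simp_all
  have gm: "g \<in> borel_measurable borel"
    unfolding g_def by (intro borel_measurable_continuous_onI continuous_intros)
  have "integrable lebesgue g" using *(1) by (simp add: set_integrable_def)
  then have i: "integrable lborel g" using gm by (simp add: integrable_completion)
  then show "integrable lborel (\<lambda>s::real. exp (of_real s * \<sigma> - of_real (exp s)))" by (simp add: g_def)
  have "(\<integral>s. g s \<partial>lborel) = integral UNIV g" using integral_lborel[OF i] by simp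
  then show "(\<integral>s. exp (of_real s * \<sigma> - of_real (exp s)) \<partial>lborel) = Gamma \<sigma>" using *(2) by (simp add: g_def)
qed

text \<open>Scaling \<open>t\<close> by \<rho> is a translation of \<open>s\<close> by
  \<open>ln \<rho>\<close>.\<close>

lemma gamma_integral_scaled:
  assumes \<sigma>: "Re \<sigma> > 0" and \<rho>: "\<rho> > 0"
  shows "integrable lborel (\<lambda>s::real. exp (of_real s * \<sigma> - of_real (\<rho> * exp s)))"
    and "(\<integral>s. exp (of_real s * \<sigma> - of_real (\<rho> * exp s)) \<partial>lborel) = Gamma \<sigma> * exp (- \<sigma> * of_real (ln \<rho>))"
proof -
  define g where "g = (\<lambda>s::real. exp (of_real s * \<sigma> - of_real (exp s)) :: complex)"
  have gm: "g \<in> borel_measurable borel"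
    unfolding g_def by (intro borel_measurable_continuous_onI continuous_intros)
  have eq: "exp (of_real s * \<sigma> - of_real (\<rho> * exp s)) = exp (- \<sigma> * of_real (ln \<rho>)) * g (ln \<rho> + s)" for s
    unfolding g_def exp_add[symmetric] using \<rho>
    by (intro arg_cong[where f=exp]) (simp add: exp_add algebra_simps)
  have i: "integrable lborel (\<lambda>s. g (ln \<rho> + s))"
    using lborel_integral_translate(2)[OF gm, of "ln \<rho>"] gamma_integral_exp(1)[OF \<sigma>] by (simp add: g_def)
  show "integrable lborel (\<lambda>s::real. exp (of_real s * \<sigma> - of_real (\<rho> * exp s)))"
    unfolding eq by (rule integrable_mult_right[OF i])
  show "(\<integral>s. exp (of_real s * \<sigma> - of_real (\<rho> * exp s)) \<partial>lborel) = Gamma \<sigma> * exp (- \<sigma> * of_real (ln \<rho>))"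
    unfolding eq integral_mult_right_zero lborel_integral_translate(1)[OF gm]
    by (simp add: g_def gamma_integral_exp(2)[OF \<sigma>])
qed

text \<open>The lower half is reflected onto \<open>s \<ge> 0\<close>, where \<open>eint\<close>
  lives. The point 0 is counted in both halves and is a null set.\<close>

lemma integral_split_reflect:
  fixes g :: "real \<Rightarrow> complex"
  assumes g: "integrable lborel g"
  shows "(\<integral>s. g s \<partial>lborel) = (\<integral>s. indicator {0..} s *\<^sub>R g s \<partial>lborel) + (\<integral>s. indicator {0..} s *\<^sub>R g (- s) \<partial>lborel)"
proof -
  have gm [measurable]: "g \<in> borel_measurable borel" using g by auto
  have i1: "integrable lborel (\<lambda>s. indicator {0..} s *\<^sub>R g s)"
    and i2: "integrable lborel (\<lambda>s. indicator {..0} s *\<^sub>R g s)"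
    by (auto intro!: integrable_mult_indicator g)
  have "(\<integral>s. g s \<partial>lborel) = (\<integral>s. indicator {0..} s *\<^sub>R g s + indicator {..0} s *\<^sub>R g s \<partial>lborel)"
  proof (rule integral_cong_AE)
    show "AE s in lborel. g s = indicator {0..} s *\<^sub>R g s + indicator {..0} s *\<^sub>R g s"
      using AE_lborel_singleton[of "0::real"] by eventually_elim (auto simp: indicator_def)
  qed auto
  also have "\<dots> = (\<integral>s. indicator {0..} s *\<^sub>R g s \<partial>lborel) + (\<integral>s. indicator {..0} s *\<^sub>R g s \<partial>lborel)"
    by (rule Bochner_Integration.integral_add[OF i1 i2])
  also have "(\<integral>s. indicator {..0} s *\<^sub>R g s \<partial>lborel) = (\<integral>s. indicator {..0} (- s) *\<^sub>R g (- s) \<partial>lborel)"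
  proof -
    have "(\<integral>s. indicator {..0} s *\<^sub>R g s \<partial>lborel) = (\<integral>s. indicator {..0} s *\<^sub>R g s \<partial>distr lborel borel uminus)"
      by (simp only: lborel_distr_uminus)
    also have "\<dots> = (\<integral>s. indicator {..0} (- s) *\<^sub>R g (- s) \<partial>lborel)"
      by (rule integral_distr) auto
    finally show ?thesis .
  qed
  also have "(\<lambda>s::real. indicator {..0} (- s) *\<^sub>R g (- s)) = (\<lambda>s. indicator {0..} s *\<^sub>R g (- s))"
    by (auto simp: indicator_def)
  finally show ?thesis .
qed

text \<open>With \<open>a = (\<nu> - N) / 2\<close> and \<open>a = \<nu> / 2\<close>, where N is
  \<open>CARD('d) + multi_abs \<alpha>\<close>, these are the contributions of the two deleted
  terms.\<close>

lemma integral_exp_tail: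
  assumes a: "Re a > 0"
  shows "integrable lborel (\<lambda>s::real. indicator {0..} s *\<^sub>R exp (- (of_real s * a)))"
    and "(\<integral>s. indicator {0..} s *\<^sub>R exp (- (of_real s * a)) \<partial>lborel) = 1 / a"
proof -
  let ?f = "\<lambda>s::real. indicator {0..} s *\<^sub>R exp (- (of_real s * a))"
  have w: "integrable lborel (\<lambda>s. indicator {0..} (0 + Re a * s) * exp (- (0 + Re a * s)) :: real)"
    using integrable_exp_tail by (rule lborel_integrable_real_affine) (use a in simp)
  have fm: "?f \<in> borel_measurable lborel" by simp
  have bd: "norm (?f s) \<le> indicator {0..} (0 + Re a * s) * exp (- (0 + Re a * s))" for s
    using a by (auto simp: indicator_def norm_exp_eq_Re mult.commute zero_le_mult_iff)
  show "integrable lborel ?f"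
    by (rule Bochner_Integration.integrable_bound[OF w fm]) (rule AE_I2, rule order_trans[OF bd], simp)
  have lim1: "(\<lambda>n. \<integral>s. indicator {0..real n} s *\<^sub>R exp (- (of_real s * a)) \<partial>lborel) \<longlonglongrightarrow> (\<integral>s. ?f s \<partial>lborel)"
  proof (rule integral_dominated_convergence[OF fm _ w])
    show "(\<lambda>s. indicator {0..real n} s *\<^sub>R exp (- (of_real s * a))) \<in> borel_measurable lborel" for n by simp
    show "AE s in lborel. (\<lambda>n. indicator {0..real n} s *\<^sub>R exp (- (of_real s * a))) \<longlonglongrightarrow> ?f s"
    proof (rule AE_I2)
      fix s :: real
      obtain N where N: "s \<le> real N" using real_arch_simple by blast
      have "\<forall>\<^sub>F n in sequentially. indicator {0..real n} s *\<^sub>R exp (- (of_real s * a)) = ?f s"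
        using eventually_ge_at_top[of N]
      proof eventually_elim
        case (elim n)
        then have "real N \<le> real n" by simp
        then show ?case using N by (auto simp: indicator_def)
      qed
      then show "(\<lambda>n. indicator {0..real n} s *\<^sub>R exp (- (of_real s * a))) \<longlonglongrightarrow> ?f s"
        by (rule tendsto_eventually)
    qed
    show "AE s in lborel. norm (indicator {0..real n} s *\<^sub>R exp (- (of_real s * a))) \<le>
        indicator {0..} (0 + Re a * s) * exp (- (0 + Re a * s))" for n
    proof (rule AE_I2)
      fix s :: real
      have "norm (indicator {0..real n} s *\<^sub>R exp (- (of_real s * a))) \<le> norm (?f s)"
        by (auto simp: indicator_def)
      then show "norm (indicator {0..real n} s *\<^sub>R exp (- (of_real s * a))) \<le>
        indicator {0..} (0 + Re a * s) * exp (- (0 + Re a * s))" using bd[of s] by (rule order_trans)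
    qed
  qed
  have a0: "a \<noteq> 0" using a by auto
  have val: "(\<integral>s. indicator {0..real n} s *\<^sub>R exp (- (of_real s * a)) \<partial>lborel) = 1 / a - exp (- (of_real (real n) * a)) / a" for n
  proof -
    have "(\<integral>s. indicator {0..real n} s *\<^sub>R exp (- (of_real s * a)) \<partial>lborel) =
        (- exp (- (of_real (real n) * a)) / a) - (- exp (- (of_real 0 * a)) / a)"
    proof (rule integral_FTC_Icc)
      fix s :: real
      show "((\<lambda>s. - exp (- (of_real s * a)) / a) has_vector_derivative exp (- (of_real s * a))) (at s within {0..real n})"
      proof -
        have "((\<lambda>w. - exp (- (w * a)) / a) has_field_derivative exp (- (of_real s * a))) (at (of_real s))"
          using a0 by (auto intro!: derivative_eq_intros)
        then show ?thesis
          using has_vector_derivative_real_field has_vector_derivative_at_within by blast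
      qed
    qed (auto intro!: continuous_intros)
    then show ?thesis by simp
  qed
  have lim2: "(\<lambda>n. 1 / a - exp (- (of_real (real n) * a)) / a) \<longlonglongrightarrow> 1 / a - 0 / a"
  proof (intro tendsto_intros a0)
    have "(\<lambda>n. exp (- (real n * Re a))) \<longlonglongrightarrow> 0" using a by real_asymp
    then have "(\<lambda>n. norm (exp (- (of_real (real n) * a)))) \<longlonglongrightarrow> 0" by (simp add: norm_exp_eq_Re)
    then show "(\<lambda>n. exp (- (of_real (real n) * a))) \<longlonglongrightarrow> 0" by (rule tendsto_norm_zero_cancel)
  qed
  show "(\<integral>s. ?f s \<partial>lborel) = 1 / a"
    using LIMSEQ_unique[OF lim1[unfolded val] lim2] by simp
qed

section \<open>Growth of the theta series\<close>

lemma summable_gauss_shift: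
  fixes x :: "real ^ 'd"
  assumes L: "gauss_summable L" and c: "c > 0"
  shows "(\<lambda>z. exp (- c * (norm (z - x))\<^sup>2)) summable_on L"
proof -
  have "(\<lambda>z. exp (- (c / 2) * (norm z)\<^sup>2)) summable_on L"
    by (rule L[unfolded gauss_summable_def, rule_format]) (use c in simp)
  then have "(\<lambda>z. exp (c * (norm x)\<^sup>2) * exp (- (c / 2) * (norm z)\<^sup>2)) summable_on L"
    by (rule summable_on_cmult_right)
  then show ?thesis
  proof (rule summable_on_comparison_test)
    fix z
    have "norm z \<le> norm (z - x) + norm x" using norm_triangle_sub[of z x] by linarith
    then have "(norm z)\<^sup>2 \<le> (norm (z - x) + norm x)\<^sup>2" by (intro power_mono) auto
    also have "\<dots> \<le> 2 * (norm (z - x))\<^sup>2 + 2 * (norm x)\<^sup>2"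
      using zero_le_power2[of "norm (z - x) - norm x"] by (simp add: power2_eq_square algebra_simps)
    finally have "(c / 2) * (norm z)\<^sup>2 \<le> (c / 2) * (2 * (norm (z - x))\<^sup>2 + 2 * (norm x)\<^sup>2)"
      using c by (intro mult_left_mono) auto
    then have "- c * (norm (z - x))\<^sup>2 \<le> c * (norm x)\<^sup>2 + - (c / 2) * (norm z)\<^sup>2"
      by (simp add: algebra_simps)
    then show "exp (- c * (norm (z - x))\<^sup>2) \<le> exp (c * (norm x)\<^sup>2) * exp (- (c / 2) * (norm z)\<^sup>2)"
      unfolding exp_add[symmetric] exp_le_cancel_iff .
  qed simp
qed

text \<open>The rate at which sums of absolute values grow as \<open>t\<close> tends to 0. The
  unweighted theta series grows like \<open>exp (s / 2 * d)\<close> by Poisson summation; the power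
  of the norm costs a further \<open>exp (s / 2 * n)\<close> after half of the Gaussian has been
  spent on it.\<close>

lemma theta_bound:
  fixes A :: "real ^ 'd ^ 'd" and x :: "real ^ 'd"
  assumes A: "invertible A"
  obtains K where
    "\<And>s. s \<ge> 0 \<Longrightarrow> (\<lambda>z. norm (z - x) ^ n * exp (- pi * exp (- s) * (norm (z - x))\<^sup>2)) summable_on lattice_of A"
    "\<And>s. s \<ge> 0 \<Longrightarrow> (\<Sum>\<^sub>\<infinity>z\<in>lattice_of A. norm (z - x) ^ n * exp (- pi * exp (- s) * (norm (z - x))\<^sup>2)) \<le>
        K * exp (s / 2 * real (CARD('d) + n))"
proof -
  define d where "d = CARD('d)"
  \<comment> \<open>From \<open>quadratic_le\<close>: the maximum of
    \<open>exp (n * \<rho> - pi / 2 * \<rho>\<^sup>2)\<close> over \<rho>.\<close>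
  define E where "E = exp ((real n)\<^sup>2 / (2 * pi))"
  note gL = gauss_summable_lattice[OF A]
  have gM: "gauss_summable (reciprocal_lattice_of A)"
    unfolding reciprocal_lattice_of_def by (rule gauss_summable_lattice[OF matrix_inv_invertible(4)[OF A]])
  define T where "T = (\<Sum>\<^sub>\<infinity>k\<in>reciprocal_lattice_of A. exp (- pi * (norm (0 - k))\<^sup>2))"
  have T_sum: "(\<lambda>k. exp (- pi * (norm (0 - k))\<^sup>2)) summable_on reciprocal_lattice_of A"
    using gM[unfolded gauss_summable_def, rule_format, of pi] by simp
  \<comment> \<open>With trivial weight and character the lattice side is a sum of positive terms,
    so the norm of the Poisson identity bounds it. On the dual side \<open>exp s \<ge> 1\<close>
    allows comparison with the sum \<open>T\<close> at \<open>s = 0\<close>.\<close>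
  have theta: "(\<Sum>\<^sub>\<infinity>z\<in>lattice_of A. exp (- pi * exp (- s) * (norm (z - x))\<^sup>2)) \<le>
      norm (poisson_const A) * exp (s / 2 * real d) * T" if s: "s \<ge> 0" for s
  proof -
    let ?h = "\<lambda>k. multi_hermite (0 :: nat ^ 'd) (complex_vec (exp (s / 2) *\<^sub>R (0 - k))) *
        exp (- 2 * of_real pi * \<i> * of_real ((0 - k) \<bullet> x)) * of_real (exp (- pi * exp s * (norm (0 - k))\<^sup>2)) :: complex"
    have nh: "norm (?h k) = exp (- pi * exp s * (norm (0 - k))\<^sup>2)" for k
      by (simp add: norm_mult multi_hermite_def norm_exp_eq_Re)
    have le: "exp (- pi * exp s * (norm (0 - k))\<^sup>2) \<le> exp (- pi * (norm (0 - k))\<^sup>2)" for k :: "real ^ 'd"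
    proof -
      have "pi * 1 * (norm (0 - k))\<^sup>2 \<le> pi * exp s * (norm (0 - k))\<^sup>2"
        using s by (intro mult_right_mono mult_left_mono) auto
      then show ?thesis by simp
    qed
    have sm: "(\<lambda>k. exp (- pi * exp s * (norm (0 - k))\<^sup>2)) summable_on reciprocal_lattice_of A"
      by (rule summable_on_comparison_test[OF T_sum le]) simp
    have "(\<Sum>\<^sub>\<infinity>z\<in>lattice_of A. of_real (multi_power (z - x) (0 :: nat ^ 'd)) *
        exp (- 2 * of_real pi * \<i> * of_real (0 \<bullet> z)) * of_real (exp (- pi * exp (- s) * (norm (z - x))\<^sup>2))) =
        complex_of_real (\<Sum>\<^sub>\<infinity>z\<in>lattice_of A. exp (- pi * exp (- s) * (norm (z - x))\<^sup>2))"
    proof -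
      have "(\<lambda>z. exp (- pi * exp (- s) * (norm (z - x))\<^sup>2)) summable_on lattice_of A"
        using summable_gauss_shift[OF gL, of "pi * exp (- s)" x] by simp
      from infsumI[OF has_sum_of_real[OF has_sum_infsum[OF this]]]
      show ?thesis by (simp add: multi_power_def)
    qed
    moreover have "multi_abs (0 :: nat ^ 'd) = 0" by (simp add: multi_abs_def)
    ultimately have "complex_of_real (\<Sum>\<^sub>\<infinity>z\<in>lattice_of A. exp (- pi * exp (- s) * (norm (z - x))\<^sup>2)) =
        poisson_const A * of_real (exp (s / 2 * real d)) * (\<Sum>\<^sub>\<infinity>k\<in>reciprocal_lattice_of A. ?h k)"
      using poisson_scaled[OF A, where x=x and y=0 and \<alpha>=0 and s=s] by (simp only: d_def add_0_right)
    then have "norm (complex_of_real (\<Sum>\<^sub>\<infinity>z\<in>lattice_of A. exp (- pi * exp (- s) * (norm (z - x))\<^sup>2))) =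
        norm (poisson_const A) * exp (s / 2 * real d) * norm (\<Sum>\<^sub>\<infinity>k\<in>reciprocal_lattice_of A. ?h k)"
      by (simp only: norm_mult) simp
    moreover have "norm (\<Sum>\<^sub>\<infinity>k\<in>reciprocal_lattice_of A. ?h k) \<le> T"
    proof -
      have "norm (\<Sum>\<^sub>\<infinity>k\<in>reciprocal_lattice_of A. ?h k) \<le> (\<Sum>\<^sub>\<infinity>k\<in>reciprocal_lattice_of A. norm (?h k))"
      proof (rule norm_infsum_bound)
        show "(\<lambda>k. norm (?h k)) summable_on reciprocal_lattice_of A"
          unfolding nh by (rule sm)
      qed
      also have "\<dots> \<le> T" unfolding nh T_def by (rule infsum_mono[OF sm T_sum le])
      finally show ?thesis .
    qed
    ultimately have "norm (complex_of_real (\<Sum>\<^sub>\<infinity>z\<in>lattice_of A. exp (- pi * exp (- s) * (norm (z - x))\<^sup>2))) \<le>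
        norm (poisson_const A) * exp (s / 2 * real d) * T"
      by (simp only:) (intro mult_left_mono mult_nonneg_nonneg norm_ge_zero exp_ge_zero)
    then show ?thesis unfolding norm_of_real by linarith
  qed
  define f where "f = (\<lambda>s z. norm (z - x) ^ n * exp (- pi * exp (- s) * (norm (z - x))\<^sup>2))"
  \<comment> \<open>Replacing \<open>s\<close> by \<open>s + ln 2\<close> halves the Gaussian
    exponent; the other half absorbs the power of the norm, rescaled by
    \<open>exp (s / 2)\<close>.\<close>
  define g where "g = (\<lambda>s z. E * exp (s / 2 * real n) * exp (- pi * exp (- (s + ln 2)) * (norm (z - x))\<^sup>2))"
  have fg: "f s z \<le> g s z" for s z
  proof -
    define w where "w = norm (z - x)"
    define \<rho> where "\<rho> = exp (- s / 2) * w"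
    have w: "w = exp (s / 2) * \<rho>" by (simp add: \<rho>_def exp_minus)
    have \<rho>0: "\<rho> \<ge> 0" by (simp add: \<rho>_def w_def)
    have r2: "exp (- s) * w\<^sup>2 = \<rho>\<^sup>2" by (simp add: \<rho>_def power_mult_distrib flip: exp_double)
    have "\<rho> ^ n \<le> (1 + \<rho>) ^ n" using \<rho>0 by (intro power_mono) auto
    also have "\<dots> \<le> exp (real n * \<rho>)" by (rule one_plus_power_le_exp[OF \<rho>0])
    finally have "\<rho> ^ n * exp (- pi * \<rho>\<^sup>2) \<le> exp (real n * \<rho>) * exp (- pi * \<rho>\<^sup>2)"
      by (rule mult_right_mono) simp
    also have "\<dots> \<le> E * exp (- (pi / 2) * \<rho>\<^sup>2)"
      using quadratic_le[of "pi / 2" "real n" \<rho>] unfolding E_def exp_add[symmetric] by simp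
    finally have "exp (s / 2 * real n) * (\<rho> ^ n * exp (- pi * \<rho>\<^sup>2)) \<le> exp (s / 2 * real n) * (E * exp (- (pi / 2) * \<rho>\<^sup>2))"
      by (rule mult_left_mono) simp
    moreover have "f s z = exp (s / 2 * real n) * (\<rho> ^ n * exp (- pi * \<rho>\<^sup>2))"
    proof -
      have "w ^ n = exp (s / 2 * real n) * \<rho> ^ n"
        unfolding w power_mult_distrib exp_of_nat_mult[symmetric] by (simp add: mult.commute)
      then show ?thesis unfolding f_def w_def[symmetric] r2[symmetric] by (simp add: mult_ac)
    qed
    moreover have "g s z = exp (s / 2 * real n) * (E * exp (- (pi / 2) * \<rho>\<^sup>2))"
    proof -
      have "exp (- (s + ln 2)) = exp (- s) * exp (- ln 2 :: real)"
        unfolding exp_add[symmetric] by simp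
      also have "exp (- ln 2 :: real) = 1 / 2" by (simp add: exp_minus)
      finally have "exp (- (s + ln 2)) = exp (- s) * (1 / 2)" .
      then have "- pi * exp (- (s + ln 2)) * w\<^sup>2 = - (pi / 2) * \<rho>\<^sup>2"
        unfolding r2[symmetric] by simp
      then have "g s z = E * exp (s / 2 * real n) * exp (- (pi / 2) * \<rho>\<^sup>2)"
        unfolding g_def w_def[symmetric] by (rule arg_cong)
      then show ?thesis by (simp only: mult_ac)
    qed
    ultimately show ?thesis by simp
  qed
  have g_sum: "g s summable_on lattice_of A" for s
    unfolding g_def
    by (rule summable_on_cmult_right, rule summable_gauss_shift[OF gL, where c="pi * exp (- (s + ln 2))", simplified minus_mult_left]) simp
  have f_sum: "f s summable_on lattice_of A" for s
    by (rule summable_on_comparison_test[OF g_sum fg]) (simp add: f_def)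
  define K where "K = E * (norm (poisson_const A) * exp (ln 2 / 2 * real d) * T)"
  have "infsum (f s) (lattice_of A) \<le> K * exp (s / 2 * real (CARD('d) + n))" if s: "s \<ge> 0" for s
  proof -
    have "infsum (f s) (lattice_of A) \<le> infsum (g s) (lattice_of A)"
      by (rule infsum_mono[OF f_sum g_sum fg])
    also have "\<dots> = E * exp (s / 2 * real n) * (\<Sum>\<^sub>\<infinity>z\<in>lattice_of A. exp (- pi * exp (- (s + ln 2)) * (norm (z - x))\<^sup>2))"
      unfolding g_def by (rule infsum_cmult_right')
    also have "\<dots> \<le> E * exp (s / 2 * real n) * (norm (poisson_const A) * exp ((s + ln 2) / 2 * real d) * T)"
      using s by (intro mult_left_mono theta) (auto simp: E_def)
    also have "exp ((s + ln 2) / 2 * real d) = exp (s / 2 * real d) * exp (ln 2 / 2 * real d)"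
      unfolding exp_add[symmetric] by (rule arg_cong[where f=exp]) (simp add: field_simps)
    also have "E * exp (s / 2 * real n) * (norm (poisson_const A) * (exp (s / 2 * real d) * exp (ln 2 / 2 * real d)) * T) =
        K * (exp (s / 2 * real d) * exp (s / 2 * real n))" by (simp only: K_def mult_ac)
    also have "exp (s / 2 * real d) * exp (s / 2 * real n) = exp (s / 2 * real (CARD('d) + n))"
      unfolding exp_add[symmetric] d_def by (rule arg_cong[where f=exp]) (simp add: field_simps)
    finally show ?thesis .
  qed
  then show ?thesis using that f_sum unfolding f_def by blast
qed

text \<open>\<omega> and \<tau> are the weights of the terms at y and x, set to 0 when these points
  are off the lattices. The second \<open>eint\<close> has v as centre and - u as frequency, with
  \<nu> reflected. In the last term the factor \<open>2 / \<nu>\<close> has been merged into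
  \<open>rGamma (\<nu> / 2 + 1)\<close>, which is entire. For \<open>\<omega> = 0\<close> the
  quotient is 0 at every \<nu>, including the zero of its denominator.\<close>

definition epstein_formula :: "real ^ 'd ^ 'd \<Rightarrow> nat ^ 'd \<Rightarrow> (real ^ 'd) set \<Rightarrow> (real ^ 'd) set \<Rightarrow> complex \<Rightarrow> complex \<Rightarrow>
    complex \<Rightarrow> complex ^ 'd \<Rightarrow> complex ^ 'd \<Rightarrow> complex" where
  "epstein_formula A \<alpha> L M \<omega> \<tau> \<nu> u v = exp (\<nu> / 2 * of_real (ln pi)) *
     (rGamma (\<nu> / 2) *
       (eint (\<lambda>w s. cpow w \<alpha>) L (\<nu>, u, v) +
        poisson_const A * exp (- 2 * of_real pi * \<i> * cdot v u) *
          eint (dual_factor \<alpha>) M (of_nat (CARD('d) + multi_abs \<alpha>) - \<nu>, v, - u) +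
        2 * poisson_const A * \<omega> / (\<nu> - of_nat (CARD('d) + multi_abs \<alpha>))) -
      \<tau> * exp (- 2 * of_real pi * \<i> * cdot v u) * rGamma (\<nu> / 2 + 1))"

section \<open>Agreement of the formula with the series\<close>

lemma mellin_gaussian:
  assumes \<nu>: "Re \<nu> > 0" and w: "w > 0"
  shows "1 / of_real w powr \<nu> = exp (\<nu> / 2 * of_real (ln pi)) * rGamma (\<nu> / 2) *
      ((\<integral>s. indicator {0..} s *\<^sub>R (exp (of_real (s / 2) * \<nu>) * of_real (exp (- pi * exp s * w\<^sup>2))) \<partial>lborel) +
       (\<integral>s. indicator {0..} s *\<^sub>R (exp (of_real (- s / 2) * \<nu>) * of_real (exp (- pi * exp (- s) * w\<^sup>2))) \<partial>lborel))"
proof -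
  \<comment> \<open>Euler's integral with \<open>\<rho> = pi * w\<^sup>2\<close>: it produces
    \<open>Gamma (\<nu> / 2)\<close>, a power of \<open>pi\<close> and the wanted power of
    \<open>w\<close>, and the prefactors undo the first two.\<close>
  define g where "g = (\<lambda>s::real. exp (of_real s * (\<nu> / 2) - of_real (pi * w\<^sup>2 * exp s)) :: complex)"
  have \<sigma>: "Re (\<nu> / 2) > 0" and \<rho>: "pi * w\<^sup>2 > 0" using \<nu> w by auto
  have gi: "integrable lborel g" unfolding g_def by (rule gamma_integral_scaled(1)[OF \<sigma> \<rho>])
  have eq: "exp (of_real (s / 2) * \<nu>) * of_real (exp (- pi * exp s * w\<^sup>2)) = g s" for s
    unfolding g_def exp_of_real[symmetric] exp_add[symmetric] by (rule arg_cong[where f=exp]) (simp add: mult_ac)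
  have X: "(\<integral>s. g s \<partial>lborel) = Gamma (\<nu> / 2) * exp (- (\<nu> / 2) * of_real (ln (pi * w\<^sup>2)))"
    unfolding g_def by (rule gamma_integral_scaled(2)[OF \<sigma> \<rho>])
  have Y: "exp (- (\<nu> / 2) * of_real (ln (pi * w\<^sup>2))) = exp (- (\<nu> / 2 * of_real (ln pi))) * (1 / of_real w powr \<nu>)"
  proof -
    have "1 / of_real w powr \<nu> = exp (- (\<nu> * of_real (ln w)))"
      using w by (simp add: powr_def Ln_of_real exp_minus field_simps)
    moreover have "ln (pi * w\<^sup>2) = ln pi + 2 * ln w"
      using w by (simp add: ln_mult ln_realpow)
    ultimately show ?thesis
      by (simp only: exp_add[symmetric]) (rule arg_cong[where f=exp], simp add: ring_distribs)
  qed
  have "Gamma (\<nu> / 2) \<noteq> 0"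
    using \<sigma> by (auto simp: Gamma_eq_zero_iff elim!: nonpos_Ints_cases)
  then have G: "rGamma (\<nu> / 2) * Gamma (\<nu> / 2) = 1" by (simp add: rGamma_inverse_Gamma)
  have alg: "c * r * (G * (e * q)) = (r * G) * (c * e) * q" for c r G e q :: complex
    by (simp add: mult_ac)
  have e: "exp (\<nu> / 2 * of_real (ln pi)) * exp (- (\<nu> / 2 * of_real (ln pi))) = 1"
    by (rule exp_minus_inverse)
  have "exp (\<nu> / 2 * of_real (ln pi)) * rGamma (\<nu> / 2) * (\<integral>s. g s \<partial>lborel) =
      (rGamma (\<nu> / 2) * Gamma (\<nu> / 2)) *
      (exp (\<nu> / 2 * of_real (ln pi)) * exp (- (\<nu> / 2 * of_real (ln pi)))) * (1 / of_real w powr \<nu>)"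
    unfolding X Y by (rule alg)
  then have 1: "1 / of_real w powr \<nu> = exp (\<nu> / 2 * of_real (ln pi)) * rGamma (\<nu> / 2) * (\<integral>s. g s \<partial>lborel)"
    unfolding G e by (simp only: mult_1_left)
  have eq2: "exp (of_real (- s / 2) * \<nu>) * of_real (exp (- pi * exp (- s) * w\<^sup>2)) = g (- s)" for s
    using eq[of "- s"] by simp
  show ?thesis unfolding eq eq2 using 1 integral_split_reflect[OF gi] by simp
qed

lemma multi_power_abs_le: "\<bar>multi_power z \<alpha>\<bar> \<le> norm z ^ multi_abs \<alpha>"
  using cpow_bound[of "complex_vec z" \<alpha>] by (simp add: cpow_complex_vec)

lemma infsum_diff_point:
  fixes f :: "'a \<Rightarrow> complex"
  assumes "(\<lambda>z. norm (f z)) summable_on (L - {x})"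
  shows "infsum f L = infsum f (L - {x}) + (if x \<in> L then f x else 0)"
proof (cases "x \<in> L")
  case True
  have "f summable_on (L - {x})" using assms abs_summable_summable by blast
  from infsum_insert[OF this, of x] show ?thesis using True by (simp add: insert_absorb)
qed simp

text \<open>Each term is a Mellin integral, split at \<open>s = 0\<close>. Summing the upper half
  gives the first \<open>eint\<close> directly; the reflected lower half is summed under the
  integral and transformed by \<open>poisson_scaled\<close> for each \<open>s\<close>.\<close>

lemma epstein_series_eq_formula:
  fixes A :: "real ^ 'd ^ 'd" and x y :: "real ^ 'd" and \<alpha> :: "nat ^ 'd"
  assumes A: "invertible A" and \<nu>: "Re \<nu> > real (CARD('d) + multi_abs \<alpha>)"
  shows "epstein_series (lattice_of A) \<alpha> x y \<nu> =
    epstein_formula A \<alpha> (lattice_of A - {x}) (reciprocal_lattice_of A - {y})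
      (if y \<in> reciprocal_lattice_of A then multi_hermite \<alpha> 0 else 0)
      (if x \<in> lattice_of A then of_real (multi_power 0 \<alpha>) else 0) \<nu> (complex_vec x) (complex_vec y)"
proof -
  define \<Lambda> where "\<Lambda> = lattice_of A"
  define M where "M = reciprocal_lattice_of A - {y}"
  define L where "L = \<Lambda> - {x}"
  define n where "n = multi_abs \<alpha>"
  define N where "N = CARD('d) + n"
  define P where "P = poisson_const A"
  define \<omega> where "\<omega> = (if y \<in> reciprocal_lattice_of A then multi_hermite \<alpha> 0 else 0)"
  define \<tau> where "\<tau> = (if x \<in> \<Lambda> then complex_of_real (multi_power 0 \<alpha>) else 0)"
  define e where "e = exp (- 2 * of_real pi * \<i> * of_real (y \<bullet> x))"
  define X where "X = (\<lambda>z. of_real (multi_power (z - x) \<alpha>) * exp (- 2 * of_real pi * \<i> * of_real (y \<bullet> z)) :: complex)"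
  define H where "H = (\<lambda>z s. exp (of_real (s / 2) * \<nu>) * X z * of_real (exp (- pi * exp s * (norm (z - x))\<^sup>2)))"
  define u where "u = complex_vec x"
  define v where "v = complex_vec y"
  note \<nu>N = \<nu>[folded n_def, folded N_def]
  have \<nu>0: "Re \<nu> > 0" using \<nu>N by (meson le_less_trans of_nat_0_le_iff)
  have gsL: "gauss_summable L"
    unfolding L_def \<Lambda>_def by (rule gauss_summable_subset[OF gauss_summable_lattice[OF A]]) auto
  have gsM: "gauss_summable M"
    unfolding M_def reciprocal_lattice_of_def
    by (rule gauss_summable_subset[OF gauss_summable_lattice[OF matrix_inv_invertible(4)[OF A]]]) auto
  have uD: "u \<in> D_set L" by (simp add: u_def complex_vec_in_D_set_iff L_def)
  have vD: "v \<in> D_set M" by (simp add: v_def complex_vec_in_D_set_iff M_def)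
  have cL: "countable L" by (rule gauss_summable_imp_countable[OF gsL])
  interpret L: sigma_finite_measure "count_space L"
    by (rule sigma_finite_measure_count_space_countable[OF cL])
  interpret pair_sigma_finite "count_space L" "lborel :: real measure" ..
  have nX: "norm (X z) \<le> norm (z - x) ^ n" for z
    using multi_power_abs_le[of "z - x" \<alpha>] by (simp add: X_def norm_mult norm_exp_eq_Re n_def)
  have Hcont: "continuous_on UNIV (\<lambda>s. H z s)" for z
    unfolding H_def by (intro continuous_intros) auto
  have Hm: "(\<lambda>s. H z s) \<in> borel_measurable borel" "(\<lambda>s. H z (- s)) \<in> borel_measurable borel" for z
    by (auto intro!: borel_measurable_continuous_onI Hcont continuous_on_compose2[OF Hcont] continuous_intros)

  have Hker: "ekernel (\<lambda>w s. cpow w \<alpha>) (\<nu>, u, v) z s = H z s" for z s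
  proof -
    have "cpow (complex_vec z - u) \<alpha> = of_real (multi_power (z - x) \<alpha>)"
      unfolding u_def complex_vec_diff[symmetric] by (rule cpow_complex_vec)
    moreover have "- of_real (pi * exp s) * cdot (complex_vec z - u) (complex_vec z - u) =
        complex_of_real (- pi * exp s * (norm (z - x))\<^sup>2)"
      unfolding u_def complex_vec_diff[symmetric] cdot_complex_vec by (simp add: power2_norm_eq_inner)
    ultimately show ?thesis
      unfolding ekernel_def H_def X_def fst_conv snd_conv
      by (simp only: v_def cdot_complex_vec exp_of_real mult_ac)
  qed
  have i1: "integrable (count_space L \<Otimes>\<^sub>M lborel) (case_prod (\<lambda>z s. indicator {0..} s *\<^sub>R H z s))"
    using eint_properties(2)[OF gsL kernel_factor_cpow, of "(\<nu>, u, v)" \<alpha>] uD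
    by (simp add: eint_measure_def case_prod_beta' Hker)
  have sum1: "(\<lambda>z. norm (\<integral>s. indicator {0..} s *\<^sub>R H z s \<partial>lborel)) summable_on L"
    using integrable_fst[OF i1] by (simp add: integrable_count_space_iff)
  have I1: "(\<Sum>\<^sub>\<infinity>z\<in>L. \<integral>s. indicator {0..} s *\<^sub>R H z s \<partial>lborel) = eint (\<lambda>w s. cpow w \<alpha>) L (\<nu>, u, v)"
    using integral_fst[OF i1] integral_count_space_eq_infsum[OF sum1]
    by (simp only: eint_def eint_measure_def case_prod_beta' Hker)

  obtain K where K: "\<And>s. s \<ge> 0 \<Longrightarrow> (\<lambda>z. norm (z - x) ^ n * exp (- pi * exp (- s) * (norm (z - x))\<^sup>2)) summable_on \<Lambda>"
    "\<And>s. s \<ge> 0 \<Longrightarrow> (\<Sum>\<^sub>\<infinity>z\<in>\<Lambda>. norm (z - x) ^ n * exp (- pi * exp (- s) * (norm (z - x))\<^sup>2)) \<le> K * exp (s / 2 * real N)"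
    using theta_bound[OF A, of x n] unfolding \<Lambda>_def N_def by blast
  \<comment> \<open>The reflected terms without the power of \<open>t\<close>. The Poisson formula
    applies to their sum over the whole lattice; the term at \<open>x\<close> is subtracted
    afterwards.\<close>
  define t where "t = (\<lambda>s z. X z * of_real (exp (- pi * exp (- s) * (norm (z - x))\<^sup>2)))"
  have nt: "norm (t s z) \<le> norm (z - x) ^ n * exp (- pi * exp (- s) * (norm (z - x))\<^sup>2)" for s z
    unfolding t_def norm_mult using nX[of z] by (simp add: mult_right_mono)
  have t_sum: "(\<lambda>z. norm (t s z)) summable_on \<Lambda>" if "s \<ge> 0" for s
    by (rule summable_on_comparison_test[OF K(1)[OF that] nt]) simp
  have t_sumL: "(\<lambda>z. norm (t s z)) summable_on L" if "s \<ge> 0" for s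
    using summable_on_subset_banach[OF t_sum[OF that]] by (simp add: L_def)
  have t_le: "(\<Sum>\<^sub>\<infinity>z\<in>L. norm (t s z)) \<le> K * exp (s / 2 * real N)" if s: "s \<ge> 0" for s
  proof -
    have "(\<Sum>\<^sub>\<infinity>z\<in>L. norm (t s z)) \<le> (\<Sum>\<^sub>\<infinity>z\<in>\<Lambda>. norm (t s z))"
      by (rule infsum_mono_neutral[OF t_sumL[OF s] t_sum[OF s]]) (auto simp: L_def)
    also have "\<dots> \<le> (\<Sum>\<^sub>\<infinity>z\<in>\<Lambda>. norm (z - x) ^ n * exp (- pi * exp (- s) * (norm (z - x))\<^sup>2))"
      by (rule infsum_mono[OF t_sum[OF s] K(1)[OF s] nt])
    also have "\<dots> \<le> K * exp (s / 2 * real N)" by (rule K(2)[OF s])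
    finally show ?thesis .
  qed
  have H_refl: "H z (- s) = exp (- of_real (s / 2) * \<nu>) * t s z" for z s
    by (simp add: H_def t_def)
  have H_sum: "(\<lambda>z. norm (H z (- s))) summable_on L" if "s \<ge> 0" for s
    unfolding H_refl norm_mult by (rule summable_on_cmult_right[OF t_sumL[OF that]])
  \<comment> \<open>The decay rate left over when the theta series, growing like
    \<open>exp (s / 2 * N)\<close>, meets the factor of size
    \<open>exp (- s / 2 * Re \<nu>)\<close>; positive exactly because of the hypothesis on
    \<nu>.\<close>
  define c where "c = (Re \<nu> - real N) / 2"
  have c: "c > 0" using \<nu>N by (simp add: c_def)
  have H_le: "(\<Sum>\<^sub>\<infinity>z\<in>L. norm (H z (- s))) \<le> K * exp (- (c * s))" if s: "s \<ge> 0" for s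
  proof -
    have "(\<Sum>\<^sub>\<infinity>z\<in>L. norm (H z (- s))) = exp (- (s / 2) * Re \<nu>) * (\<Sum>\<^sub>\<infinity>z\<in>L. norm (t s z))"
      unfolding H_refl norm_mult infsum_cmult_right' by (simp add: norm_exp_eq_Re)
    also have "\<dots> \<le> exp (- (s / 2) * Re \<nu>) * (K * exp (s / 2 * real N))"
      by (rule mult_left_mono[OF t_le[OF s]]) simp
    also have "\<dots> = K * (exp (- (s / 2) * Re \<nu>) * exp (s / 2 * real N))" by (simp only: mult_ac)
    also have "exp (- (s / 2) * Re \<nu>) * exp (s / 2 * real N) = exp (- (c * s))"
      unfolding exp_add[symmetric] c_def by (rule arg_cong[where f=exp]) (simp add: field_simps)
    finally show ?thesis .
  qed
  \<comment> \<open>Absolute integrability on the product, by Tonelli with the lattice sum inside.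
    The domination behind \<open>eint\<close> does not reach this half, and
    \<open>theta_bound\<close> takes its place.\<close>
  have i2: "integrable (count_space L \<Otimes>\<^sub>M lborel) (case_prod (\<lambda>z s. indicator {0..} s *\<^sub>R H z (- s)))"
    unfolding integrable_iff_bounded
  proof
    show m: "case_prod (\<lambda>z s. indicator {0..} s *\<^sub>R H z (- s)) \<in> borel_measurable (count_space L \<Otimes>\<^sub>M lborel)"
      by (rule measurable_pair_measure_countable1[OF cL]) (use Hm(2) in simp)
    have "(\<integral>\<^sup>+m. ennreal (norm (case_prod (\<lambda>z s. indicator {0..} s *\<^sub>R H z (- s)) m)) \<partial>(count_space L \<Otimes>\<^sub>M lborel)) =
        (\<integral>\<^sup>+s. (\<integral>\<^sup>+z. ennreal (norm (indicator {0..} s *\<^sub>R H z (- s))) \<partial>count_space L) \<partial>lborel)"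
      using nn_integral_snd[OF measurable_compose[OF measurable_compose[OF m borel_measurable_norm] measurable_ennreal], symmetric]
      by (simp only: case_prod_conv)
    also have "\<dots> \<le> (\<integral>\<^sup>+s. ennreal (norm (K * (indicator {0..} s * exp (- (c * s))))) \<partial>lborel)"
    proof (rule nn_integral_mono)
      fix s :: real
      show "(\<integral>\<^sup>+z. ennreal (norm (indicator {0..} s *\<^sub>R H z (- s))) \<partial>count_space L) \<le>
          ennreal (norm (K * (indicator {0..} s * exp (- (c * s)))))"
      proof (cases "s \<ge> 0")
        case True
        have int: "integrable (count_space L) (\<lambda>z. norm (H z (- s)))"
          using H_sum[OF True] by (simp add: integrable_count_space_iff)
        have "(\<integral>\<^sup>+z. ennreal (norm (H z (- s))) \<partial>count_space L) = ennreal (\<integral>z. norm (H z (- s)) \<partial>count_space L)"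
          by (rule nn_integral_eq_integral[OF int]) simp
        also have "(\<integral>z. norm (H z (- s)) \<partial>count_space L) = (\<Sum>\<^sub>\<infinity>z\<in>L. norm (H z (- s)))"
          by (rule integral_count_space_eq_infsum) (use H_sum[OF True] in simp)
        also have "ennreal \<dots> \<le> ennreal (norm (K * exp (- (c * s))))"
          by (rule ennreal_leI, rule order_trans[OF H_le[OF True]]) simp
        finally show ?thesis using True by simp
      qed simp
    qed
    also have "\<dots> < \<infinity>"
    proof -
      have "integrable lborel (\<lambda>s. K * (indicator {0..} s * exp (- (c * s))))"
      proof (rule integrable_mult_right)
        have "integrable lborel (\<lambda>s. indicator {0..} (0 + c * s) * exp (- (0 + c * s)) :: real)"
          using integrable_exp_tail by (rule lborel_integrable_real_affine) (use c in simp)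
        moreover have "indicator {0..} (c * s) = (indicator {0..} s :: real)" for s
          using c by (auto simp: indicator_def zero_le_mult_iff)
        ultimately show "integrable lborel (\<lambda>s. indicator {0..} s * exp (- (c * s)) :: real)" by simp
      qed
      then show ?thesis by (simp only: integrable_iff_bounded)
    qed
    finally show "(\<integral>\<^sup>+m. ennreal (norm (case_prod (\<lambda>z s. indicator {0..} s *\<^sub>R H z (- s)) m)) \<partial>(count_space L \<Otimes>\<^sub>M lborel)) < \<infinity>" .
  qed
  have sum2: "(\<lambda>z. norm (\<integral>s. indicator {0..} s *\<^sub>R H z (- s) \<partial>lborel)) summable_on L"
    using integrable_fst[OF i2] by (simp add: integrable_count_space_iff)
  \<comment> \<open>The functional equation under the integral sign: a dual kernel sum, plus the
    term at \<open>y\<close> deleted from the dual lattice, minus the term at \<open>x\<close>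
    deleted from the lattice.\<close>
  have inner: "(\<integral>z. indicator {0..} s *\<^sub>R H z (- s) \<partial>count_space L) =
      P * e * (indicator {0..} s *\<^sub>R (\<Sum>\<^sub>\<infinity>k\<in>M. ekernel (dual_factor \<alpha>) (of_nat N - \<nu>, v, - u) k s)) +
      (P * \<omega> * (indicator {0..} s *\<^sub>R exp (- (of_real s * ((\<nu> - of_nat N) / 2)))) -
       \<tau> * e * (indicator {0..} s *\<^sub>R exp (- (of_real s * (\<nu> / 2)))))" for s
  proof (cases "s \<ge> 0")
    case True
    define T where "T = (\<lambda>k. multi_hermite \<alpha> (complex_vec (exp (s / 2) *\<^sub>R (y - k))) *
        exp (- 2 * of_real pi * \<i> * of_real ((y - k) \<bullet> x)) * of_real (exp (- pi * exp s * (norm (y - k))\<^sup>2)) :: complex)"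
    \<comment> \<open>The dual terms are again of the form \<open>ekernel\<close>, with exponent N -
      \<nu>, centre \<open>v\<close> and frequency \<open>- u\<close>; \<open>e\<close> is the part
      of the character that is free of \<open>k\<close>.\<close>
    have Tker: "exp (of_real (s / 2) * (of_nat N - \<nu>)) * T k = e * ekernel (dual_factor \<alpha>) (of_nat N - \<nu>, v, - u) k s" for k
    proof -
      have 1: "dual_factor \<alpha> (complex_vec k - v) s = multi_hermite \<alpha> (complex_vec (exp (s / 2) *\<^sub>R (y - k)))"
      proof -
        have "scaleC (- of_real (exp (s / 2))) (complex_vec k - v) = complex_vec (exp (s / 2) *\<^sub>R (y - k))"
          by (simp add: v_def vec_eq_iff complex_vec_def scaleC_vec_def scaleC_complex_def algebra_simps)
        then show ?thesis by (simp only: dual_factor_def)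
      qed
      have 2: "exp (- 2 * of_real pi * \<i> * of_real ((y - k) \<bullet> x)) = e * exp (- 2 * of_real pi * \<i> * cdot (- u) (complex_vec k))"
        unfolding e_def exp_add[symmetric] u_def complex_vec_minus[symmetric] cdot_complex_vec
        by (rule arg_cong[where f=exp]) (simp add: inner_diff_left inner_commute[of k x] ring_distribs)
      have 3: "- of_real (pi * exp s) * cdot (complex_vec k - v) (complex_vec k - v) =
          complex_of_real (- pi * exp s * (norm (y - k))\<^sup>2)"
        unfolding v_def complex_vec_diff[symmetric] cdot_complex_vec
        by (simp add: power2_norm_eq_inner norm_minus_commute[of y k])
      show ?thesis unfolding T_def ekernel_def fst_conv snd_conv 1 2 3 exp_of_real by (simp only: mult_ac)
    qed
    have T_sum: "(\<lambda>k. norm (T k)) summable_on M"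
    proof -
      have "(\<lambda>k. norm (ekernel (dual_factor \<alpha>) (of_nat N - \<nu>, v, - u) k s)) summable_on M"
        by (rule eint_properties(3)[OF gsM kernel_factor_dual _ True]) (simp add: vD)
      moreover have "norm (T k) = norm (e * exp (- (of_real (s / 2) * (of_nat N - \<nu>)))) *
          norm (ekernel (dual_factor \<alpha>) (of_nat N - \<nu>, v, - u) k s)" for k
      proof -
        have "T k = exp (- (of_real (s / 2) * (of_nat N - \<nu>))) * (exp (of_real (s / 2) * (of_nat N - \<nu>)) * T k)"
          by (simp add: exp_minus)
        then show ?thesis unfolding Tker by (simp only: norm_mult mult_ac)
      qed
      ultimately show ?thesis by (simp only: summable_on_cmult_right)
    qed
    have Ty: "T y = multi_hermite \<alpha> 0" by (simp add: T_def)
    have tx: "t s x = of_real (multi_power 0 \<alpha>) * e" by (simp add: t_def X_def e_def)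
    have "infsum (t s) \<Lambda> = P * of_real (exp (s / 2 * real N)) * infsum T (reciprocal_lattice_of A)"
      using poisson_scaled[OF A, where x=x and y=y and \<alpha>=\<alpha> and s=s]
      unfolding t_def X_def T_def \<Lambda>_def N_def n_def P_def .
    also have "infsum T (reciprocal_lattice_of A) = infsum T M + \<omega>"
      using infsum_diff_point[of T "reciprocal_lattice_of A" y] T_sum by (simp add: M_def \<omega>_def Ty)
    finally have tL: "infsum (t s) L = P * of_real (exp (s / 2 * real N)) * (infsum T M + \<omega>) - \<tau> * e"
      using infsum_diff_point[of "t s" \<Lambda> x] t_sumL[OF True] by (simp add: L_def \<tau>_def tx)
    have expN: "exp (- of_real (s / 2) * \<nu>) * of_real (exp (s / 2 * real N)) = exp (of_real (s / 2) * (of_nat N - \<nu>))"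
      unfolding exp_of_real[symmetric] exp_add[symmetric] by (rule arg_cong[where f=exp]) (simp add: ring_distribs)
    have e1: "exp (- (of_real s * ((\<nu> - of_nat N) / 2))) = exp (of_real (s / 2) * (of_nat N - \<nu>))"
      by (rule arg_cong[where f=exp]) (simp add: field_simps)
    have e2: "exp (- (of_real s * (\<nu> / 2))) = exp (- of_real (s / 2) * \<nu>)"
      by (rule arg_cong[where f=exp]) simp
    have "(\<integral>z. H z (- s) \<partial>count_space L) = (\<Sum>\<^sub>\<infinity>z\<in>L. H z (- s))"
      by (rule integral_count_space_eq_infsum[OF H_sum[OF True]])
    also have "\<dots> = exp (- of_real (s / 2) * \<nu>) * infsum (t s) L"
      unfolding H_refl by (rule infsum_cmult_right')
    also have "\<dots> = P * ((exp (- of_real (s / 2) * \<nu>) * of_real (exp (s / 2 * real N))) * infsum T M) +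
        (P * \<omega> * (exp (- of_real (s / 2) * \<nu>) * of_real (exp (s / 2 * real N))) - \<tau> * e * exp (- of_real (s / 2) * \<nu>))"
      unfolding tL by (simp add: algebra_simps)
    also have "\<dots> = P * (\<Sum>\<^sub>\<infinity>k\<in>M. exp (of_real (s / 2) * (of_nat N - \<nu>)) * T k) +
        (P * \<omega> * exp (of_real (s / 2) * (of_nat N - \<nu>)) - \<tau> * e * exp (- of_real (s / 2) * \<nu>))"
      unfolding expN infsum_cmult_right' ..
    also have "\<dots> = P * (e * (\<Sum>\<^sub>\<infinity>k\<in>M. ekernel (dual_factor \<alpha>) (of_nat N - \<nu>, v, - u) k s)) +
        (P * \<omega> * exp (- (of_real s * ((\<nu> - of_nat N) / 2))) - \<tau> * e * exp (- (of_real s * (\<nu> / 2))))"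
      unfolding Tker infsum_cmult_right' e1 e2 ..
    finally show ?thesis using True by (simp add: mult.assoc)
  qed simp
  have I2: "(\<Sum>\<^sub>\<infinity>z\<in>L. \<integral>s. indicator {0..} s *\<^sub>R H z (- s) \<partial>lborel) =
      P * e * eint (dual_factor \<alpha>) M (of_nat N - \<nu>, v, - u) + (P * \<omega> * (1 / ((\<nu> - of_nat N) / 2)) - \<tau> * e * (1 / (\<nu> / 2)))"
  proof -
    have "(\<Sum>\<^sub>\<infinity>z\<in>L. \<integral>s. indicator {0..} s *\<^sub>R H z (- s) \<partial>lborel) =
        (\<integral>s. (\<integral>z. indicator {0..} s *\<^sub>R H z (- s) \<partial>count_space L) \<partial>lborel)"
      using integral_fst[OF i2] integral_snd[OF i2] integral_count_space_eq_infsum[OF sum2] by (simp only:)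
    also have "\<dots> = P * e * eint (dual_factor \<alpha>) M (of_nat N - \<nu>, v, - u) +
        (P * \<omega> * (1 / ((\<nu> - of_nat N) / 2)) - \<tau> * e * (1 / (\<nu> / 2)))"
    proof -
      have v': "fst (snd (of_nat N - \<nu>, v, - u)) \<in> D_set M" using vD by simp
      note ei = eint_eq_iterated[OF gsM kernel_factor_dual v', of \<alpha>]
      have a1: "Re ((\<nu> - of_nat N) / 2) > 0" using \<nu>N by simp
      have a2: "Re (\<nu> / 2) > 0" using \<nu>0 by simp
      note t1 = integral_exp_tail[OF a1] and t2 = integral_exp_tail[OF a2]
      show ?thesis
        unfolding inner ei(1)
        by (simp only: Bochner_Integration.integral_add Bochner_Integration.integral_diff
            Bochner_Integration.integrable_add Bochner_Integration.integrable_diff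
            integrable_mult_right integral_mult_right_zero ei(2) t1 t2)
    qed
    finally show ?thesis .
  qed
  let ?c = "exp (\<nu> / 2 * of_real (ln pi))"
  have term_eq: "exp (- 2 * of_real pi * \<i> * of_real (y \<bullet> z)) * of_real (multi_power (z - x) \<alpha>) / of_real (norm (z - x)) powr \<nu> =
      ?c * rGamma (\<nu> / 2) * ((\<integral>s. indicator {0..} s *\<^sub>R H z s \<partial>lborel) + (\<integral>s. indicator {0..} s *\<^sub>R H z (- s) \<partial>lborel))"
    if z: "z \<in> L" for z
  proof -
    have w: "norm (z - x) > 0" using z by (simp add: L_def)
    have h1: "indicator {0..} s *\<^sub>R H z s = X z * (indicator {0..} s *\<^sub>R (exp (of_real (s / 2) * \<nu>) * of_real (exp (- pi * exp s * (norm (z - x))\<^sup>2))))" for s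
      by (simp add: H_def scaleR_conv_of_real mult_ac)
    have h2: "indicator {0..} s *\<^sub>R H z (- s) = X z * (indicator {0..} s *\<^sub>R (exp (of_real (- s / 2) * \<nu>) * of_real (exp (- pi * exp (- s) * (norm (z - x))\<^sup>2))))" for s
      by (simp add: H_def scaleR_conv_of_real mult_ac)
    have "exp (- 2 * of_real pi * \<i> * of_real (y \<bullet> z)) * of_real (multi_power (z - x) \<alpha>) / of_real (norm (z - x)) powr \<nu> =
        X z * (1 / of_real (norm (z - x)) powr \<nu>)" by (simp add: X_def)
    then show ?thesis
      unfolding mellin_gaussian[OF \<nu>0 w] h1 h2 integral_mult_right_zero by (simp only: ring_distribs mult_ac)
  qed
  have "epstein_series (lattice_of A) \<alpha> x y \<nu> =
      (\<Sum>\<^sub>\<infinity>z\<in>L. ?c * rGamma (\<nu> / 2) * ((\<integral>s. indicator {0..} s *\<^sub>R H z s \<partial>lborel) + (\<integral>s. indicator {0..} s *\<^sub>R H z (- s) \<partial>lborel)))"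
    unfolding epstein_series_def L_def[symmetric] \<Lambda>_def[symmetric] by (rule infsum_cong[OF term_eq])
  also have "\<dots> = ?c * rGamma (\<nu> / 2) *
      ((\<Sum>\<^sub>\<infinity>z\<in>L. \<integral>s. indicator {0..} s *\<^sub>R H z s \<partial>lborel) + (\<Sum>\<^sub>\<infinity>z\<in>L. \<integral>s. indicator {0..} s *\<^sub>R H z (- s) \<partial>lborel))"
    unfolding infsum_cmult_right'
    using infsum_add[OF abs_summable_summable[OF sum1] abs_summable_summable[OF sum2]] by (simp only:)
  also have "\<dots> = ?c * (rGamma (\<nu> / 2) * (eint (\<lambda>w s. cpow w \<alpha>) L (\<nu>, u, v) +
      P * e * eint (dual_factor \<alpha>) M (of_nat N - \<nu>, v, - u) + 2 * P * \<omega> / (\<nu> - of_nat N)) -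
      \<tau> * e * (rGamma (\<nu> / 2) * (1 / (\<nu> / 2))))"
    unfolding I1 I2 by (simp add: algebra_simps)
  \<comment> \<open>The apparent pole at \<nu> = 0 from the deleted term at \<open>x\<close>
    disappears, because \<open>rGamma z = z * rGamma (z + 1)\<close>.\<close>
  also have "rGamma (\<nu> / 2) * (1 / (\<nu> / 2)) = rGamma (\<nu> / 2 + 1)"
  proof -
    have "\<nu> \<noteq> 0" using \<nu>0 by auto
    then show ?thesis unfolding rGamma_plus1[of "\<nu> / 2", symmetric] by simp
  qed
  also have "e = exp (- 2 * of_real pi * \<i> * cdot v u)"
    by (simp add: e_def u_def v_def cdot_complex_vec)
  finally show ?thesis
    by (simp only: epstein_formula_def L_def M_def \<Lambda>_def N_def n_def P_def \<omega>_def \<tau>_def u_def v_def)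
qed

section \<open>Joint holomorphy of the formula\<close>

lemma holo_at_holomorphic:
  "holo_at f p \<Longrightarrow> g holomorphic_on UNIV \<Longrightarrow> holo_at (\<lambda>q. g (f q)) p"
  by (rule holo_at_comp[OF _ holomorphic_derivI[of g UNIV]]) auto

lemma holo_at_inverse: "holo_at f p \<Longrightarrow> f p \<noteq> 0 \<Longrightarrow> holo_at (\<lambda>q. inverse (f q)) p"
  by (rule holo_at_comp[OF _ DERIV_inverse])

text \<open>Otherwise Poisson summation at \<open>s = 0\<close> would make a sum of positive terms
  vanish, although the origin alone contributes 1. The residue at the pole is nonzero for this
  reason.\<close>

lemma poisson_const_nonzero:
  fixes A :: "real ^ 'd ^ 'd"
  assumes A: "invertible A"
  shows "poisson_const A \<noteq> 0"
proof
  assume "poisson_const A = 0"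
  let ?f = "\<lambda>z::real^'d. exp (- pi * (norm (z - 0))\<^sup>2)"
  have f: "?f summable_on lattice_of A"
    by (rule summable_gauss_shift[OF gauss_summable_lattice[OF A]]) simp
  have "(\<Sum>\<^sub>\<infinity>z\<in>lattice_of A. of_real (multi_power (z - 0) (0 :: nat ^ 'd)) *
      exp (- 2 * of_real pi * \<i> * of_real (0 \<bullet> z)) * of_real (exp (- pi * exp (- 0) * (norm (z - 0))\<^sup>2))) =
      complex_of_real (infsum ?f (lattice_of A))"
    using infsumI[OF has_sum_of_real[OF has_sum_infsum[OF f]]] by (simp add: multi_power_def)
  then have "complex_of_real (infsum ?f (lattice_of A)) = 0"
    using poisson_scaled[OF A, where x=0 and y=0 and \<alpha>=0 and s=0] \<open>poisson_const A = 0\<close> by (simp only:) simp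
  moreover have "0 \<in> lattice_of A" unfolding lattice_of_image
    using int_vecs_arith(1) by (auto intro!: image_eqI[of _ _ 0])
  then have "sum ?f {0} \<le> infsum ?f (lattice_of A)"
    by (intro finite_sum_le_infsum[OF f]) auto
  ultimately show False by simp
qed

lemma holo_at_epstein_formula:
  fixes A :: "real ^ 'd ^ 'd" and \<alpha> :: "nat ^ 'd"
  assumes L: "gauss_summable L" and M: "gauss_summable M"
    and u: "fst (snd p) \<in> D_set L" and v: "snd (snd p) \<in> D_set M"
    and \<omega>: "\<omega> = 0 \<or> fst p \<noteq> of_nat (CARD('d) + multi_abs \<alpha>)"
  shows "holo_at (\<lambda>p. epstein_formula A \<alpha> L M \<omega> \<tau> (fst p) (fst (snd p)) (snd (snd p))) p"
proof -
  let ?N = "of_nat (CARD('d) + multi_abs \<alpha>) :: complex"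
  have 1: "holo_at (\<lambda>p::complex \<times> (complex ^ 'd) \<times> (complex ^ 'd). fst p) p"
    by (intro holo_at_fst holo_intros)
  have 2: "holo_at (\<lambda>p::complex \<times> (complex ^ 'd) \<times> (complex ^ 'd). fst (snd p) $ i) p" for i
    by (rule holo_at_snd[of "\<lambda>x. fst x $ i"]) (intro holo_at_fst[of "\<lambda>x. x $ i"] holo_intros)
  have 3: "holo_at (\<lambda>p::complex \<times> (complex ^ 'd) \<times> (complex ^ 'd). snd (snd p) $ i) p" for i
    by (rule holo_at_snd[of "\<lambda>x. snd x $ i"]) (intro holo_at_snd[of "\<lambda>x. x $ i"] holo_intros)
  have e1: "holo_at (\<lambda>p. eint (\<lambda>w s. cpow w \<alpha>) L (fst p, fst (snd p), snd (snd p))) p"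
    using eint_properties(1)[OF L kernel_factor_cpow u] by simp
  \<comment> \<open>The reflection of \<nu> and the exchange of the vectors form an affine map
    commuting with \<open>scaleC\<close>. The vector \<open>- u\<close> lands in the unrestricted
    frequency slot, so \<open>v\<close> alone has to lie in the domain of the dual integral.\<close>
  have e2: "holo_at (\<lambda>p. eint (dual_factor \<alpha>) M (?N - fst p, snd (snd p), - fst (snd p))) p"
  proof (rule holo_at_comp_affine[where f="eint (dual_factor \<alpha>) M" and T="\<lambda>p. (?N - fst p, snd (snd p), - fst (snd p))"
        and T'="\<lambda>p. (- fst p, snd (snd p), - fst (snd p))" and a="(?N, 0, 0)"])
    show "holo_at (eint (dual_factor \<alpha>) M) (?N - fst p, snd (snd p), - fst (snd p))"
      by (rule eint_properties(1)[OF M kernel_factor_dual]) (simp add: v)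
    show "bounded_linear (\<lambda>p::complex \<times> (complex ^ 'd) \<times> (complex ^ 'd). (- fst p, snd (snd p), - fst (snd p)))"
      by (rule bounded_linear_Pair[OF bounded_linear_minus[OF bounded_linear_fst]
          bounded_linear_Pair[OF bounded_linear_compose[OF bounded_linear_snd bounded_linear_snd]
            bounded_linear_minus[OF bounded_linear_compose[OF bounded_linear_fst bounded_linear_snd]]]])
  qed (auto simp: scaleC_prod_def scaleC_vec_def scaleC_complex_def vec_eq_iff)
  have w: "holo_at (\<lambda>p. 2 * poisson_const A * \<omega> / (fst p - ?N)) p"
  proof (cases "\<omega> = 0")
    case False
    then have "fst p - ?N \<noteq> 0" using \<omega> by simp
    then have "holo_at (\<lambda>p. inverse (fst p - ?N)) p"
      by (rule holo_at_inverse[OF holo_at_diff[OF 1 holo_at_const]])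
    then show ?thesis unfolding divide_inverse by (rule holo_at_mult[OF holo_at_const])
  qed (simp add: holo_at_const)
  have g1: "holo_at (\<lambda>p::complex \<times> (complex ^ 'd) \<times> (complex ^ 'd). rGamma (fst p / 2)) p"
    unfolding divide_inverse
    by (rule holo_at_holomorphic[where g=rGamma]) (intro holo_intros 1, rule holomorphic_rGamma)
  have g2: "holo_at (\<lambda>p::complex \<times> (complex ^ 'd) \<times> (complex ^ 'd). rGamma (fst p / 2 + 1)) p"
    unfolding divide_inverse
    by (rule holo_at_holomorphic[where g=rGamma]) (intro holo_intros 1, rule holomorphic_rGamma)
  have e3: "holo_at (\<lambda>p::complex \<times> (complex ^ 'd) \<times> (complex ^ 'd). exp (fst p / 2 * of_real (ln pi))) p"
    unfolding divide_inverse by (intro holo_intros 1)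
  show ?thesis unfolding epstein_formula_def
    by (intro holo_at_mult holo_at_add holo_at_diff holo_at_const holo_at_exp holo_at_cdot e1 e2 e3 w g1 g2 2 3)
qed

text \<open>Restriction to an affine slice with \<open>u\<close> frozen. For
  \<open>u = complex_vec x\<close> with \<open>x\<close> on the lattice it is applied with
  \<open>x\<close> deleted from \<open>L\<close>.\<close>

lemma holo_at_epstein_formula_right:
  fixes A :: "real ^ 'd ^ 'd" and \<alpha> :: "nat ^ 'd"
  assumes "gauss_summable L" "gauss_summable M" "u \<in> D_set L" "snd p \<in> D_set M"
    and "\<omega> = 0 \<or> fst p \<noteq> of_nat (CARD('d) + multi_abs \<alpha>)"
  shows "holo_at (\<lambda>p. epstein_formula A \<alpha> L M \<omega> \<tau> (fst p) u (snd p)) p"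
proof -
  have "holo_at (\<lambda>p. epstein_formula A \<alpha> L M \<omega> \<tau> (fst p) (fst (snd p)) (snd (snd p))) (fst p, u, snd p)"
    by (rule holo_at_epstein_formula) (use assms in auto)
  then have "holo_at (\<lambda>q. (\<lambda>p. epstein_formula A \<alpha> L M \<omega> \<tau> (fst p) (fst (snd p)) (snd (snd p))) (fst q, u, snd q)) p"
    by (rule holo_at_comp_affine[where T="\<lambda>q. (fst q, u, snd q)" and T'="\<lambda>q. (fst q, 0, snd q)" and a="(0, u, 0)"])
      (auto simp: scaleC_prod_def scaleC_vec_def scaleC_complex_def vec_eq_iff
        intro!: bounded_linear_Pair bounded_linear_fst bounded_linear_snd bounded_linear_zero)
  then show ?thesis by simp
qed

lemma holo_at_epstein_formula_left:
  fixes A :: "real ^ 'd ^ 'd" and \<alpha> :: "nat ^ 'd"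
  assumes "gauss_summable L" "gauss_summable M" "snd p \<in> D_set L" "v \<in> D_set M"
    and "\<omega> = 0 \<or> fst p \<noteq> of_nat (CARD('d) + multi_abs \<alpha>)"
  shows "holo_at (\<lambda>p. epstein_formula A \<alpha> L M \<omega> \<tau> (fst p) (snd p) v) p"
proof -
  have "holo_at (\<lambda>p. epstein_formula A \<alpha> L M \<omega> \<tau> (fst p) (fst (snd p)) (snd (snd p))) (fst p, snd p, v)"
    by (rule holo_at_epstein_formula) (use assms in auto)
  then have "holo_at (\<lambda>q. (\<lambda>p. epstein_formula A \<alpha> L M \<omega> \<tau> (fst p) (fst (snd p)) (snd (snd p))) (fst q, snd q, v)) p"
    by (rule holo_at_comp_affine[where T="\<lambda>q. (fst q, snd q, v)" and T'="\<lambda>q. (fst q, snd q, 0)" and a="(0, 0, v)"])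
      (auto simp: scaleC_prod_def scaleC_vec_def scaleC_complex_def vec_eq_iff
        intro!: bounded_linear_Pair bounded_linear_fst bounded_linear_snd bounded_linear_zero)
  then show ?thesis by simp
qed

lemma epstein_formula_holomorphic:
  fixes A :: "real ^ 'd ^ 'd" and \<alpha> :: "nat ^ 'd"
  assumes "gauss_summable L" "gauss_summable M" "u \<in> D_set L" "v \<in> D_set M"
  shows "(\<lambda>\<nu>. epstein_formula A \<alpha> L M 0 \<tau> \<nu> u v) holomorphic_on UNIV"
proof (rule holomorphic_onI)
  fix \<nu> :: complex
  have "holo_at (\<lambda>p. epstein_formula A \<alpha> L M 0 \<tau> (fst p) u (snd p)) (\<nu>, v)"
    by (rule holo_at_epstein_formula_right) (use assms in auto)
  then have "holo_at (\<lambda>\<nu>. (\<lambda>p. epstein_formula A \<alpha> L M 0 \<tau> (fst p) u (snd p)) (\<nu>, v)) \<nu>"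
    by (rule holo_at_comp_affine[where T="\<lambda>\<nu>. (\<nu>, v)" and T'="\<lambda>\<nu>. (\<nu>, 0)" and a="(0, v)"])
      (auto simp: scaleC_prod_def scaleC_vec_def scaleC_complex_def vec_eq_iff
        intro!: bounded_linear_Pair bounded_linear_ident bounded_linear_zero)
  then show "(\<lambda>\<nu>. epstein_formula A \<alpha> L M 0 \<tau> \<nu> u v) field_differentiable at \<nu> within UNIV"
    using holo_at_imp_field_differentiable by simp
qed

section \<open>The pole and the identification with the zeta function\<close>

definition epstein_numerator :: "real ^ 'd ^ 'd \<Rightarrow> nat ^ 'd \<Rightarrow> (real ^ 'd) set \<Rightarrow> (real ^ 'd) set \<Rightarrow> complex \<Rightarrow> complex \<Rightarrow>
    complex ^ 'd \<Rightarrow> complex ^ 'd \<Rightarrow> complex \<Rightarrow> complex" where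
  "epstein_numerator A \<alpha> L M \<omega> \<tau> u v \<nu> =
     epstein_formula A \<alpha> L M 0 \<tau> \<nu> u v * (\<nu> - of_nat (CARD('d) + multi_abs \<alpha>)) +
     exp (\<nu> / 2 * of_real (ln pi)) * rGamma (\<nu> / 2) * (2 * poisson_const A * \<omega>)"

text \<open>The polar part is split off from the formula with \<open>\<omega> = 0\<close>. The
  numerator is written without division by the linear factor, hence entire, and its value at the
  pole reduces to the term with \<omega>.\<close>

lemma epstein_formula_eq_numerator:
  fixes A :: "real ^ 'd ^ 'd" and \<alpha> :: "nat ^ 'd"
  assumes "\<nu> \<noteq> of_nat (CARD('d) + multi_abs \<alpha>)"
  shows "epstein_formula A \<alpha> L M \<omega> \<tau> \<nu> u v =
    epstein_numerator A \<alpha> L M \<omega> \<tau> u v \<nu> / (\<nu> - of_nat (CARD('d) + multi_abs \<alpha>))"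
proof -
  have n: "\<nu> - of_nat (CARD('d) + multi_abs \<alpha>) \<noteq> 0" using assms by simp
  have "epstein_formula A \<alpha> L M \<omega> \<tau> \<nu> u v = epstein_formula A \<alpha> L M 0 \<tau> \<nu> u v +
      exp (\<nu> / 2 * of_real (ln pi)) * rGamma (\<nu> / 2) * (2 * poisson_const A * \<omega>) / (\<nu> - of_nat (CARD('d) + multi_abs \<alpha>))"
  proof -
    have *: "c * (r * (E1 + E2 + 2 * P * w / D) - t) = c * (r * (E1 + E2 + 2 * P * 0 / D) - t) + c * r * (2 * P * w) / D"
      for c r E1 E2 P w D t :: complex
      by (simp add: algebra_simps)
    show ?thesis unfolding epstein_formula_def by (rule *)
  qed
  then show ?thesis
    unfolding epstein_numerator_def add_divide_distrib using n by simp
qed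

lemma epstein_numerator_properties:
  fixes A :: "real ^ 'd ^ 'd" and \<alpha> :: "nat ^ 'd"
  assumes "gauss_summable L" "gauss_summable M" "u \<in> D_set L" "v \<in> D_set M"
  shows "epstein_numerator A \<alpha> L M \<omega> \<tau> u v holomorphic_on UNIV"
    and "invertible A \<Longrightarrow> \<omega> \<noteq> 0 \<Longrightarrow> epstein_numerator A \<alpha> L M \<omega> \<tau> u v (of_nat (CARD('d) + multi_abs \<alpha>)) \<noteq> 0"
proof -
  show "epstein_numerator A \<alpha> L M \<omega> \<tau> u v holomorphic_on UNIV"
    unfolding epstein_numerator_def[abs_def]
    by (intro holomorphic_intros holomorphic_rGamma' epstein_formula_holomorphic assms) auto
  assume A: "invertible A" and \<omega>: "\<omega> \<noteq> 0"
  let ?N = "CARD('d) + multi_abs \<alpha>"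
  \<comment> \<open>The zeros of \<open>rGamma\<close> are the nonpositive integers, and the
    dimension is at least 1, so the factor \<open>rGamma (\<nu> / 2)\<close> cannot cancel the
    pole.\<close>
  have "rGamma (of_nat ?N / 2 :: complex) \<noteq> 0"
  proof -
    have "0 < real ?N" by (simp del: of_nat_add)
    then have "Re (of_nat ?N / 2) > 0" by (simp del: of_nat_add)
    moreover have "Re z \<le> 0" if "z \<in> \<int>\<^sub>\<le>\<^sub>0" for z :: complex
      using that by (auto elim!: nonpos_Ints_cases)
    ultimately show ?thesis unfolding rGamma_eq_zero_iff by (meson not_le)
  qed
  then show "epstein_numerator A \<alpha> L M \<omega> \<tau> u v (of_nat ?N) \<noteq> 0"
    using poisson_const_nonzero[OF A] \<omega> by (simp add: epstein_numerator_def del: of_nat_add)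
qed

text \<open>The value of \<open>f\<close> at \<open>z\<close> itself is left open, because the
  formula and the zeta function carry conventional values there.\<close>

lemma has_simple_pole_divide:
  assumes g: "g holomorphic_on UNIV" "g z \<noteq> 0" and f: "\<And>w. w \<noteq> z \<Longrightarrow> f w = g w / (w - z)"
  shows "has_simple_pole f z"
  unfolding has_simple_pole_def
proof (intro conjI)
  have ev: "\<forall>\<^sub>F w in at z. g w / (w - z) ^ 1 = f w"
    using f by (auto simp: eventually_at_filter)
  have "is_pole (\<lambda>w. g w / (w - z) ^ 1) z"
    by (rule is_pole_basic[of g UNIV]) (use g in auto)
  then show "is_pole f z" using is_pole_cong[OF ev refl] by simp
  have "(\<lambda>w. g w / (w - z)) holomorphic_on UNIV - {z}"
    by (intro holomorphic_intros holomorphic_on_subset[OF g(1)]) auto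
  then have "f holomorphic_on UNIV - {z}"
    by (rule holomorphic_transform) (use f in auto)
  then show "isolated_singularity_at f z"
    by (rule isolated_singularity_at_holomorphic) auto
  show "zorder f z = - 1"
    by (rule zorder_eqI[of UNIV z g]) (use g f in \<open>auto simp: power_int_minus divide_inverse\<close>)
qed

text \<open>The value 0 at the pole is what a nicely meromorphic function takes there; it makes this
  function the canonical representative to which uniqueness of the continuation applies.\<close>

lemma nicely_meromorphic_simple_pole:
  fixes g :: "complex \<Rightarrow> complex"
  assumes g: "g holomorphic_on UNIV" "g z0 \<noteq> 0"
  shows "(\<lambda>w. if w = z0 then 0 else g w / (w - z0)) nicely_meromorphic_on UNIV" (is "?f nicely_meromorphic_on _")
  unfolding nicely_meromorphic_on_def
proof (intro conjI ballI)
  have "g meromorphic_on UNIV"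
    using g(1) analytic_on_open open_UNIV analytic_on_imp_meromorphic_on by blast
  then have "(\<lambda>w. g w / (w - z0)) meromorphic_on UNIV"
    by (intro meromorphic_intros)
  moreover have "\<forall>\<^sub>F w in at z. ?f w = g w / (w - z0)" for z
  proof -
    have "open (UNIV - {z0})" by (simp add: open_Diff)
    show ?thesis
    proof (cases "z = z0")
      case True
      then show ?thesis by (auto simp: eventually_at_filter)
    next
      case False
      then have "\<forall>\<^sub>F w in at z. w \<in> UNIV - {z0}"
        using eventually_at_in_open'[OF \<open>open (UNIV - {z0})\<close>] by auto
      then show ?thesis by eventually_elim auto
    qed
  qed
  ultimately show "?f meromorphic_on UNIV"
    using meromorphic_on_cong[of UNIV ?f "\<lambda>w. g w / (w - z0)" UNIV] by auto
  fix z
  show "is_pole ?f z \<and> ?f z = 0 \<or> ?f \<midarrow>z\<rightarrow> ?f z"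
  proof (cases "z = z0")
    case True
    have "has_simple_pole ?f z0" by (rule has_simple_pole_divide[OF g]) simp
    then show ?thesis using True by (simp add: has_simple_pole_def)
  next
    case False
    have "(\<lambda>w. g w / (w - z0)) holomorphic_on UNIV - {z0}"
      by (intro holomorphic_intros holomorphic_on_subset[OF g(1)]) auto
    then have "?f holomorphic_on UNIV - {z0}"
      by (rule holomorphic_transform) auto
    then have "isCont ?f z"
      using False by (intro continuous_on_interior[of "UNIV - {z0}"] holomorphic_on_imp_continuous_on)
        (auto simp: interior_open open_Diff)
    then show ?thesis by (simp add: isCont_def)
  qed
qed

text \<open>Agreement with the series on a nonempty open half plane determines the continuation. The
  two shapes differ at the pole: for \<open>\<omega> \<noteq> 0\<close> the formula, where division
  by 0 gives 0, would retain its regular part at N, while the continuation must be 0 there.\<close>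

lemma epstein_zeta_eq:
  fixes A :: "real ^ 'd ^ 'd" and x y :: "real ^ 'd" and \<alpha> :: "nat ^ 'd"
  assumes A: "invertible A"
  defines "\<Lambda> \<equiv> lattice_of A" and "\<Lambda>' \<equiv> reciprocal_lattice_of A"
    and "N \<equiv> of_nat (CARD('d) + multi_abs \<alpha>) :: complex"
  defines "\<omega> \<equiv> (if y \<in> \<Lambda>' then multi_hermite \<alpha> 0 else 0)"
    and "\<tau> \<equiv> (if x \<in> \<Lambda> then complex_of_real (multi_power 0 \<alpha>) else 0)"
  shows "\<omega> = 0 \<Longrightarrow> epstein_zeta \<Lambda> \<nu> \<alpha> x y =
      epstein_formula A \<alpha> (\<Lambda> - {x}) (\<Lambda>' - {y}) 0 \<tau> \<nu> (complex_vec x) (complex_vec y)"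
    and "\<omega> \<noteq> 0 \<Longrightarrow> epstein_zeta \<Lambda> \<nu> \<alpha> x y = (if \<nu> = N then 0 else
      epstein_numerator A \<alpha> (\<Lambda> - {x}) (\<Lambda>' - {y}) \<omega> \<tau> (complex_vec x) (complex_vec y) \<nu> / (\<nu> - N))"
proof -
  let ?L = "\<Lambda> - {x}" and ?M = "\<Lambda>' - {y}" and ?u = "complex_vec x" and ?v = "complex_vec y"
  let ?U = "{s. Re s > real (CARD('d) + multi_abs \<alpha>)}"
  have L: "gauss_summable ?L"
    unfolding \<Lambda>_def by (rule gauss_summable_subset[OF gauss_summable_lattice[OF A]]) auto
  have M: "gauss_summable ?M"
    unfolding \<Lambda>'_def reciprocal_lattice_of_def
    by (rule gauss_summable_subset[OF gauss_summable_lattice[OF matrix_inv_invertible(4)[OF A]]]) auto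
  have u: "?u \<in> D_set ?L" and v: "?v \<in> D_set ?M" by (simp_all add: complex_vec_in_D_set_iff)
  have U: "open ?U" "?U \<noteq> {}"
  proof -
    show "open ?U" by (rule open_halfspace_Re_gt)
    have "of_real (real (CARD('d) + multi_abs \<alpha>) + 1) \<in> ?U" by simp
    then show "?U \<noteq> {}" by blast
  qed
  have series: "epstein_series \<Lambda> \<alpha> x y s = epstein_formula A \<alpha> ?L ?M \<omega> \<tau> s ?u ?v" if "s \<in> ?U" for s
    using epstein_series_eq_formula[OF A, of \<alpha> s x y] that
    unfolding \<Lambda>_def \<Lambda>'_def \<omega>_def \<tau>_def by simp
  show "epstein_zeta \<Lambda> \<nu> \<alpha> x y = epstein_formula A \<alpha> ?L ?M 0 \<tau> \<nu> ?u ?v" if "\<omega> = 0"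
  proof -
    let ?g = "\<lambda>\<nu>. epstein_formula A \<alpha> ?L ?M 0 \<tau> \<nu> ?u ?v"
    have "?g analytic_on UNIV"
      using epstein_formula_holomorphic[OF L M u v] by (simp add: analytic_on_open)
    then have "is_meromorphic_continuation (epstein_series \<Lambda> \<alpha> x y) ?U ?g"
      unfolding is_meromorphic_continuation_def
      using series that analytic_on_imp_nicely_meromorphic_on by auto
    from meromorphic_continuation_eqI[OF this U] show ?thesis by (simp add: epstein_zeta_def)
  qed
  show "epstein_zeta \<Lambda> \<nu> \<alpha> x y = (if \<nu> = N then 0 else
      epstein_numerator A \<alpha> ?L ?M \<omega> \<tau> ?u ?v \<nu> / (\<nu> - N))" if \<omega>: "\<omega> \<noteq> 0"
  proof -
    let ?g = "\<lambda>\<nu>. if \<nu> = N then 0 else epstein_numerator A \<alpha> ?L ?M \<omega> \<tau> ?u ?v \<nu> / (\<nu> - N)"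
    have "?g nicely_meromorphic_on UNIV"
      using epstein_numerator_properties[OF L M u v, where A=A and \<alpha>=\<alpha> and \<omega>=\<omega> and \<tau>=\<tau>, folded N_def]
        A \<omega> by (intro nicely_meromorphic_simple_pole)
    moreover have "?g s = epstein_series \<Lambda> \<alpha> x y s" if s: "s \<in> ?U" for s
    proof -
      have "s \<noteq> N" using s by (auto simp: N_def simp del: of_nat_add)
      then show ?thesis
        unfolding series[OF s] using epstein_formula_eq_numerator[of s \<alpha> A, folded N_def] by simp
    qed
    ultimately have "is_meromorphic_continuation (epstein_series \<Lambda> \<alpha> x y) ?U ?g"
      unfolding is_meromorphic_continuation_def by blast
    from meromorphic_continuation_eqI[OF this U] show ?thesis by (simp add: epstein_zeta_def)
  qed
qed

theorem theorem2p11: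
  fixes A :: "real ^ 'd ^ 'd" and \<Lambda> \<Lambda>' :: "(real ^ 'd) set"
    and \<alpha> :: "nat ^ 'd" and \<nu>\<^sub>0 :: complex
  assumes regular: "invertible A"
    and lattice: "\<Lambda> = lattice_of A"
    and reciprocal: "\<Lambda>' = reciprocal_lattice_of A"
    and pole: "\<nu>\<^sub>0 = of_nat (CARD('d) + multi_abs \<alpha>)"
  shows
    "(\<exists>F. jointly_holomorphic_on F (UNIV \<times> D_set \<Lambda> \<times> D_set \<Lambda>') \<and>
        (\<forall>\<nu> x y. x \<notin> \<Lambda> \<longrightarrow> y \<notin> \<Lambda>' \<longrightarrow>
           F (\<nu>, complex_vec x, complex_vec y) = epstein_zeta \<Lambda> \<nu> \<alpha> x y)) \<and>
     (\<forall>x\<in>\<Lambda>. \<exists>F. jointly_holomorphic_on F (UNIV \<times> D_set \<Lambda>') \<and>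
        (\<forall>\<nu> y. y \<notin> \<Lambda>' \<longrightarrow> F (\<nu>, complex_vec y) = epstein_zeta \<Lambda> \<nu> \<alpha> x y)) \<and>
     (\<forall>y\<in>\<Lambda>'.
        (even_indicator \<alpha> = 0 \<longrightarrow>
          (\<exists>F. jointly_holomorphic_on F (UNIV \<times> D_set \<Lambda>) \<and>
             (\<forall>\<nu> x. x \<notin> \<Lambda> \<longrightarrow> F (\<nu>, complex_vec x) = epstein_zeta \<Lambda> \<nu> \<alpha> x y))) \<and>
        (even_indicator \<alpha> = 1 \<longrightarrow>
          (\<exists>F. jointly_holomorphic_on F ((UNIV - {\<nu>\<^sub>0}) \<times> D_set \<Lambda>) \<and>
             (\<forall>\<nu> x. \<nu> \<noteq> \<nu>\<^sub>0 \<longrightarrow> x \<notin> \<Lambda> \<longrightarrow>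
                F (\<nu>, complex_vec x) = epstein_zeta \<Lambda> \<nu> \<alpha> x y) \<and>
             (\<forall>u\<in>D_set \<Lambda>. has_simple_pole (\<lambda>\<nu>. F (\<nu>, u)) \<nu>\<^sub>0)))) \<and>
     (\<forall>x\<in>\<Lambda>. \<forall>y\<in>\<Lambda>'.
        (even_indicator \<alpha> = 0 \<longrightarrow>
          (\<lambda>\<nu>. epstein_zeta \<Lambda> \<nu> \<alpha> x y) holomorphic_on UNIV) \<and>
        (even_indicator \<alpha> = 1 \<longrightarrow>
          (\<lambda>\<nu>. epstein_zeta \<Lambda> \<nu> \<alpha> x y) holomorphic_on (UNIV - {\<nu>\<^sub>0}) \<and>
          has_simple_pole (\<lambda>\<nu>. epstein_zeta \<Lambda> \<nu> \<alpha> x y) \<nu>\<^sub>0))"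
proof -
  have gL: "gauss_summable \<Lambda>" unfolding lattice by (rule gauss_summable_lattice[OF regular])
  have gM: "gauss_summable \<Lambda>'"
    unfolding reciprocal reciprocal_lattice_of_def
    by (rule gauss_summable_lattice[OF matrix_inv_invertible(4)[OF regular]])
  have gLx: "gauss_summable (\<Lambda> - X)" and gMx: "gauss_summable (\<Lambda>' - X)" for X
    using gauss_summable_subset[OF gL] gauss_summable_subset[OF gM] by auto
  have oL: "open (D_set \<Lambda>)" and oM: "open (D_set \<Lambda>')"
    using open_D_set gauss_summable_imp_closed gL gM by blast+
  note zeta = epstein_zeta_eq[OF regular, folded lattice reciprocal, of _ \<alpha>, folded pole]
  have sub: "u \<in> D_set S \<Longrightarrow> u \<in> D_set (S - X)" for u :: "complex ^ 'd" and S X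
    by (auto simp: D_set_def)
  \<comment> \<open>Once its own point is deleted, a lattice point lies in the domain; this gives
    access to the cases with \<open>x\<close> or \<open>y\<close> on the lattices.\<close>
  have self: "complex_vec x \<in> D_set (S - {x})" for x :: "real ^ 'd" and S
    by (simp add: complex_vec_in_D_set_iff)
  let ?\<omega> = "multi_hermite \<alpha> 0" and ?\<tau> = "complex_of_real (multi_power 0 \<alpha>)"
  have \<omega>: "even_indicator \<alpha> = 0 \<Longrightarrow> ?\<omega> = 0" "even_indicator \<alpha> = 1 \<Longrightarrow> ?\<omega> \<noteq> 0"
    by (erule multi_hermite_zero)+
  show ?thesis
  proof (intro conjI ballI impI)
    let ?F = "\<lambda>p. epstein_formula A \<alpha> \<Lambda> \<Lambda>' 0 0 (fst p) (fst (snd p)) (snd (snd p))"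
    have "jointly_holomorphic_on ?F (UNIV \<times> D_set \<Lambda> \<times> D_set \<Lambda>')"
      unfolding jointly_holomorphic_on_iff_holo_at
      using oL oM by (auto intro!: open_Times holo_at_epstein_formula[OF gL gM])
    moreover have "?F (\<nu>, complex_vec x, complex_vec y) = epstein_zeta \<Lambda> \<nu> \<alpha> x y"
      if "x \<notin> \<Lambda>" "y \<notin> \<Lambda>'" for \<nu> x y
      using zeta(1)[of y \<nu> x] that by simp
    ultimately show "\<exists>F. jointly_holomorphic_on F (UNIV \<times> D_set \<Lambda> \<times> D_set \<Lambda>') \<and>
        (\<forall>\<nu> x y. x \<notin> \<Lambda> \<longrightarrow> y \<notin> \<Lambda>' \<longrightarrow> F (\<nu>, complex_vec x, complex_vec y) = epstein_zeta \<Lambda> \<nu> \<alpha> x y)"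
      by (intro exI[of _ ?F]) simp
  next
    fix x assume x: "x \<in> \<Lambda>"
    \<comment> \<open>The deleted term at \<open>x\<close> has the weight
      \<open>multi_power 0 \<alpha>\<close>, which is 1 for \<alpha> = 0 and 0 otherwise.\<close>
    let ?F = "\<lambda>p. epstein_formula A \<alpha> (\<Lambda> - {x}) \<Lambda>' 0 ?\<tau> (fst p) (complex_vec x) (snd p)"
    have "jointly_holomorphic_on ?F (UNIV \<times> D_set \<Lambda>')"
      unfolding jointly_holomorphic_on_iff_holo_at
      using oM by (auto intro!: open_Times holo_at_epstein_formula_right[OF gLx gM self])
    moreover have "?F (\<nu>, complex_vec y) = epstein_zeta \<Lambda> \<nu> \<alpha> x y" if "y \<notin> \<Lambda>'" for \<nu> y
      using zeta(1)[of y \<nu> x] that x by simp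
    ultimately show "\<exists>F. jointly_holomorphic_on F (UNIV \<times> D_set \<Lambda>') \<and>
        (\<forall>\<nu> y. y \<notin> \<Lambda>' \<longrightarrow> F (\<nu>, complex_vec y) = epstein_zeta \<Lambda> \<nu> \<alpha> x y)"
      by (intro exI[of _ ?F]) simp
  next
    fix y assume y: "y \<in> \<Lambda>'" and even: "even_indicator \<alpha> = 0"
    \<comment> \<open>The weight of the deleted dual term is the Hermite value at 0, which vanishes
      here because some component of \<alpha> is odd; so no polar term is left.\<close>
    let ?F = "\<lambda>p. epstein_formula A \<alpha> \<Lambda> (\<Lambda>' - {y}) 0 0 (fst p) (snd p) (complex_vec y)"
    have "jointly_holomorphic_on ?F (UNIV \<times> D_set \<Lambda>)"
      unfolding jointly_holomorphic_on_iff_holo_at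
      using oL by (auto intro!: open_Times holo_at_epstein_formula_left[OF gL gMx _ self])
    moreover have "?F (\<nu>, complex_vec x) = epstein_zeta \<Lambda> \<nu> \<alpha> x y" if "x \<notin> \<Lambda>" for \<nu> x
      using zeta(1)[of y \<nu> x] that \<omega>(1)[OF even] by simp
    ultimately show "\<exists>F. jointly_holomorphic_on F (UNIV \<times> D_set \<Lambda>) \<and>
        (\<forall>\<nu> x. x \<notin> \<Lambda> \<longrightarrow> F (\<nu>, complex_vec x) = epstein_zeta \<Lambda> \<nu> \<alpha> x y)"
      by (intro exI[of _ ?F]) simp
  next
    fix y assume y: "y \<in> \<Lambda>'" and even: "even_indicator \<alpha> = 1"
    let ?F = "\<lambda>p. epstein_formula A \<alpha> \<Lambda> (\<Lambda>' - {y}) ?\<omega> 0 (fst p) (snd p) (complex_vec y)"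
    have "jointly_holomorphic_on ?F ((UNIV - {\<nu>\<^sub>0}) \<times> D_set \<Lambda>)"
      unfolding jointly_holomorphic_on_iff_holo_at
    proof (intro conjI ballI)
      show "open ((UNIV - {\<nu>\<^sub>0}) \<times> D_set \<Lambda>)" using oL by (intro open_Times open_Diff) auto
      fix p assume "p \<in> (UNIV - {\<nu>\<^sub>0}) \<times> D_set \<Lambda>"
      then show "holo_at ?F p"
        by (intro holo_at_epstein_formula_left[OF gL gMx _ self]) (auto simp: pole)
    qed
    moreover have "?F (\<nu>, complex_vec x) = epstein_zeta \<Lambda> \<nu> \<alpha> x y" if "\<nu> \<noteq> \<nu>\<^sub>0" "x \<notin> \<Lambda>" for \<nu> x
      proof -
        have "epstein_zeta \<Lambda> \<nu> \<alpha> x y = epstein_numerator A \<alpha> \<Lambda> (\<Lambda>' - {y}) ?\<omega> 0 (complex_vec x) (complex_vec y) \<nu> / (\<nu> - \<nu>\<^sub>0)"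
          using zeta(2)[of y \<nu> x] that y \<omega>(2)[OF even] by simp
        then show ?thesis
          using epstein_formula_eq_numerator[OF that(1)[unfolded pole], where A=A, folded pole] by simp
      qed
    \<comment> \<open>At the pole the numerator reduces to its term with \<omega>, which does not
      involve \<open>u\<close>; the pole is therefore present for every complex \<open>u\<close> in
      the domain.\<close>
    moreover have "has_simple_pole (\<lambda>\<nu>. ?F (\<nu>, u)) \<nu>\<^sub>0" if u: "u \<in> D_set \<Lambda>" for u
    proof (rule has_simple_pole_divide)
      note props = epstein_numerator_properties[OF gL gMx u self[of y "\<Lambda>'"], where A=A and \<alpha>=\<alpha> and \<omega>="?\<omega>" and \<tau>=0, folded pole]
      show "epstein_numerator A \<alpha> \<Lambda> (\<Lambda>' - {y}) ?\<omega> 0 u (complex_vec y) holomorphic_on UNIV"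
        by (rule props)
      show "epstein_numerator A \<alpha> \<Lambda> (\<Lambda>' - {y}) ?\<omega> 0 u (complex_vec y) \<nu>\<^sub>0 \<noteq> 0"
        by (rule props(2)[OF regular \<omega>(2)[OF even]])
      show "?F (w, u) = epstein_numerator A \<alpha> \<Lambda> (\<Lambda>' - {y}) ?\<omega> 0 u (complex_vec y) w / (w - \<nu>\<^sub>0)" if "w \<noteq> \<nu>\<^sub>0" for w
        unfolding fst_conv snd_conv by (rule epstein_formula_eq_numerator[OF that[unfolded pole], folded pole])
    qed
    ultimately show "\<exists>F. jointly_holomorphic_on F ((UNIV - {\<nu>\<^sub>0}) \<times> D_set \<Lambda>) \<and>
         (\<forall>\<nu> x. \<nu> \<noteq> \<nu>\<^sub>0 \<longrightarrow> x \<notin> \<Lambda> \<longrightarrow> F (\<nu>, complex_vec x) = epstein_zeta \<Lambda> \<nu> \<alpha> x y) \<and>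
         (\<forall>u\<in>D_set \<Lambda>. has_simple_pole (\<lambda>\<nu>. F (\<nu>, u)) \<nu>\<^sub>0)"
      by (intro exI[of _ ?F] conjI allI impI ballI) blast+
  next
    fix x y assume x: "x \<in> \<Lambda>" and y: "y \<in> \<Lambda>'" and even: "even_indicator \<alpha> = 0"
    have "(\<lambda>\<nu>. epstein_zeta \<Lambda> \<nu> \<alpha> x y) =
        (\<lambda>\<nu>. epstein_formula A \<alpha> (\<Lambda> - {x}) (\<Lambda>' - {y}) 0 ?\<tau> \<nu> (complex_vec x) (complex_vec y))"
      using zeta(1)[of y _ x] x \<omega>(1)[OF even] by (auto simp: fun_eq_iff)
    then show "(\<lambda>\<nu>. epstein_zeta \<Lambda> \<nu> \<alpha> x y) holomorphic_on UNIV"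
      using epstein_formula_holomorphic[OF gLx gMx self self] by simp
  next
    fix x y assume x: "x \<in> \<Lambda>" and y: "y \<in> \<Lambda>'" and even: "even_indicator \<alpha> = 1"
    let ?G = "epstein_numerator A \<alpha> (\<Lambda> - {x}) (\<Lambda>' - {y}) ?\<omega> ?\<tau> (complex_vec x) (complex_vec y)"
    have eq: "epstein_zeta \<Lambda> \<nu> \<alpha> x y = ?G \<nu> / (\<nu> - \<nu>\<^sub>0)" if "\<nu> \<noteq> \<nu>\<^sub>0" for \<nu>
      using zeta(2)[of y \<nu> x] that x y \<omega>(2)[OF even] by simp
    note props = epstein_numerator_properties[OF gLx gMx self[of x \<Lambda>] self[of y "\<Lambda>'"], where A=A and \<alpha>=\<alpha> and \<omega>="?\<omega>" and \<tau>="?\<tau>", folded pole]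
    have "(\<lambda>\<nu>. ?G \<nu> / (\<nu> - \<nu>\<^sub>0)) holomorphic_on UNIV - {\<nu>\<^sub>0}"
      by (intro holomorphic_intros holomorphic_on_subset[OF props(1)]) auto
    then show "(\<lambda>\<nu>. epstein_zeta \<Lambda> \<nu> \<alpha> x y) holomorphic_on UNIV - {\<nu>\<^sub>0}"
      by (rule holomorphic_transform) (use eq in auto)
    show "has_simple_pole (\<lambda>\<nu>. epstein_zeta \<Lambda> \<nu> \<alpha> x y) \<nu>\<^sub>0"
      by (rule has_simple_pole_divide[OF props(1) props(2)[OF regular \<omega>(2)[OF even]] eq])
  qed
qed

end
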